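(* Let $\mathcal{P}_T>0$, $\sigma^2>0$ and let $N_B,N_E\ge 1$ be integers. Suppose $N_A=1$, the legitimate channel $\mathbf{h}\in\mathbb{C}^{N_B}$ is constant (deterministic), and the eavesdropper channel $\mathbf{g}\in\mathbb{C}^{N_E}$ has $N_E$ independent circularly symmetric complex Gaussian components of variance $\sigma^2$. Then for $r\ge0$ the minimum $\mathrm{SOP}^\star(r)$ of $\mathrm{SOP}(r)$ over all input distributions $p_{(u,x)}$ with $\mathbb{E}[|x|^2]\le\mathcal{P}_T$ is $$\mathrm{SOP}^\star(r)=\begin{cases}1-\dfrac{1}{(N_E-1)!}\,\Gamma_i\!\left(N_E,\ \dfrac{1}{2^r\mathcal{P}_T\sigma^2}+\dfrac{\lVert\mathbf{h}\rVert^2}{2^r\sigma^2}-\dfrac{1}{\mathcal{P}_T\sigma^2}\right), & \text{if } r\le\log(1+\mathcal{P}_T\lVert\mathbf{h}\rVert^2),\\[2mm] 1, & \text{if } r>\log(1+\mathcal{P}_T\lVert\mathbf{h}\rVert^2),\end{cases}$$ and the maximum $\mathrm{EPSR}^\star$ of $\mathrm{EPSR}$ over the same input distributions is $$\mathrm{EPSR}^\star=\int_0^{\log(1+\mathcal{P}_T\lVert\mathbf{h}\rVert^2)}\frac{1}{(N_E-1)!}\,\Gamma_i\!\left(N_E,\ \frac{1}{2^r\mathcal{P}_T\sigma^2}+\frac{\lVert\mathbf{h}\rVert^2}{2^r\sigma^2}-\frac{1}{\mathcal{P}_T\sigma^2}\right)dr.$$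
   Context: $\Gamma_i(s,t)=\int_0^t v^{s-1}e^{-v}\,dv$ is the (lower) incomplete gamma function; $\log$ is base 2; $\lVert\cdot\rVert$ is the Euclidean norm; $(t)^+=\max(0,t)$. Channel model (SIMOME: single transmit antenna). A message $u$, a random variable in an arbitrary set $\mathcal{U}$, is encoded into a complex random variable $x\in\mathbb{C}$; the joint law $p_{(u,x)}$ is the input distribution (the set $\mathcal U$, the law of $u$ and the conditional law of $x$ given $u$ are all free). The legitimate receiver observes $\mathbf{y}=\mathbf{h}x+\mathbf{w}_B\in\mathbb{C}^{N_B}$ and the eavesdropper observes $\mathbf{z}=\mathbf{g}x+\mathbf{w}_E\in\mathbb{C}^{N_E}$, where $\mathbf{g}$ is independent of $(u,x)$ and $\mathbf{w}_B,\mathbf{w}_E$ are circularly symmetric complex Gaussian noise vectors with identity covariance, independent of each other and of everything else. $I(u;\mathbf{y})$ and $I(u;\mathbf{z})$ denote the Shannon mutual informations (in bits) for the instantaneous channel states; in particular $I(u;\mathbf{z})$ means $I(u;\mathbf{z}\mid\mathbf{g}=\mathbf{g}_0)$ evaluated at $\mathbf{g}_0=\mathbf{g}$, a random variable. The metrics are $\mathrm{SOP}(r)=\mathbb{P}[I(u;\mathbf{y})-I(u;\mathbf{z})<r]$ and $\mathrm{EPSR}=\mathbb{E}\big[(I(u;\mathbf{y})-I(u;\mathbf{z}))^+\big]$, probability and expectation being over the channel states.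
   Formalization: The SOP formula is proved for r > 0 rather than r ≥ 0: at r = 0 it always fails, since a constant message u with x = 0 has P[I(u;y) − I(u;z) < 0] = 0, while the formula gives a strictly positive value. The EPSR claim is unchanged. *)

theory Defs
  imports "HOL-Probability.Probability"
begin

definition lower_inc_gamma :: "real \<Rightarrow> real \<Rightarrow> real" where
  "lower_inc_gamma s t = integral {0..t} (\<lambda>v. v powr (s - 1) * exp (- v))"

(* Lebesgue density on the complex plane of a circularly symmetric Gaussian z with E|z|^2 = v
   (so v/2 per real dimension). *)
definition cscg_density :: "real \<Rightarrow> complex \<Rightarrow> real" where
  "cscg_density v z = exp (- (norm z)\<^sup>2 / v) / (pi * v)"

(* Identity covariance: i.i.d. components of variance 1. *)
definition cscg_noise :: "(complex ^ 'n) measure" where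
  "cscg_noise = density lborel (\<lambda>w. ennreal (\<Prod>i\<in>UNIV. cscg_density 1 (w $ i)))"

(* An input distribution is the joint law of (u,x).  Of the measure U only the underlying
   measurable space, i.e. the message set with its sigma-algebra, matters. *)
definition admissible_input :: "'u measure \<Rightarrow> real \<Rightarrow> ('u \<times> complex) measure \<Rightarrow> bool" where
  "admissible_input U P p \<longleftrightarrow>
     prob_space p \<and> sets p = sets (U \<Otimes>\<^sub>M borel) \<and>
     (\<integral>\<^sup>+\<omega>. ennreal ((norm (snd \<omega>))\<^sup>2) \<partial>p) \<le> ennreal P"

(* Joint law of ((u,x),(w_B,w_E)) *)
definition transmission ::
    "('u \<times> complex) measure \<Rightarrow> (('u \<times> complex) \<times> (complex ^ 'b) \<times> (complex ^ 'e)) measure" where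
  "transmission p = p \<Otimes>\<^sub>M (cscg_noise \<Otimes>\<^sub>M cscg_noise)"

(* I(u;y) - I(u;z) in bits for the channel states h and g.  The library's mutual information is
   a Bochner integral of the log-likelihood ratio, hence meaningful only if the joint law is
   absolutely continuous with respect to the product of the marginals and the divergence is
   finite; for an admissible input both hold, by the Gaussian noise and the power constraint. *)
definition secrecy_rate ::
    "'u measure \<Rightarrow> ('u \<times> complex) measure \<Rightarrow> complex ^ 'b \<Rightarrow> complex ^ 'e \<Rightarrow> real" where
  "secrecy_rate U p h g =
     (let T = transmission p :: (('u \<times> complex) \<times> (complex ^ 'b) \<times> (complex ^ 'e)) measure;
          u = (\<lambda>((u, x), (wB, wE)). u);
          y = (\<lambda>((u, x), (wB, wE)). x *s h + wB);
          z = (\<lambda>((u, x), (wB, wE)). x *s g + wE)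
      in prob_space.mutual_information T 2 U borel u y
         - prob_space.mutual_information T 2 U borel u z)"

(* The channel states are random vectors h and g on the probability space M.  Since g is
   independent of (u,x) and of the noise, conditioning I(u;z) on the value g0 of g amounts to
   inserting g0 for the channel. *)
definition SOP ::
    "'u measure \<Rightarrow> ('u \<times> complex) measure \<Rightarrow> 's measure \<Rightarrow> ('s \<Rightarrow> complex ^ 'b) \<Rightarrow>
     ('s \<Rightarrow> complex ^ 'e) \<Rightarrow> real \<Rightarrow> real" where
  "SOP U p M h g r = measure M {\<omega> \<in> space M. secrecy_rate U p (h \<omega>) (g \<omega>) < r}"

definition EPSR ::
    "'u measure \<Rightarrow> ('u \<times> complex) measure \<Rightarrow> 's measure \<Rightarrow> ('s \<Rightarrow> complex ^ 'b) \<Rightarrow>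
     ('s \<Rightarrow> complex ^ 'e) \<Rightarrow> real" where
  "EPSR U p M h g = (\<integral>\<omega>. max 0 (secrecy_rate U p (h \<omega>) (g \<omega>)) \<partial>M)"

(* The function 1/(N-1)! Gamma_i(N, 1/(2^r P v) + |h|^2/(2^r v) - 1/(P v)); the last argument
   is H = |h|. *)
definition gamma_term :: "nat \<Rightarrow> real \<Rightarrow> real \<Rightarrow> real \<Rightarrow> real \<Rightarrow> real" where
  "gamma_term N P v H r =
     1 / fact (N - 1) *
     lower_inc_gamma (real N)
       (1 / (2 powr r * P * v) + H\<^sup>2 / (2 powr r * v) - 1 / (P * v))"

(* r = 0 has to be excluded from the formula for the minimal SOP: a message u independent of x
   (say x = 0) has I(u;y) = I(u;z) = 0, so that P[I(u;y) - I(u;z) < 0] = 0, whereas the value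
   of the formula at r = 0 is P[|g| >= |h|] > 0. *)

end

theory Submission
  imports Defs
begin

text \<open>
  For a deterministic gain vector \<open>h\<close> the scalar \<open>\<langle>e, y\<rangle>\<close>, where \<open>e\<close> is the direction of \<open>h\<close>, is a
  sufficient statistic for \<open>x\<close>, so \<open>I(u;y) = J(|h|)\<close> with \<open>J(a)\<close> the information that
  \<open>a x + w\<close> carries about \<open>u\<close>. For \<open>b = c a\<close> with \<open>0 \<le> c < 1\<close> the output at gain \<open>b\<close> is a degraded
  version of the output at gain \<open>a\<close>. In this coupling \<open>ln t \<le> t - 1\<close>, applied to ratios of
  likelihoods whose mean is at most one, gives both \<open>J(b) \<le> J(a)\<close> and
  \<open>J(a) - J(b) \<le> log ((1 + P a\<^sup>2) / (1 + P b\<^sup>2))\<close>; a Gaussian \<open>x = u\<close> attains equality in the latter.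
  Hence the positive part of the secrecy rate is maximised pointwise in the channel states, and the
  two formulas follow because \<open>|g|\<^sup>2\<close> has an Erlang distribution.
\<close>

section \<open>The standard complex Gaussian\<close>

text \<open>Let y and z be the coupled outputs at gains \<open>a\<close> and \<open>a * c\<close>.
  The gap bound is a chain rule: I(u;y) - I(u;z) equals [I(x;y) - I(x;z)] - [I(x;y|u) - I(x;z|u)].
  The second bracket is nonnegative by degradedness. The first is the mean of an explicit quadratic
  expression minus the drop, from y to z, of the relative entropy of the output to the Gaussian
  output; this drop is nonnegative too, and the power constraint controls the quadratic. Each
  nonnegativity claim becomes one ratio of likelihoods, so neither differential entropies nor a
  conditional law of x given u are formed. The message space is arbitrary, hence the likelihood
  given u is a Radon-Nikodym derivative, fixed only almost everywhere; every logarithm therefore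
  needs almost sure positivity and a proof of integrability. Densities are relative to the noise
  law: degradation is then a kernel of mass one that maps likelihoods at gain \<open>a\<close> to
  likelihoods at gain \<open>a * c\<close>. Monotonicity of J matters as much as the gap bound: it
  makes the secrecy rate nonpositive once |g| >= |h|.\<close>

lemma nn_integral_lborel_translate:
  fixes c :: "'a::euclidean_space"
  assumes [measurable]: "F \<in> borel_measurable borel"
  shows "(\<integral>\<^sup>+z. F (c + z) \<partial>lborel) = (\<integral>\<^sup>+z. F z \<partial>lborel)"
proof -
  have "(\<integral>\<^sup>+z. F z \<partial>lborel) = (\<integral>\<^sup>+z. F z \<partial>distr lborel borel ((+) c))"
    by (simp add: lborel_distr_plus)
  also have "\<dots> = (\<integral>\<^sup>+z. F (c + z) \<partial>lborel)"
    by (subst nn_integral_distr) auto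
  finally show ?thesis by simp
qed

lemma nn_integral_lborel_scale:
  fixes F :: "'a::euclidean_space \<Rightarrow> ennreal"
  assumes [measurable]: "F \<in> borel_measurable borel" and "c \<noteq> 0"
  shows "(\<integral>\<^sup>+z. F z \<partial>lborel) = ennreal (\<bar>c\<bar> ^ DIM('a)) * (\<integral>\<^sup>+z. F (c *\<^sub>R z) \<partial>lborel)"
proof -
  have "(\<integral>\<^sup>+z. F z \<partial>lborel) = (\<integral>\<^sup>+z. F z \<partial>density (distr lborel borel (\<lambda>x. 0 + c *\<^sub>R x)) (\<lambda>_. \<bar>c\<bar>^DIM('a)))"
    using lborel_affine[of c "0::'a"] assms by simp
  also have "\<dots> = (\<integral>\<^sup>+z. ennreal (\<bar>c\<bar>^DIM('a)) * F (c *\<^sub>R z) \<partial>lborel)"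
    by (subst nn_integral_density) (auto simp: nn_integral_distr)
  also have "\<dots> = ennreal (\<bar>c\<bar> ^ DIM('a)) * (\<integral>\<^sup>+z. F (c *\<^sub>R z) \<partial>lborel)"
    using assms by (subst nn_integral_cmult) auto
  finally show ?thesis .
qed

text \<open>A disc of radius r has area pi r^2, so |z|^2 pushes Lebesgue measure on the plane
  forward to pi times Lebesgue measure on the half-line.\<close>

lemma nn_integral_lborel_norm_squared:
  assumes [measurable]: "F \<in> borel_measurable borel"
  shows "(\<integral>\<^sup>+z. F ((norm (z::complex))\<^sup>2) \<partial>lborel) = ennreal pi * (\<integral>\<^sup>+t. F t * indicator {0..} t \<partial>lborel)"
proof -
  \<comment> \<open>The sign is flipped because the comparison runs over rays unbounded above: such
    a ray then pulls back to a disc, which has finite measure.\<close>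
  let ?M = "distr lborel borel (\<lambda>z::complex. - (norm z)\<^sup>2)"
  let ?N = "density lborel (\<lambda>t::real. ennreal pi * indicator {..0} t)"
  have MN: "?M = ?N"
  proof (rule measure_eqI_lessThan)
    fix x :: real
    have M: "emeasure ?M {x<..} = ennreal (pi * max 0 (- x))"
    proof (cases "x < 0")
      case True
      have "- (norm z)\<^sup>2 > x \<longleftrightarrow> norm z < sqrt (- x)" for z :: complex
        using real_sqrt_less_iff[of "(norm z)\<^sup>2" "- x"] by auto
      then have "(\<lambda>z::complex. - (norm z)\<^sup>2) -` {x<..} = ball 0 (sqrt (- x))"
        by auto
      then have "emeasure ?M {x<..} = emeasure lborel (ball (0::complex) (sqrt (- x)))"
        by (subst emeasure_distr) auto
      also have "\<dots> = ennreal (pi * (- x))"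
        using True by (simp add: emeasure_ball unit_ball_vol_2)
      finally show ?thesis using True by simp
    next
      case False
      then have "(\<lambda>z::complex. - (norm z)\<^sup>2) -` {x<..} = {}"
        by (auto dest: order.strict_trans2[of x _ 0])
      then show ?thesis using False by (subst emeasure_distr) auto
    qed
    have N: "emeasure ?N {x<..} = ennreal (pi * max 0 (- x))"
    proof -
      have "emeasure ?N {x<..} = (\<integral>\<^sup>+t. ennreal pi * indicator {x<..0} t \<partial>lborel)"
        by (subst emeasure_density) (auto intro!: nn_integral_cong split: split_indicator)
      also have "\<dots> = ennreal pi * emeasure lborel {x<..0}"
        by (subst nn_integral_cmult_indicator) auto
      also have "\<dots> = ennreal (pi * max 0 (- x))"
        by (cases "x \<le> 0") (simp_all flip: ennreal_mult')
      finally show ?thesis .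
    qed
    show "emeasure ?M {x<..} = emeasure ?N {x<..}" "emeasure ?M {x<..} < \<infinity>"
      unfolding M N by auto
  qed simp_all
  have "(\<integral>\<^sup>+z. F ((norm (z::complex))\<^sup>2) \<partial>lborel) = (\<integral>\<^sup>+t. F (- t) \<partial>?M)"
    by (subst nn_integral_distr) auto
  also have "\<dots> = (\<integral>\<^sup>+t. ennreal pi * indicator {..0} t * F (- t) \<partial>lborel)"
    unfolding MN by (subst nn_integral_density) auto
  also have "\<dots> = (\<integral>\<^sup>+t. ennreal pi * indicator {..0} (- t) * F t \<partial>lborel)"
    by (subst nn_integral_real_affine[where c="-1" and t=0]) auto
  also have "\<dots> = (\<integral>\<^sup>+t. ennreal pi * (F t * indicator {0..} t) \<partial>lborel)"
    by (auto intro!: nn_integral_cong split: split_indicator)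
  also have "\<dots> = ennreal pi * (\<integral>\<^sup>+t. F t * indicator {0..} t \<partial>lborel)"
    by (rule nn_integral_cmult) auto
  finally show ?thesis .
qed

lemma borel_measurable_cscg_density [measurable]: "cscg_density v \<in> borel_measurable borel"
  unfolding cscg_density_def by measurable

lemma cscg_density_nonneg: "0 \<le> v \<Longrightarrow> 0 \<le> cscg_density v z"
  unfolding cscg_density_def by simp

lemma nn_integral_cscg_density_norm_squared:
  assumes [measurable]: "F \<in> borel_measurable borel" and "v > 0"
  shows "(\<integral>\<^sup>+z. ennreal (cscg_density v z) * F ((norm z)\<^sup>2) \<partial>lborel) =
    (\<integral>\<^sup>+t. ennreal (exponential_density (1 / v) t) * F t \<partial>lborel)"
proof -
  have "(\<integral>\<^sup>+z. ennreal (cscg_density v z) * F ((norm z)\<^sup>2) \<partial>lborel) =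
     ennreal pi * (\<integral>\<^sup>+t. (ennreal (exp (- t / v) / (pi * v)) * F t) * indicator {0..} t \<partial>lborel)"
    unfolding cscg_density_def by (rule nn_integral_lborel_norm_squared) auto
  also have "\<dots> = (\<integral>\<^sup>+t. ennreal pi * ((ennreal (exp (- t / v) / (pi * v)) * F t) * indicator {0..} t) \<partial>lborel)"
    by (rule nn_integral_cmult[symmetric]) auto
  also have "\<dots> = (\<integral>\<^sup>+t. ennreal (exponential_density (1 / v) t) * F t \<partial>lborel)"
    using \<open>v > 0\<close>
    by (intro nn_integral_cong)
       (auto simp: exponential_density_def mult.assoc[symmetric] ennreal_mult[symmetric] split: split_indicator)
  finally show ?thesis .
qed

text \<open>The common reference measure of the scalar densities below: relative to it, the density
  of an output is a likelihood ratio against pure noise.\<close>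

definition cscg :: "complex measure" where
  "cscg = density lborel (\<lambda>z. ennreal (cscg_density 1 z))"

lemma sets_cscg [simp, measurable_cong]: "sets cscg = sets borel"
  and space_cscg [simp]: "space cscg = UNIV"
  by (simp_all add: cscg_def)

lemma nn_integral_cscg:
  assumes [measurable]: "F \<in> borel_measurable borel"
  shows "(\<integral>\<^sup>+z. F z \<partial>cscg) = (\<integral>\<^sup>+z. ennreal (cscg_density 1 z) * F z \<partial>lborel)"
  unfolding cscg_def by (subst nn_integral_density) auto

lemma nn_integral_cscg_density:
  assumes "v > 0" shows "(\<integral>\<^sup>+z. ennreal (cscg_density v z) \<partial>lborel) = 1"
proof -
  have "(\<integral>\<^sup>+z. ennreal (cscg_density v z) * 1 \<partial>lborel) =
    (\<integral>\<^sup>+t. ennreal (exponential_density (1 / v) t) * 1 \<partial>lborel)"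
    by (rule nn_integral_cscg_density_norm_squared) (use assms in auto)
  also have "\<dots> = 1"
    using prob_space.emeasure_space_1[OF prob_space_exponential_density[of "1/v"]] assms
    by (simp add: emeasure_density)
  finally show ?thesis by simp
qed

lemma prob_space_cscg: "prob_space cscg"
  by standard (simp add: cscg_def emeasure_density nn_integral_cscg_density)

interpretation cscg: prob_space cscg by (rule prob_space_cscg)

lemma nn_integral_gaussian:
  fixes m :: complex
  assumes "v > 0"
  shows "(\<integral>\<^sup>+z. ennreal (exp (- v * (norm (z - m))\<^sup>2)) \<partial>lborel) = ennreal (pi / v)"
proof -
  have "(\<integral>\<^sup>+z. ennreal (exp (- v * (norm (z - m))\<^sup>2)) \<partial>lborel) = (\<integral>\<^sup>+z. ennreal (exp (- v * (norm ((m + z) - m))\<^sup>2)) \<partial>lborel)"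
    by (rule nn_integral_lborel_translate[symmetric]) auto
  also have "\<dots> = (\<integral>\<^sup>+z. ennreal (pi / v) * ennreal (cscg_density (1/v) z) \<partial>lborel)"
    using assms by (intro nn_integral_cong) (auto simp: cscg_density_def ennreal_mult[symmetric] field_simps)
  also have "\<dots> = ennreal (pi / v)"
    using assms by (subst nn_integral_cmult) (auto simp: nn_integral_cscg_density)
  finally show ?thesis .
qed

lemma nn_integral_cscg_norm_squared: "(\<integral>\<^sup>+z. ennreal ((norm z)\<^sup>2) \<partial>cscg) = 1"
proof -
  have "(\<integral>\<^sup>+z. ennreal ((norm z)\<^sup>2) \<partial>cscg) = (\<integral>\<^sup>+t. ennreal (exponential_density (1 / 1) t) * ennreal t \<partial>lborel)"
    using nn_integral_cscg_density_norm_squared[of ennreal 1] by (simp add: nn_integral_cscg)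
  also have "\<dots> = (\<integral>\<^sup>+t. ennreal (erlang_density 0 1 t * t ^ 1) \<partial>lborel)"
    by (intro nn_integral_cong) (auto simp: ennreal_mult'[symmetric] erlang_density_def)
  also have "\<dots> = 1" by (subst nn_integral_erlang_ith_moment) auto
  finally show ?thesis .
qed

lemma nn_integral_cscg_uminus:
  assumes [measurable]: "F \<in> borel_measurable borel"
  shows "(\<integral>\<^sup>+w. F (- w) \<partial>cscg) = (\<integral>\<^sup>+w. F w \<partial>cscg)"
proof -
  have "(\<integral>\<^sup>+w. F w \<partial>cscg) = (\<integral>\<^sup>+w. ennreal (cscg_density 1 (- w)) * F (- w) \<partial>lborel)"
    using nn_integral_lborel_scale[of "\<lambda>w. ennreal (cscg_density 1 w) * F w" "-1"]
    by (simp add: nn_integral_cscg)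
  also have "\<dots> = (\<integral>\<^sup>+w. F (- w) \<partial>cscg)"
    by (subst nn_integral_cscg) (auto simp: cscg_density_def)
  finally show ?thesis by simp
qed

text \<open>Adding the copies for w and -w cancels the cross term by the parallelogram law, so that
  only nonnegative integrals occur.\<close>

lemma nn_integral_cscg_norm_add_squared:
  "(\<integral>\<^sup>+w. ennreal ((norm (m + w))\<^sup>2) \<partial>cscg) = ennreal ((norm m)\<^sup>2 + 1)"
proof -
  let ?I = "\<integral>\<^sup>+w. ennreal ((norm (m + w))\<^sup>2) \<partial>cscg"
  have "?I + ?I = ?I + (\<integral>\<^sup>+w. ennreal ((norm (m + - w))\<^sup>2) \<partial>cscg)"
    by (subst (2) nn_integral_cscg_uminus[symmetric]) auto
  also have "\<dots> = (\<integral>\<^sup>+w. ennreal ((norm (m + w))\<^sup>2) + ennreal ((norm (m + - w))\<^sup>2) \<partial>cscg)"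
    by (rule nn_integral_add[symmetric]) auto
  also have "\<dots> = (\<integral>\<^sup>+w. ennreal (2 * (norm m)\<^sup>2) + 2 * ennreal ((norm w)\<^sup>2) \<partial>cscg)"
  proof (rule nn_integral_cong)
    fix w
    have "(norm (m + w))\<^sup>2 + (norm (m + - w))\<^sup>2 = 2 * (norm m)\<^sup>2 + 2 * (norm w)\<^sup>2"
      unfolding cmod_power2 by (simp add: power2_eq_square algebra_simps)
    then show "ennreal ((norm (m + w))\<^sup>2) + ennreal ((norm (m + - w))\<^sup>2) = ennreal (2 * (norm m)\<^sup>2) + 2 * ennreal ((norm w)\<^sup>2)"
      by (simp add: ennreal_plus[symmetric] ennreal_mult'[symmetric] numeral_mult_ennreal del: ennreal_plus)
  qed
  also have "\<dots> = ennreal (2 * (norm m)\<^sup>2) + 2"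
    by (subst nn_integral_add) (auto simp: nn_integral_cmult nn_integral_cscg_norm_squared cscg.emeasure_space_1[simplified])
  also have "\<dots> = 2 * ennreal ((norm m)\<^sup>2 + 1)"
    by (simp add: ennreal_mult' distrib_left)
  finally have "2 * ?I = 2 * ennreal ((norm m)\<^sup>2 + 1)" by (simp add: mult_2)
  then show ?thesis
    by (subst (asm) ennreal_mult_cancel_left) auto
qed

section \<open>Likelihood ratios of shifted Gaussians\<close>

lemma complex_norm_diff_squared: "(norm (y - m))\<^sup>2 = (norm y)\<^sup>2 - 2 * Re (cnj m * y) + (norm m)\<^sup>2"
  for y m :: complex
  unfolding cmod_power2 by (simp add: power2_eq_square algebra_simps)

text \<open>The density of \<open>a *\<^sub>R x + w\<close> relative to the law of the noise w. The
  gain is a separate argument because the same x is later observed at two gains.\<close>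

definition lik :: "real \<Rightarrow> complex \<Rightarrow> complex \<Rightarrow> real" where
  "lik a x s = exp (2 * a * Re (cnj x * s) - a\<^sup>2 * (norm x)\<^sup>2)"

lemma lik_pos [simp]: "0 < lik a x s" by (simp add: lik_def)
lemma lik_nonneg [simp]: "0 \<le> lik a x s" by (simp add: lik_def)
lemma lik_neq_0 [simp]: "lik a x s \<noteq> 0" by (simp add: lik_def)
lemma borel_measurable_lik [measurable]: 
  "case_prod (lik a) \<in> borel_measurable (borel \<Otimes>\<^sub>M borel)"
  unfolding lik_def case_prod_beta borel_prod by (intro borel_measurable_continuous_onI continuous_intros)

lemma ln_lik: "ln (lik a x s) = (norm s)\<^sup>2 - (norm (s - a *\<^sub>R x))\<^sup>2"
  by (simp add: lik_def complex_norm_diff_squared power_mult_distrib)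

lemma cscg_density_lik: "cscg_density 1 (s - a *\<^sub>R x) = cscg_density 1 s * lik a x s"
  unfolding cscg_density_def lik_def
  by (simp add: complex_norm_diff_squared power_mult_distrib exp_add[symmetric] algebra_simps)

lemma nn_integral_cscg_shift:
  assumes [measurable]: "F \<in> borel_measurable borel"
  shows "(\<integral>\<^sup>+w. F (a *\<^sub>R x + w) \<partial>cscg) = (\<integral>\<^sup>+s. ennreal (lik a x s) * F s \<partial>cscg)"
proof -
  have "(\<integral>\<^sup>+w. F (a *\<^sub>R x + w) \<partial>cscg) = (\<integral>\<^sup>+w. ennreal (cscg_density 1 ((a *\<^sub>R x + w) - a *\<^sub>R x)) * F (a *\<^sub>R x + w) \<partial>lborel)"
    by (subst nn_integral_cscg) auto
  also have "\<dots> = (\<integral>\<^sup>+w. ennreal (cscg_density 1 (w - a *\<^sub>R x)) * F w \<partial>lborel)"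
    by (rule nn_integral_lborel_translate) auto
  also have "\<dots> = (\<integral>\<^sup>+s. ennreal (lik a x s) * F s \<partial>cscg)"
    by (subst nn_integral_cscg) (auto simp: cscg_density_lik ennreal_mult cscg_density_nonneg ac_simps)
  finally show ?thesis .
qed

lemma nn_integral_lik: "(\<integral>\<^sup>+s. ennreal (lik a x s) \<partial>cscg) = 1"
  using nn_integral_cscg_shift[of "\<lambda>_. 1" a x] cscg.emeasure_space_1 by simp

text \<open>Mehler's kernel of the complex Ornstein-Uhlenbeck semigroup: the density of
  \<open>c y + sqrt (1 - |c|^2) w\<close> with respect to the law of the standard Gaussian \<open>w\<close>.\<close>

definition mehler :: "complex \<Rightarrow> complex \<Rightarrow> complex \<Rightarrow> real" where
  "mehler c y z = exp (- ((norm c)\<^sup>2 * (norm z)\<^sup>2 + (norm c)\<^sup>2 * (norm y)\<^sup>2 - 2 * Re (cnj (c * y) * z)) / (1 - (norm c)\<^sup>2))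
     / (1 - (norm c)\<^sup>2)"

lemma borel_measurable_mehler [measurable]:
  "case_prod (mehler c) \<in> borel_measurable (borel \<Otimes>\<^sub>M borel)"
  unfolding mehler_def case_prod_beta borel_prod divide_inverse
  by (intro borel_measurable_continuous_onI continuous_intros)

lemma mehler_nonneg: "norm c < 1 \<Longrightarrow> 0 \<le> mehler c y z"
  by (simp add: mehler_def abs_square_le_1)

text \<open>Reversibility of the semigroup, with the conjugate as adjoint of multiplication by
  \<open>c\<close>. It turns integration over the first argument into integration over the second,
  which \<open>nn_integral_mehler_eq\<close> evaluates.\<close>

lemma mehler_cnj: "mehler c y z = mehler (cnj c) z y"
  by (simp add: mehler_def algebra_simps)

lemma nn_integral_mehler_eq:
  assumes [measurable]: "F \<in> borel_measurable borel" and c: "norm c < 1"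
  shows "(\<integral>\<^sup>+w. F (c * y + sqrt (1 - (norm c)\<^sup>2) *\<^sub>R w) \<partial>cscg) = (\<integral>\<^sup>+z. ennreal (mehler c y z) * F z \<partial>cscg)"
proof -
  define q where "q = 1 - (norm c)\<^sup>2"
  have q: "q > 0" using c by (simp add: q_def abs_square_less_1)
  have "(\<integral>\<^sup>+z. ennreal (mehler c y z) * F z \<partial>cscg) = (\<integral>\<^sup>+z. ennreal (cscg_density 1 z) * (ennreal (mehler c y z) * F z) \<partial>lborel)"
    by (subst nn_integral_cscg) auto
  also have "\<dots> = (\<integral>\<^sup>+z. ennreal (cscg_density q (z - c * y)) * F z \<partial>lborel)"
  proof (rule nn_integral_cong)
    fix z
    have "cscg_density 1 z * mehler c y z = cscg_density q (z - c * y)"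
    proof -
      \<comment> \<open>Completing the square: multiplied by the noise density, the kernel becomes
        the Gaussian density of variance \<open>q\<close> centred at \<open>c * y\<close>.\<close>
      have "- (norm z)\<^sup>2 + - ((norm c)\<^sup>2 * (norm z)\<^sup>2 + (norm c)\<^sup>2 * (norm y)\<^sup>2 - 2 * Re (cnj (c * y) * z)) / q
        = - (norm (z - c * y))\<^sup>2 / q"
        unfolding complex_norm_diff_squared[of z "c * y"] using q
        by (simp add: field_simps norm_mult power_mult_distrib) (simp add: q_def field_simps)
      then show ?thesis
        unfolding cscg_density_def mehler_def q_def[symmetric] by (simp add: exp_add[symmetric] mult.commute)
    qed
    then show "ennreal (cscg_density 1 z) * (ennreal (mehler c y z) * F z) = ennreal (cscg_density q (z - c * y)) * F z"
      by (metis (no_types) ennreal_mult' cscg_density_nonneg mult.assoc zero_le_one)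
  qed
  also have "\<dots> = (\<integral>\<^sup>+z. ennreal (cscg_density q ((c * y + z) - c * y)) * F (c * y + z) \<partial>lborel)"
    by (rule nn_integral_lborel_translate[symmetric]) auto
  \<comment> \<open>Since \<open>DIM(complex)\<close> is 2, the Jacobian is \<open>q\<close>, which
    cancels the normalisation of \<open>cscg_density q\<close>.\<close>
  also have "\<dots> = ennreal (\<bar>sqrt q\<bar> ^ DIM(complex)) * (\<integral>\<^sup>+z. ennreal (cscg_density q ((c * y + sqrt q *\<^sub>R z) - c * y)) * F (c * y + sqrt q *\<^sub>R z) \<partial>lborel)"
    using q by (intro nn_integral_lborel_scale) auto
  also have "\<dots> = (\<integral>\<^sup>+z. ennreal q * (ennreal (cscg_density q (sqrt q *\<^sub>R z)) * F (c * y + sqrt q *\<^sub>R z)) \<partial>lborel)"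
    using q by (subst nn_integral_cmult) (auto simp: )
  also have "\<dots> = (\<integral>\<^sup>+z. ennreal (cscg_density 1 z) * F (c * y + sqrt q *\<^sub>R z) \<partial>lborel)"
    using q
    by (intro nn_integral_cong)
       (auto simp: mult.assoc[symmetric] ennreal_mult'[symmetric] cscg_density_def power_mult_distrib)
  also have "\<dots> = (\<integral>\<^sup>+w. F (c * y + sqrt (1 - (norm c)\<^sup>2) *\<^sub>R w) \<partial>cscg)"
    unfolding q_def by (subst nn_integral_cscg) auto
  finally show ?thesis ..
qed

lemma nn_integral_mehler: "norm c < 1 \<Longrightarrow> (\<integral>\<^sup>+z. ennreal (mehler c y z) \<partial>cscg) = 1"
  using nn_integral_mehler_eq[of "\<lambda>_. 1" c y] cscg.emeasure_space_1 by simp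

lemma nn_integral_mehler': "norm c < 1 \<Longrightarrow> (\<integral>\<^sup>+y. ennreal (mehler c y z) \<partial>cscg) = 1"
  by (subst mehler_cnj) (simp add: nn_integral_mehler)

lemma lik_mult: "lik a x (of_real c * z + b *\<^sub>R w) = exp (2 * (a * c) * Re (cnj x * z) - a\<^sup>2 * (norm x)\<^sup>2 + (a * b)\<^sup>2 * (norm x)\<^sup>2) * lik (a * b) x w"
  by (simp add: lik_def exp_add[symmetric] algebra_simps)

text \<open>By reversibility the integral is the mean of the likelihood at a point c z + sqrt (1 -
  c^2) w. There it splits into a factor free of w and the likelihood of w at a smaller gain, whose
  mean is one. This is the action of degradation on likelihoods.\<close>

lemma nn_integral_mehler_lik:
  fixes c :: real assumes c: "\<bar>c\<bar> < 1"
  shows "(\<integral>\<^sup>+y. ennreal (mehler (of_real c) y z) * ennreal (lik a x y) \<partial>cscg) = ennreal (lik (a * c) x z)"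
proof -
  let ?b = "sqrt (1 - c\<^sup>2)"
  have b: "?b\<^sup>2 = 1 - c\<^sup>2" using c by (simp add: abs_square_le_1)
  have "(\<integral>\<^sup>+y. ennreal (mehler (of_real c) y z) * ennreal (lik a x y) \<partial>cscg)
    = (\<integral>\<^sup>+y. ennreal (mehler (of_real c) z y) * ennreal (lik a x y) \<partial>cscg)"
    by (subst mehler_cnj) simp
  also have "\<dots> = (\<integral>\<^sup>+w. ennreal (lik a x (of_real c * z + ?b *\<^sub>R w)) \<partial>cscg)"
    using c by (subst nn_integral_mehler_eq[symmetric]) auto
  also have "\<dots> = (\<integral>\<^sup>+w. ennreal (exp (2 * (a * c) * Re (cnj x * z) - a\<^sup>2 * (norm x)\<^sup>2 + (a * ?b)\<^sup>2 * (norm x)\<^sup>2)) * ennreal (lik (a * ?b) x w) \<partial>cscg)"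
    unfolding lik_mult by (simp add: ennreal_mult)
  also have "\<dots> = ennreal (exp (2 * (a * c) * Re (cnj x * z) - a\<^sup>2 * (norm x)\<^sup>2 + (a * ?b)\<^sup>2 * (norm x)\<^sup>2))"
    by (subst nn_integral_cmult) (auto simp: nn_integral_lik)
  also have "\<dots> = ennreal (lik (a * c) x z)"
    unfolding power_mult_distrib b by (simp add: lik_def algebra_simps)
  finally show ?thesis .
qed

text \<open>The density, relative to the standard Gaussian, of a circular Gaussian of variance
  \<open>1 + P * a\<^sup>2\<close>: the output law at gain \<open>a\<close> for a Gaussian input of
  power \<open>P\<close>.\<close>

definition mixlik :: "real \<Rightarrow> real \<Rightarrow> complex \<Rightarrow> real" where
  "mixlik P a s = exp ((norm s)\<^sup>2 - (norm s)\<^sup>2 / (1 + P * a\<^sup>2)) / (1 + P * a\<^sup>2)"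

lemma borel_measurable_mixlik [measurable]: "mixlik P a \<in> borel_measurable borel"
  unfolding mixlik_def by measurable

lemma mixlik_pos: "P \<ge> 0 \<Longrightarrow> 0 < mixlik P a s"
  by (simp add: mixlik_def add_pos_nonneg)

lemma mixlik_eq:
  assumes P: "P \<ge> 0"
  shows "(\<integral>\<^sup>+w. ennreal (lik a (sqrt P *\<^sub>R w) s) \<partial>cscg) = ennreal (mixlik P a s)"
proof -
  define v where "v = 1 + P * a\<^sup>2"
  have v: "v > 0" using P by (simp add: v_def add_pos_nonneg)
  have sP: "(sqrt P)\<^sup>2 = P" using P by simp
  \<comment> \<open>The posterior mean of w given s; the posterior variance is \<open>1 / v\<close>,
    so the exponent completes to a square around this point.\<close>
  let ?m = "(a * sqrt P / v) *\<^sub>R s"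
  have "(\<integral>\<^sup>+w. ennreal (lik a (sqrt P *\<^sub>R w) s) \<partial>cscg) = (\<integral>\<^sup>+w. ennreal (mixlik P a s * v / pi) * ennreal (exp (- v * (norm (w - ?m))\<^sup>2)) \<partial>lborel)"
  proof (subst nn_integral_cscg, measurable, rule nn_integral_cong)
    fix w
    have "- (norm w)\<^sup>2 + (2 * a * Re (cnj (sqrt P *\<^sub>R w) * s) - a\<^sup>2 * (norm (sqrt P *\<^sub>R w))\<^sup>2)
       = ((norm s)\<^sup>2 - (norm s)\<^sup>2 / v) + (- v * (norm (w - ?m))\<^sup>2)"
    proof -
      have 1: "(norm ?m)\<^sup>2 = a\<^sup>2 * P / v\<^sup>2 * (norm s)\<^sup>2"
        using P by (simp add: power_mult_distrib power_divide)
      have 2: "Re (cnj ?m * w) = a * sqrt P / v * Re (cnj w * s)"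
        by (simp add: algebra_simps)
      have 3: "(norm (sqrt P *\<^sub>R w))\<^sup>2 = P * (norm w)\<^sup>2" using P by (simp add: power_mult_distrib)
      have 4: "Re (cnj (sqrt P *\<^sub>R w) * s) = sqrt P * Re (cnj w * s)" by (simp add: algebra_simps)
      have 5: "1 - 1 / v = a\<^sup>2 * P / v" using v by (simp add: v_def field_simps)
      have 6: "v * (a\<^sup>2 * P / v\<^sup>2 * (norm s)\<^sup>2) = (1 - 1 / v) * (norm s)\<^sup>2"
        unfolding 5 using v by (simp add: power2_eq_square)
      have "- v * (norm (w - ?m))\<^sup>2 = - v * (norm w)\<^sup>2 + 2 * (v * (a * sqrt P / v)) * Re (cnj w * s) - v * (a\<^sup>2 * P / v\<^sup>2 * (norm s)\<^sup>2)"
        unfolding complex_norm_diff_squared[of w ?m] 1 2 by (simp add: algebra_simps)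
      also have "\<dots> = - v * (norm w)\<^sup>2 + 2 * (a * sqrt P) * Re (cnj w * s) - (1 - 1 / v) * (norm s)\<^sup>2"
        unfolding 6 using v by simp
      finally show ?thesis unfolding 3 4 by (simp add: v_def algebra_simps)
    qed
    then have "cscg_density 1 w * lik a (sqrt P *\<^sub>R w) s = mixlik P a s * v / pi * exp (- v * (norm (w - ?m))\<^sup>2)"
      using v unfolding cscg_density_def lik_def mixlik_def v_def[symmetric] by (simp add: exp_add[symmetric])
    then show "ennreal (cscg_density 1 w) * ennreal (lik a (sqrt P *\<^sub>R w) s) = 
      ennreal (mixlik P a s * v / pi) * ennreal (exp (- v * (norm (w - ?m))\<^sup>2))"
      using v mixlik_pos[OF P, of a s] by (simp add: ennreal_mult'[symmetric] cscg_density_nonneg)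
  qed
  also have "\<dots> = ennreal (mixlik P a s * v / pi) * ennreal (pi / v)"
    by (subst nn_integral_cmult) (auto simp: nn_integral_gaussian[OF v, unfolded mult_minus_left] )
  also have "\<dots> = ennreal (mixlik P a s)"
    using v mixlik_pos[OF P, of a s] by (simp add: ennreal_mult'[symmetric])
  finally show ?thesis .
qed

lemma nn_integral_mixlik: "P \<ge> 0 \<Longrightarrow> (\<integral>\<^sup>+s. ennreal (mixlik P a s) \<partial>cscg) = 1"
proof -
  assume P: "P \<ge> 0"
  interpret pair_sigma_finite cscg cscg ..
  have "(\<integral>\<^sup>+s. ennreal (mixlik P a s) \<partial>cscg) = (\<integral>\<^sup>+s. \<integral>\<^sup>+w. ennreal (lik a (sqrt P *\<^sub>R w) s) \<partial>cscg \<partial>cscg)"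
    using P by (simp add: mixlik_eq)
  also have "\<dots> = (\<integral>\<^sup>+w. \<integral>\<^sup>+s. ennreal (lik a (sqrt P *\<^sub>R w) s) \<partial>cscg \<partial>cscg)"
    by (rule Fubini') measurable
  finally show ?thesis using cscg.emeasure_space_1 by (simp add: nn_integral_lik)
qed

lemma nn_integral_mehler_mixlik:
  fixes c :: real assumes c: "\<bar>c\<bar> < 1" and P: "P \<ge> 0"
  shows "(\<integral>\<^sup>+y. ennreal (mehler (of_real c) y z) * ennreal (mixlik P a y) \<partial>cscg) = ennreal (mixlik P (a * c) z)"
proof -
  interpret pair_sigma_finite cscg cscg ..
  have "(\<integral>\<^sup>+y. ennreal (mehler (of_real c) y z) * ennreal (mixlik P a y) \<partial>cscg)
    = (\<integral>\<^sup>+y. \<integral>\<^sup>+w. ennreal (mehler (of_real c) y z) * ennreal (lik a (sqrt P *\<^sub>R w) y) \<partial>cscg \<partial>cscg)"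
    using P by (simp add: mixlik_eq[symmetric] nn_integral_cmult)
  also have "\<dots> = (\<integral>\<^sup>+w. \<integral>\<^sup>+y. ennreal (mehler (of_real c) y z) * ennreal (lik a (sqrt P *\<^sub>R w) y) \<partial>cscg \<partial>cscg)"
    by (rule Fubini') measurable
  also have "\<dots> = ennreal (mixlik P (a * c) z)"
    using P by (simp add: nn_integral_mehler_lik[OF c] mixlik_eq)
  finally show ?thesis .
qed

section \<open>Likelihood ratios of an input distribution\<close>

lemma nonneg_nn_integral_le_imp_integral:
  assumes [measurable]: "f \<in> borel_measurable M" and nn: "\<And>x. 0 \<le> f x" and c: "0 \<le> c"
    and le: "(\<integral>\<^sup>+x. ennreal (f x) \<partial>M) \<le> ennreal c"
  shows "integrable M f" "integral\<^sup>L M f \<le> c"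
proof -
  show I: "integrable M f"
    using le nn by (intro integrableI_nonneg) (auto simp: le_less_trans[OF le])
  have "ennreal (integral\<^sup>L M f) \<le> ennreal c"
    using le nn by (subst nn_integral_eq_integral[OF I, symmetric]) auto
  then show "integral\<^sup>L M f \<le> c" using c by simp
qed

lemma nonneg_nn_integral_eq_imp_integral:
  assumes [measurable]: "f \<in> borel_measurable M" and nn: "\<And>x. 0 \<le> f x" and c: "0 \<le> c"
    and le: "(\<integral>\<^sup>+x. ennreal (f x) \<partial>M) = ennreal c"
  shows "integrable M f" "integral\<^sup>L M f = c"
proof -
  show I: "integrable M f"
    using le nn by (intro integrableI_nonneg) auto
  have "ennreal (integral\<^sup>L M f) = ennreal c"
    using le nn by (subst nn_integral_eq_integral[OF I, symmetric]) auto
  then show "integral\<^sup>L M f = c" using c nn by simp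
qed

locale channel_input =
  fixes U :: "'u measure" and p :: "('u \<times> complex) measure" and P :: real
  assumes admissible: "admissible_input U P p" and P_pos: "P > 0"
begin

sublocale p: prob_space p
  using admissible by (simp add: admissible_input_def)

lemma sets_p [measurable_cong]: "sets p = sets (U \<Otimes>\<^sub>M borel)"
  using admissible by (simp add: admissible_input_def)

lemma measurable_fst_p [measurable]: "fst \<in> p \<rightarrow>\<^sub>M U" by measurable
lemma measurable_snd_p [measurable]: "snd \<in> p \<rightarrow>\<^sub>M borel" by measurable

definition pu :: "'u measure" where "pu = distr p U fst"

lemma sets_pu [simp, measurable_cong]: "sets pu = sets U"
  and space_pu [simp]: "space pu = space U"
  by (simp_all add: pu_def)

sublocale pu: prob_space pu
  unfolding pu_def by (rule p.prob_space_distr) measurable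

sublocale pxs: pair_prob_space p cscg ..
sublocale pus: pair_prob_space pu cscg ..
sublocale ss: pair_prob_space cscg cscg ..
sublocale pss: pair_prob_space p "cscg \<Otimes>\<^sub>M cscg" ..

definition mean_power :: real where "mean_power = (\<integral>\<omega>. (norm (snd \<omega>))\<^sup>2 \<partial>p)"

lemma nn_integral_mean_power: "(\<integral>\<^sup>+\<omega>. ennreal ((norm (snd \<omega>))\<^sup>2) \<partial>p) = ennreal mean_power"
  and mean_power_le: "mean_power \<le> P" and mean_power_nonneg: "0 \<le> mean_power"
proof -
  have le: "(\<integral>\<^sup>+\<omega>. ennreal ((norm (snd \<omega>))\<^sup>2) \<partial>p) \<le> ennreal P"
    using admissible by (simp add: admissible_input_def)
  have I: "integrable p (\<lambda>\<omega>. (norm (snd \<omega>))\<^sup>2)" and "mean_power \<le> P"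
    unfolding mean_power_def using P_pos by (auto intro!: nonneg_nn_integral_le_imp_integral[OF _ _ _ le])
  then show "mean_power \<le> P" by simp
  show "(\<integral>\<^sup>+\<omega>. ennreal ((norm (snd \<omega>))\<^sup>2) \<partial>p) = ennreal mean_power"
    unfolding mean_power_def by (rule nn_integral_eq_integral[OF I]) auto
  show "0 \<le> mean_power" unfolding mean_power_def by simp
qed

text \<open>The density of the output marginal at gain \<open>a\<close> relative to the noise
  law.\<close>

definition avg_lik :: "real \<Rightarrow> complex \<Rightarrow> real" where
  "avg_lik a s = enn2real (\<integral>\<^sup>+\<omega>. ennreal (lik a (snd \<omega>) s) \<partial>p)"

text \<open>The bound is uniform in x, so the averaged likelihood is finite for every input
  law.\<close>

lemma lik_le: "lik a x s \<le> exp ((norm s)\<^sup>2)"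
proof -
  have "ln (lik a x s) \<le> (norm s)\<^sup>2" unfolding ln_lik by simp
  then show ?thesis by (metis exp_le_cancel_iff exp_ln lik_pos)
qed

lemma avg_lik_eq: "(\<integral>\<^sup>+\<omega>. ennreal (lik a (snd \<omega>) s) \<partial>p) = ennreal (avg_lik a s)"
  and avg_lik_pos: "0 < avg_lik a s"
proof -
  let ?I = "\<integral>\<^sup>+\<omega>. ennreal (lik a (snd \<omega>) s) \<partial>p"
  have "?I \<le> (\<integral>\<^sup>+\<omega>. ennreal (exp ((norm s)\<^sup>2)) \<partial>p)"
    by (intro nn_integral_mono ennreal_leI lik_le)
  also have "\<dots> = ennreal (exp ((norm s)\<^sup>2))" by (simp add: p.emeasure_space_1)
  finally have fin: "?I < top" by (simp add: le_less_trans)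
  have "?I \<noteq> 0"
    by (subst nn_integral_0_iff_AE) (auto simp: p.AE_False ennreal_eq_0_iff not_less[symmetric])
  then show "0 < avg_lik a s" unfolding avg_lik_def using fin
    by (simp add: enn2real_positive_iff zero_less_iff_neq_zero)
  show "?I = ennreal (avg_lik a s)" unfolding avg_lik_def using fin by simp
qed

lemma borel_measurable_avg_lik [measurable]: "avg_lik a \<in> borel_measurable borel"
proof -
  have "(\<lambda>s. enn2real (\<integral>\<^sup>+\<omega>. ennreal (lik a (snd \<omega>) s) \<partial>p)) \<in> borel_measurable borel"
    by measurable
  then show ?thesis unfolding avg_lik_def .
qed

lemma nn_integral_avg_lik: "(\<integral>\<^sup>+s. ennreal (avg_lik a s) \<partial>cscg) = 1"
proof -
  have "(\<integral>\<^sup>+s. ennreal (avg_lik a s) \<partial>cscg) = (\<integral>\<^sup>+s. \<integral>\<^sup>+\<omega>. ennreal (lik a (snd \<omega>) s) \<partial>p \<partial>cscg)"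
    by (simp add: avg_lik_eq)
  also have "\<dots> = (\<integral>\<^sup>+\<omega>. \<integral>\<^sup>+s. ennreal (lik a (snd \<omega>) s) \<partial>cscg \<partial>p)"
    by (rule pxs.Fubini') measurable
  finally show ?thesis by (simp add: nn_integral_lik p.emeasure_space_1)
qed

lemma nn_integral_mehler_avg_lik:
  fixes c :: real assumes c: "\<bar>c\<bar> < 1"
  shows "(\<integral>\<^sup>+y. ennreal (mehler (of_real c) y z) * ennreal (avg_lik a y) \<partial>cscg) = ennreal (avg_lik (a * c) z)"
proof -
  have "(\<integral>\<^sup>+y. ennreal (mehler (of_real c) y z) * ennreal (avg_lik a y) \<partial>cscg)
    = (\<integral>\<^sup>+y. \<integral>\<^sup>+\<omega>. ennreal (mehler (of_real c) y z) * ennreal (lik a (snd \<omega>) y) \<partial>p \<partial>cscg)"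
    by (simp add: avg_lik_eq[symmetric] nn_integral_cmult)
  also have "\<dots> = (\<integral>\<^sup>+\<omega>. \<integral>\<^sup>+y. ennreal (mehler (of_real c) y z) * ennreal (lik a (snd \<omega>) y) \<partial>cscg \<partial>p)"
    by (rule pxs.Fubini') measurable
  also have "\<dots> = ennreal (avg_lik (a * c) z)"
    by (simp add: nn_integral_mehler_lik[OF c] avg_lik_eq)
  finally show ?thesis .
qed

text \<open>\<open>L\<close> is a version of the conditional expectation of \<open>lik a x s\<close>
  given u, that is, the density of the pair (u, output) relative to the product of the message law
  and the noise law. Testing against functions of u and s avoids choosing a conditional law of x,
  and a predicate admits any version, for instance \<open>lik\<close> itself when u = x.\<close>

definition cond_lik :: "real \<Rightarrow> ('u \<times> complex \<Rightarrow> real) \<Rightarrow> bool" where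
  "cond_lik a L \<longleftrightarrow> L \<in> borel_measurable (pu \<Otimes>\<^sub>M cscg) \<and> (\<forall>us. 0 \<le> L us) \<and>
     (\<forall>\<psi>\<in>borel_measurable (U \<Otimes>\<^sub>M borel).
        (\<integral>\<^sup>+\<omega>. \<integral>\<^sup>+s. ennreal (lik a (snd \<omega>) s) * \<psi> (fst \<omega>, s) \<partial>cscg \<partial>p) =
        (\<integral>\<^sup>+us. ennreal (L us) * \<psi> us \<partial>(pu \<Otimes>\<^sub>M cscg)))"

lemma cond_lik_measurable: "cond_lik a L \<Longrightarrow> L \<in> borel_measurable (U \<Otimes>\<^sub>M borel)"
  and cond_lik_nonneg: "cond_lik a L \<Longrightarrow> 0 \<le> L us"
  and cond_lik_eq: "cond_lik a L \<Longrightarrow> \<psi> \<in> borel_measurable (U \<Otimes>\<^sub>M borel) \<Longrightarrow>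
    (\<integral>\<^sup>+\<omega>. \<integral>\<^sup>+s. ennreal (lik a (snd \<omega>) s) * \<psi> (fst \<omega>, s) \<partial>cscg \<partial>p) =
        (\<integral>\<^sup>+us. ennreal (L us) * \<psi> us \<partial>(pu \<Otimes>\<^sub>M cscg))"
proof -
  have "sets (pu \<Otimes>\<^sub>M cscg) = sets (U \<Otimes>\<^sub>M (borel :: complex measure))"
    by (rule sets_pair_measure_cong) simp_all
  note * = measurable_cong_sets[OF this refl]
  show "cond_lik a L \<Longrightarrow> L \<in> borel_measurable (U \<Otimes>\<^sub>M borel)" unfolding cond_lik_def * by simp
qed (cases us, auto simp: cond_lik_def)

lemma pu_cscg_eq: "pu \<Otimes>\<^sub>M cscg = distr (p \<Otimes>\<^sub>M cscg) (U \<Otimes>\<^sub>M borel) (\<lambda>(\<omega>, s). (fst \<omega>, s))"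
proof -
  have "distr cscg borel (\<lambda>s. s) = cscg" by (rule distr_id2) simp
  then have "pu \<Otimes>\<^sub>M cscg = distr p U fst \<Otimes>\<^sub>M distr cscg borel (\<lambda>s. s)" by (simp add: pu_def)
  also have "\<dots> = distr (p \<Otimes>\<^sub>M cscg) (U \<Otimes>\<^sub>M borel) (\<lambda>(\<omega>, s). (fst \<omega>, s))"
    by (rule pair_measure_distr) (auto simp: \<open>distr cscg borel (\<lambda>s. s) = cscg\<close> intro!: cscg.sigma_finite_measure_axioms)
  finally show ?thesis .
qed

text \<open>The joint law of (u, x) and the scalar output a x + w. Reweighting by the likelihood
  amounts to shifting the noise; compare \<open>nn_integral_rho_shift\<close>.\<close>

definition rho :: "real \<Rightarrow> (('u \<times> complex) \<times> complex) measure" where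
  "rho a = density (p \<Otimes>\<^sub>M cscg) (\<lambda>(\<omega>, s). ennreal (lik a (snd \<omega>) s))"

lemma sets_rho [simp, measurable_cong]: "sets (rho a) = sets (p \<Otimes>\<^sub>M cscg)"
  and space_rho [simp]: "space (rho a) = space (p \<Otimes>\<^sub>M cscg)"
  by (simp_all add: rho_def)

lemma nn_integral_rho:
  assumes [measurable]: "F \<in> borel_measurable (p \<Otimes>\<^sub>M cscg)"
  shows "(\<integral>\<^sup>+x. F x \<partial>rho a) = (\<integral>\<^sup>+\<omega>. \<integral>\<^sup>+s. ennreal (lik a (snd \<omega>) s) * F (\<omega>, s) \<partial>cscg \<partial>p)"
proof -
  have "(\<integral>\<^sup>+x. F x \<partial>rho a) = (\<integral>\<^sup>+x. ennreal (lik a (snd (fst x)) (snd x)) * F x \<partial>(p \<Otimes>\<^sub>M cscg))"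
    unfolding rho_def by (subst nn_integral_density) (auto simp: case_prod_beta)
  also have "\<dots> = (\<integral>\<^sup>+\<omega>. \<integral>\<^sup>+s. ennreal (lik a (snd \<omega>) s) * F (\<omega>, s) \<partial>cscg \<partial>p)"
    by (subst cscg.nn_integral_fst[symmetric]) auto
  finally show ?thesis .
qed

lemma nn_integral_rho_shift:
  assumes [measurable]: "F \<in> borel_measurable (p \<Otimes>\<^sub>M cscg)"
  shows "(\<integral>\<^sup>+x. F x \<partial>rho a) = (\<integral>\<^sup>+\<omega>. \<integral>\<^sup>+w. F (\<omega>, a *\<^sub>R snd \<omega> + w) \<partial>cscg \<partial>p)"
proof (subst nn_integral_rho, measurable, rule nn_integral_cong)
  fix \<omega> assume [measurable]: "\<omega> \<in> space p"
  show "(\<integral>\<^sup>+s. ennreal (lik a (snd \<omega>) s) * F (\<omega>, s) \<partial>cscg) = (\<integral>\<^sup>+w. F (\<omega>, a *\<^sub>R snd \<omega> + w) \<partial>cscg)"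
    by (rule nn_integral_cscg_shift[symmetric]) measurable
qed

lemma prob_space_rho: "prob_space (rho a)"
proof
  have "(\<integral>\<^sup>+x. 1 \<partial>rho a) = 1"
    by (subst nn_integral_rho) (auto simp: nn_integral_lik p.emeasure_space_1)
  then show "emeasure (rho a) (space (rho a)) = 1" by simp
qed

text \<open>Radon-Nikodym: \<open>rho a\<close> has a density relative to
  \<open>p \<Otimes>\<^sub>M cscg\<close>, so its image under forgetting x is absolutely continuous
  relative to the image of that product, which is \<open>pu \<Otimes>\<^sub>M cscg\<close>.\<close>

lemma cond_lik_exists: "\<exists>L. cond_lik a L"
proof -
  let ?\<pi> = "\<lambda>(\<omega> :: 'u \<times> complex, s :: complex). (fst \<omega>, s)"
  define Q where "Q = distr (rho a) (U \<Otimes>\<^sub>M borel) ?\<pi>"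
  have \<pi>[measurable]: "?\<pi> \<in> p \<Otimes>\<^sub>M cscg \<rightarrow>\<^sub>M U \<Otimes>\<^sub>M borel" by measurable
  have sQ: "sets Q = sets (pu \<Otimes>\<^sub>M cscg)"
    unfolding pu_cscg_eq Q_def by simp
  have ac: "absolutely_continuous (pu \<Otimes>\<^sub>M cscg) Q"
    unfolding absolutely_continuous_def
  proof
    fix A assume A: "A \<in> null_sets (pu \<Otimes>\<^sub>M cscg)"
    then have [measurable]: "A \<in> sets (U \<Otimes>\<^sub>M borel)" by (metis pu_cscg_eq sets_distr null_setsD2)
    from A have "AE x in distr (p \<Otimes>\<^sub>M cscg) (U \<Otimes>\<^sub>M borel) ?\<pi>. x \<notin> A"
      unfolding pu_cscg_eq by (rule AE_not_in)
    then have "AE x in p \<Otimes>\<^sub>M cscg. ?\<pi> x \<notin> A"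
      by (subst (asm) AE_distr_iff) auto
    then have "AE x in rho a. ?\<pi> x \<notin> A"
      unfolding rho_def by (subst AE_density) auto
    then have "AE x in Q. x \<notin> A"
      unfolding Q_def by (subst AE_distr_iff) auto
    then show "A \<in> null_sets Q"
      by (subst AE_iff_null_sets) (auto simp: Q_def)
  qed
  interpret rho: prob_space "rho a" by (rule prob_space_rho)
  interpret Q: prob_space Q unfolding Q_def by (rule rho.prob_space_distr) measurable
  obtain D where D: "D \<in> borel_measurable (pu \<Otimes>\<^sub>M cscg)" "AE x in pu \<Otimes>\<^sub>M cscg. RN_deriv (pu \<Otimes>\<^sub>M cscg) Q x = ennreal (D x)"
    "\<And>x. 0 \<le> D x"
    using pus.P.real_RN_deriv[OF Q.finite_measure_axioms ac sQ] by metis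
  have "cond_lik a D"
    unfolding cond_lik_def
  proof (intro conjI ballI allI D)
    fix \<psi> :: "'u \<times> complex \<Rightarrow> ennreal" assume [measurable]: "\<psi> \<in> borel_measurable (U \<Otimes>\<^sub>M borel)"
    have "(\<integral>\<^sup>+\<omega>. \<integral>\<^sup>+s. ennreal (lik a (snd \<omega>) s) * \<psi> (fst \<omega>, s) \<partial>cscg \<partial>p) = (\<integral>\<^sup>+x. \<psi> (?\<pi> x) \<partial>rho a)"
      by (subst nn_integral_rho) auto
    also have "\<dots> = (\<integral>\<^sup>+x. \<psi> x \<partial>Q)"
      unfolding Q_def by (subst nn_integral_distr) auto
    also have "\<dots> = (\<integral>\<^sup>+x. RN_deriv (pu \<Otimes>\<^sub>M cscg) Q x * \<psi> x \<partial>(pu \<Otimes>\<^sub>M cscg))"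
      by (rule pus.P.RN_deriv_nn_integral[OF ac sQ]) (auto simp: measurable_cong_sets[OF sQ] Q_def)
    also have "\<dots> = (\<integral>\<^sup>+us. ennreal (D us) * \<psi> us \<partial>(pu \<Otimes>\<^sub>M cscg))"
      using D(2) by (intro nn_integral_cong_AE) auto
    finally show "(\<integral>\<^sup>+\<omega>. \<integral>\<^sup>+s. ennreal (lik a (snd \<omega>) s) * \<psi> (fst \<omega>, s) \<partial>cscg \<partial>p) = 
      (\<integral>\<^sup>+us. ennreal (D us) * \<psi> us \<partial>(pu \<Otimes>\<^sub>M cscg))" .
  qed
  then show ?thesis by blast
qed

lemma cond_lik_nn_integral: "cond_lik a L \<Longrightarrow> (\<integral>\<^sup>+us. ennreal (L us) \<partial>(pu \<Otimes>\<^sub>M cscg)) = 1"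
  using cond_lik_eq[of a L "\<lambda>_. 1"] by (simp add: nn_integral_lik p.emeasure_space_1)

text \<open>The set where \<open>L\<close> vanishes has as its mass the integral of \<open>L\<close>
  over that set, which is zero. This makes the logarithms below meaningful almost surely.\<close>

lemma AE_cond_lik_pos:
  assumes L: "cond_lik a L"
  shows "AE (\<omega>, s) in rho a. 0 < L (fst \<omega>, s)"
proof -
  note [measurable] = cond_lik_measurable[OF L]
  have "(\<integral>\<^sup>+x. indicator {us. L us = 0} (fst (fst x), snd x) \<partial>rho a) = (\<integral>\<^sup>+us. ennreal (L us) * indicator {us. L us = 0} us \<partial>(pu \<Otimes>\<^sub>M cscg))"
    by (subst cond_lik_eq[OF L, symmetric], measurable, subst nn_integral_rho) auto
  also have "\<dots> = (\<integral>\<^sup>+us. 0 \<partial>(pu \<Otimes>\<^sub>M cscg))"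
    by (intro nn_integral_cong) (auto split: split_indicator)
  also have "\<dots> = 0" by simp
  finally have "AE x in rho a. (indicator {us. L us = 0} (fst (fst x), snd x) :: ennreal) = 0"
    by (subst (asm) nn_integral_0_iff_AE) auto
  then show ?thesis
    by eventually_elim (use cond_lik_nonneg[OF L] in \<open>auto simp: indicator_def less_le split: if_splits\<close>)
qed

end

lemma integrable_between:
  fixes f g h :: "'a \<Rightarrow> real"
  assumes "integrable M g" "integrable M h" "f \<in> borel_measurable M"
    and "AE x in M. g x \<le> f x" "AE x in M. f x \<le> h x"
  shows "integrable M f"
proof (rule Bochner_Integration.integrable_bound)
  show "integrable M (\<lambda>x. \<bar>g x\<bar> + \<bar>h x\<bar>)" using assms by auto
  show "AE x in M. norm (f x) \<le> norm (\<bar>g x\<bar> + \<bar>h x\<bar>)"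
    using assms(4,5) by eventually_elim auto
qed (use assms in auto)

section \<open>Information densities and their integrability\<close>

context channel_input
begin

lemma rho_sq_diff: "integrable (rho a) (\<lambda>(\<omega>, s). (norm (s - a *\<^sub>R snd \<omega>))\<^sup>2)"
    "(\<integral>x. (case x of (\<omega>, s) \<Rightarrow> (norm (s - a *\<^sub>R snd \<omega>))\<^sup>2) \<partial>rho a) = 1"
proof -
  have "(\<integral>\<^sup>+x. ennreal (case x of (\<omega>, s) \<Rightarrow> (norm (s - a *\<^sub>R snd \<omega>))\<^sup>2) \<partial>rho a) = ennreal 1"
    by (subst nn_integral_rho_shift) (auto simp: nn_integral_cscg_norm_squared p.emeasure_space_1)
  then show "integrable (rho a) (\<lambda>(\<omega>, s). (norm (s - a *\<^sub>R snd \<omega>))\<^sup>2)"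
    "(\<integral>x. (case x of (\<omega>, s) \<Rightarrow> (norm (s - a *\<^sub>R snd \<omega>))\<^sup>2) \<partial>rho a) = 1"
    by (intro nonneg_nn_integral_eq_imp_integral; auto)+
qed

lemma rho_sq: "integrable (rho a) (\<lambda>(\<omega>, s). (norm s)\<^sup>2)"
    "(\<integral>x. (case x of (\<omega>, s) \<Rightarrow> (norm s)\<^sup>2) \<partial>rho a) = 1 + a\<^sup>2 * mean_power"
proof -
  have "(\<integral>\<^sup>+x. ennreal (case x of (\<omega>, s) \<Rightarrow> (norm s)\<^sup>2) \<partial>rho a) =
    (\<integral>\<^sup>+\<omega>. ennreal (a\<^sup>2) * ennreal ((norm (snd \<omega>))\<^sup>2) + 1 \<partial>p)"
    by (subst nn_integral_rho_shift)
      (auto simp: nn_integral_cscg_norm_add_squared power_mult_distrib ennreal_mult' intro!: nn_integral_cong)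
  also have "\<dots> = ennreal (a\<^sup>2) * ennreal mean_power + 1"
    by (subst nn_integral_add) (auto simp: nn_integral_cmult nn_integral_mean_power p.emeasure_space_1)
  also have "\<dots> = ennreal (1 + a\<^sup>2 * mean_power)"
    using mean_power_nonneg by (simp add: ennreal_mult' add.commute)
  finally have eq: "(\<integral>\<^sup>+x. ennreal (case x of (\<omega>, s) \<Rightarrow> (norm s)\<^sup>2) \<partial>rho a) = ennreal (1 + a\<^sup>2 * mean_power)" .
  show "integrable (rho a) (\<lambda>(\<omega>, s). (norm s)\<^sup>2)"
    "(\<integral>x. (case x of (\<omega>, s) \<Rightarrow> (norm s)\<^sup>2) \<partial>rho a) = 1 + a\<^sup>2 * mean_power"
    using mean_power_nonneg by (intro nonneg_nn_integral_eq_imp_integral[OF _ _ _ eq]; auto)+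
qed

text \<open>The information density between x and the output for a Gaussian input of power
  \<open>P\<close>, here integrated under an arbitrary input. It is quadratic in s and x up to a
  constant, so its mean depends on the input only through the mean power.\<close>

definition gauss_lr :: "real \<Rightarrow> (('u \<times> complex) \<times> complex) \<Rightarrow> real" where
  "gauss_lr a = (\<lambda>(\<omega>, s). ln (lik a (snd \<omega>) s / mixlik P a s))"

lemma gauss_lr_eq: "gauss_lr a x = ((case x of (\<omega>, s) \<Rightarrow> (norm s)\<^sup>2) / (1 + P * a\<^sup>2)
     - (case x of (\<omega>, s) \<Rightarrow> (norm (s - a *\<^sub>R snd \<omega>))\<^sup>2)) + ln (1 + P * a\<^sup>2)"
proof -
  obtain \<omega> s where x: "x = (\<omega>, s)" by (cases x)
  have v: "1 + P * a\<^sup>2 > 0" using P_pos by (simp add: add_pos_nonneg)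
  have "ln (lik a (snd \<omega>) s / mixlik P a s) = ln (lik a (snd \<omega>) s) - ln (mixlik P a s)"
    using mixlik_pos[of P a s] P_pos by (simp add: ln_div)
  moreover have "ln (mixlik P a s) = ((norm s)\<^sup>2 - (norm s)\<^sup>2 / (1 + P * a\<^sup>2)) - ln (1 + P * a\<^sup>2)"
    unfolding mixlik_def using v by (simp add: ln_div)
  ultimately show ?thesis unfolding x gauss_lr_def ln_lik by simp
qed

lemma gauss_lr: "integrable (rho a) (gauss_lr a)"
   "(\<integral>x. gauss_lr a x \<partial>rho a) = (1 + a\<^sup>2 * mean_power) / (1 + P * a\<^sup>2) - 1 + ln (1 + P * a\<^sup>2)"
proof -
  interpret rho: prob_space "rho a" by (rule prob_space_rho)
  have I: "integrable (rho a) (\<lambda>x. (case x of (\<omega>, s) \<Rightarrow> (norm s)\<^sup>2) / (1 + P * a\<^sup>2))"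
    using rho_sq(1)[of a] by simp
  show "integrable (rho a) (gauss_lr a)"
    unfolding gauss_lr_eq[abs_def] by (intro Bochner_Integration.integrable_add Bochner_Integration.integrable_diff I rho_sq_diff) simp
  have "(\<integral>x. gauss_lr a x \<partial>rho a) = 
    (\<integral>x. (case x of (\<omega>, s) \<Rightarrow> (norm s)\<^sup>2) / (1 + P * a\<^sup>2)
     - (case x of (\<omega>, s) \<Rightarrow> (norm (s - a *\<^sub>R snd \<omega>))\<^sup>2) \<partial>rho a) + (\<integral>x. ln (1 + P * a\<^sup>2) \<partial>rho a)"
    unfolding gauss_lr_eq by (intro Bochner_Integration.integral_add Bochner_Integration.integrable_diff I rho_sq_diff) simp
  also have "(\<integral>x. (case x of (\<omega>, s) \<Rightarrow> (norm s)\<^sup>2) / (1 + P * a\<^sup>2)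
     - (case x of (\<omega>, s) \<Rightarrow> (norm (s - a *\<^sub>R snd \<omega>))\<^sup>2) \<partial>rho a) = 
     (\<integral>x. (case x of (\<omega>, s) \<Rightarrow> (norm s)\<^sup>2) / (1 + P * a\<^sup>2) \<partial>rho a)
     - (\<integral>x. (case x of (\<omega>, s) \<Rightarrow> (norm (s - a *\<^sub>R snd \<omega>))\<^sup>2) \<partial>rho a)"
    by (intro Bochner_Integration.integral_diff I rho_sq_diff)
  finally show "(\<integral>x. gauss_lr a x \<partial>rho a) = (1 + a\<^sup>2 * mean_power) / (1 + P * a\<^sup>2) - 1 + ln (1 + P * a\<^sup>2)"
    by (simp add: rho_sq_diff(2) rho_sq(2) rho.prob_space[simplified])
qed

text \<open>The information density between u and the output; its mean under \<open>rho a\<close> is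
  the mutual information in nats.\<close>

definition info_lr :: "('u \<times> complex \<Rightarrow> real) \<Rightarrow> real \<Rightarrow> (('u \<times> complex) \<times> complex) \<Rightarrow> real" where
  "info_lr L a = (\<lambda>(\<omega>, s). ln (L (fst \<omega>, s) / avg_lik a s))"

lemma borel_measurable_info_lr [measurable]:
  assumes L: "cond_lik a L" shows "info_lr L a \<in> borel_measurable (p \<Otimes>\<^sub>M cscg)"
proof -
  note [measurable] = cond_lik_measurable[OF L]
  show ?thesis unfolding info_lr_def by measurable
qed

text \<open>Sandwich by ln t <= t - 1. From below the bound is minus the ratio \<open>?C\<close>.
  From above, the logarithm splits into those of the ratios \<open>?A\<close> and \<open>?B\<close>
  plus \<open>gauss_lr\<close>, which is integrable by the power constraint. All three ratios have
  mean at most one.\<close>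

lemma integrable_info_lr:
  assumes L: "cond_lik a L"
  shows "integrable (rho a) (info_lr L a)"
proof (rule integrable_between)
  note [measurable] = cond_lik_measurable[OF L]
  note nnL = cond_lik_nonneg[OF L]
  let ?A = "\<lambda>(\<omega>, s). L (fst \<omega>, s) / lik a (snd \<omega>) s"
  let ?B = "\<lambda>(\<omega> :: 'u \<times> complex, s). mixlik P a s / avg_lik a s"
  let ?C = "\<lambda>(\<omega>, s). avg_lik a s / L (fst \<omega>, s)"
  have posm: "0 < mixlik P a s" for s using mixlik_pos P_pos by simp
  have posa: "0 < avg_lik a s" for s by (rule avg_lik_pos)
  have "(\<integral>\<^sup>+x. ennreal (?A x) \<partial>rho a) = (\<integral>\<^sup>+\<omega>. \<integral>\<^sup>+s. ennreal (L (fst \<omega>, s)) \<partial>cscg \<partial>p)"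
    by (subst nn_integral_rho) (auto simp: ennreal_mult'[symmetric] less_imp_neq[OF lik_pos, symmetric])
  also have "\<dots> = (\<integral>\<^sup>+us. ennreal (L us) \<partial>(pu \<Otimes>\<^sub>M cscg))"
    unfolding pu_cscg_eq by (subst nn_integral_distr) (auto simp: cscg.nn_integral_fst[symmetric])
  finally have A: "(\<integral>\<^sup>+x. ennreal (?A x) \<partial>rho a) \<le> ennreal 1" using cond_lik_nn_integral[OF L] by simp
  have IA: "integrable (rho a) ?A"
    by (rule nonneg_nn_integral_le_imp_integral(1)[OF _ _ _ A]) (auto simp: nnL)
  have "(\<integral>\<^sup>+x. ennreal (?B x) \<partial>rho a) = (\<integral>\<^sup>+\<omega>. \<integral>\<^sup>+s. ennreal (lik a (snd \<omega>) s) * ennreal (mixlik P a s / avg_lik a s) \<partial>cscg \<partial>p)"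
    by (subst nn_integral_rho) auto
  also have "\<dots> = (\<integral>\<^sup>+s. \<integral>\<^sup>+\<omega>. ennreal (lik a (snd \<omega>) s) * ennreal (mixlik P a s / avg_lik a s) \<partial>p \<partial>cscg)"
    by (rule pxs.Fubini'[symmetric]) measurable
  also have "\<dots> = (\<integral>\<^sup>+s. ennreal (avg_lik a s) * ennreal (mixlik P a s / avg_lik a s) \<partial>cscg)"
    by (simp add: nn_integral_multc avg_lik_eq)
  also have "\<dots> = (\<integral>\<^sup>+s. ennreal (mixlik P a s) \<partial>cscg)"
    by (intro nn_integral_cong) (simp add: ennreal_mult'[symmetric] less_imp_le[OF posa] less_imp_neq[OF posa, symmetric])
  finally have B: "(\<integral>\<^sup>+x. ennreal (?B x) \<partial>rho a) \<le> ennreal 1" using P_pos by (simp add: nn_integral_mixlik)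
  have IB: "integrable (rho a) ?B"
    by (rule nonneg_nn_integral_le_imp_integral(1)[OF _ _ _ B]) (auto simp: less_imp_le posm posa)
  have "(\<integral>\<^sup>+x. ennreal (?C x) \<partial>rho a) = (\<integral>\<^sup>+\<omega>. \<integral>\<^sup>+s. ennreal (lik a (snd \<omega>) s) * ennreal (avg_lik a s / L (fst \<omega>, s)) \<partial>cscg \<partial>p)"
    by (subst nn_integral_rho) auto
  also have "\<dots> = (\<integral>\<^sup>+us. ennreal (L us) * ennreal (avg_lik a (snd us) / L us) \<partial>(pu \<Otimes>\<^sub>M cscg))"
    by (subst cond_lik_eq[OF L, symmetric]) auto
  \<comment> \<open>Only an inequality: where \<open>L\<close> is 0 the left integrand is 0, while
    \<open>avg_lik\<close> is positive.\<close>
  also have "\<dots> \<le> (\<integral>\<^sup>+us. ennreal (avg_lik a (snd us)) \<partial>(pu \<Otimes>\<^sub>M cscg))"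
    using posa nnL by (intro nn_integral_mono) (auto simp: ennreal_mult'[symmetric] less_imp_le)
  also have "\<dots> = 1"
    by (subst cscg.nn_integral_fst[symmetric]) (auto simp: nn_integral_avg_lik pu.emeasure_space_1[simplified])
  finally have C: "(\<integral>\<^sup>+x. ennreal (?C x) \<partial>rho a) \<le> ennreal 1" by simp
  have IC: "integrable (rho a) ?C"
    by (rule nonneg_nn_integral_le_imp_integral(1)[OF _ _ _ C]) (auto simp: less_imp_le nnL posa)
  show "integrable (rho a) (\<lambda>x. - ?C x)" using IC by simp
  show "integrable (rho a) (\<lambda>x. ?A x + ?B x + gauss_lr a x)"
    using IA IB gauss_lr(1) by (intro Bochner_Integration.integrable_add)
  show "info_lr L a \<in> borel_measurable (rho a)" using L by measurable
  show "AE x in rho a. - ?C x \<le> info_lr L a x"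
    using AE_cond_lik_pos[OF L]
  proof eventually_elim
    case (elim x)
    obtain \<omega> s where x: "x = (\<omega>, s)" by (cases x)
    have "L (fst \<omega>, s) > 0" using elim x by simp
    then have "ln (avg_lik a s / L (fst \<omega>, s)) \<le> avg_lik a s / L (fst \<omega>, s) - 1"
      using posa by (intro ln_le_minus_one) auto
    moreover have "ln (L (fst \<omega>, s) / avg_lik a s) = - ln (avg_lik a s / L (fst \<omega>, s))"
      using posa[of s] \<open>L (fst \<omega>, s) > 0\<close> by (simp add: ln_div)
    ultimately show ?case by (simp add: x info_lr_def)
  qed
  show "AE x in rho a. info_lr L a x \<le> ?A x + ?B x + gauss_lr a x"
    using AE_cond_lik_pos[OF L]
  proof eventually_elim
    case (elim x)
    obtain \<omega> s where x: "x = (\<omega>, s)" by (cases x)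
    have Lp: "L (fst \<omega>, s) > 0" using elim x by simp
    have "ln (L (fst \<omega>, s) / lik a (snd \<omega>) s) \<le> L (fst \<omega>, s) / lik a (snd \<omega>) s - 1"
      using Lp by (intro ln_le_minus_one) auto
    moreover have "ln (mixlik P a s / avg_lik a s) \<le> mixlik P a s / avg_lik a s - 1"
      using posa posm by (intro ln_le_minus_one) auto
    moreover have "ln (L (fst \<omega>, s) / avg_lik a s) = ln (L (fst \<omega>, s) / lik a (snd \<omega>) s) + ln (mixlik P a s / avg_lik a s) + ln (lik a (snd \<omega>) s / mixlik P a s)"
      using Lp posa[of s] posm[of s] by (simp add: ln_div)
    ultimately show ?case by (simp add: x info_lr_def gauss_lr_def)
  qed
qed

text \<open>The coupling that makes the output at the smaller gain \<open>a c\<close> a degraded version of the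
  output at gain \<open>a\<close>.\<close>

definition coupling :: "real \<Rightarrow> real \<Rightarrow> (('u \<times> complex) \<times> complex \<times> complex) measure" where
  "coupling a c = density (p \<Otimes>\<^sub>M (cscg \<Otimes>\<^sub>M cscg))
     (\<lambda>(\<omega>, y, z). ennreal (lik a (snd \<omega>) y) * ennreal (mehler (of_real c) y z))"

lemma sets_coupling [simp, measurable_cong]: "sets (coupling a c) = sets (p \<Otimes>\<^sub>M (cscg \<Otimes>\<^sub>M cscg))"
  and space_coupling [simp]: "space (coupling a c) = space (p \<Otimes>\<^sub>M (cscg \<Otimes>\<^sub>M cscg))"
  by (simp_all add: coupling_def)

lemma nn_integral_coupling:
  assumes [measurable]: "F \<in> borel_measurable (p \<Otimes>\<^sub>M (cscg \<Otimes>\<^sub>M cscg))"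
  shows "(\<integral>\<^sup>+x. F x \<partial>coupling a c) = 
    (\<integral>\<^sup>+\<omega>. \<integral>\<^sup>+y. \<integral>\<^sup>+z. ennreal (lik a (snd \<omega>) y) * ennreal (mehler (of_real c) y z) * F (\<omega>, y, z) \<partial>cscg \<partial>cscg \<partial>p)"
proof -
  have "(\<integral>\<^sup>+x. F x \<partial>coupling a c) = (\<integral>\<^sup>+x. (ennreal (lik a (snd (fst x)) (fst (snd x))) * ennreal (mehler (of_real c) (fst (snd x)) (snd (snd x)))) * F x \<partial>(p \<Otimes>\<^sub>M (cscg \<Otimes>\<^sub>M cscg)))"
    unfolding coupling_def by (subst nn_integral_density) (auto simp: case_prod_beta)
  also have "\<dots> = (\<integral>\<^sup>+\<omega>. \<integral>\<^sup>+x. ennreal (lik a (snd \<omega>) (fst x)) * ennreal (mehler (of_real c) (fst x) (snd x)) * F (\<omega>, x) \<partial>(cscg \<Otimes>\<^sub>M cscg) \<partial>p)"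
    by (subst ss.P.nn_integral_fst[symmetric]) auto
  also have "\<dots> = (\<integral>\<^sup>+\<omega>. \<integral>\<^sup>+y. \<integral>\<^sup>+z. ennreal (lik a (snd \<omega>) y) * ennreal (mehler (of_real c) y z) * F (\<omega>, y, z) \<partial>cscg \<partial>cscg \<partial>p)"
    by (intro nn_integral_cong, subst cscg.nn_integral_fst[symmetric]) auto
  finally show ?thesis .
qed

lemma nn_integral_coupling':
  assumes [measurable]: "F \<in> borel_measurable (p \<Otimes>\<^sub>M (cscg \<Otimes>\<^sub>M cscg))"
  shows "(\<integral>\<^sup>+x. F x \<partial>coupling a c) = 
    (\<integral>\<^sup>+\<omega>. \<integral>\<^sup>+z. \<integral>\<^sup>+y. ennreal (lik a (snd \<omega>) y) * ennreal (mehler (of_real c) y z) * F (\<omega>, y, z) \<partial>cscg \<partial>cscg \<partial>p)"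
  by (subst nn_integral_coupling, measurable, intro nn_integral_cong ss.Fubini'[symmetric]) measurable

context
  fixes c :: real assumes c: "\<bar>c\<bar> < 1"
begin

lemma mehler_nn [simp]: "0 \<le> mehler (of_real c) y z" using c by (intro mehler_nonneg) simp

lemma distr_coupling_fst: "distr (coupling a c) (p \<Otimes>\<^sub>M cscg) (\<lambda>(\<omega>, y, z). (\<omega>, y)) = rho a"
proof (rule measure_eqI)
  fix A assume "A \<in> sets (distr (coupling a c) (p \<Otimes>\<^sub>M cscg) (\<lambda>(\<omega>, y, z). (\<omega>, y)))"
  then have A[measurable]: "A \<in> sets (p \<Otimes>\<^sub>M cscg)" by simp
  have "(\<integral>\<^sup>+x. indicator A x \<partial>distr (coupling a c) (p \<Otimes>\<^sub>M cscg) (\<lambda>(\<omega>, y, z). (\<omega>, y))) = 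
     (\<integral>\<^sup>+\<omega>. \<integral>\<^sup>+y. \<integral>\<^sup>+z. ennreal (lik a (snd \<omega>) y) * ennreal (mehler (of_real c) y z) * indicator A (\<omega>, y) \<partial>cscg \<partial>cscg \<partial>p)"
    by (subst nn_integral_distr, measurable, subst nn_integral_coupling) (auto simp del: nn_integral_indicator)
  also have "\<dots> = (\<integral>\<^sup>+\<omega>. \<integral>\<^sup>+y. ennreal (lik a (snd \<omega>) y) * indicator A (\<omega>, y) \<partial>cscg \<partial>p)"
    using c by (simp add: nn_integral_cmult nn_integral_multc nn_integral_mehler)
  also have "\<dots> = (\<integral>\<^sup>+x. indicator A x \<partial>rho a)"
    by (subst nn_integral_rho) (auto simp del: nn_integral_indicator)
  finally show "emeasure (distr (coupling a c) (p \<Otimes>\<^sub>M cscg) (\<lambda>(\<omega>, y, z). (\<omega>, y))) A = emeasure (rho a) A"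
    using A by simp
qed simp

text \<open>Integrating out y lets the kernel turn \<open>lik a\<close> into
  \<open>lik (a * c)\<close>. Hence z really is the output at the smaller gain, although it is
  generated from y alone.\<close>

lemma distr_coupling_snd: "distr (coupling a c) (p \<Otimes>\<^sub>M cscg) (\<lambda>(\<omega>, y, z). (\<omega>, z)) = rho (a * c)"
proof (rule measure_eqI)
  fix A assume "A \<in> sets (distr (coupling a c) (p \<Otimes>\<^sub>M cscg) (\<lambda>(\<omega>, y, z). (\<omega>, z)))"
  then have A[measurable]: "A \<in> sets (p \<Otimes>\<^sub>M cscg)" by simp
  have "(\<integral>\<^sup>+x. indicator A x \<partial>distr (coupling a c) (p \<Otimes>\<^sub>M cscg) (\<lambda>(\<omega>, y, z). (\<omega>, z))) = 
     (\<integral>\<^sup>+\<omega>. \<integral>\<^sup>+z. \<integral>\<^sup>+y. ennreal (mehler (of_real c) y z) * ennreal (lik a (snd \<omega>) y) * indicator A (\<omega>, z) \<partial>cscg \<partial>cscg \<partial>p)"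
    by (subst nn_integral_distr, measurable, subst nn_integral_coupling') (auto simp del: nn_integral_indicator simp: mult_ac)
  also have "\<dots> = (\<integral>\<^sup>+\<omega>. \<integral>\<^sup>+z. ennreal (lik (a * c) (snd \<omega>) z) * indicator A (\<omega>, z) \<partial>cscg \<partial>p)"
    by (simp add: nn_integral_multc nn_integral_mehler_lik[OF c])
  also have "\<dots> = (\<integral>\<^sup>+x. indicator A x \<partial>rho (a * c))"
    by (subst nn_integral_rho) (auto simp del: nn_integral_indicator)
  finally show "emeasure (distr (coupling a c) (p \<Otimes>\<^sub>M cscg) (\<lambda>(\<omega>, y, z). (\<omega>, z))) A = emeasure (rho (a * c)) A"
    using A by simp
qed simp

lemma prob_space_coupling: "prob_space (coupling a c)"
proof
  have "(\<integral>\<^sup>+x. 1 \<partial>coupling a c) = 1"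
    using c by (subst nn_integral_coupling) (auto simp: nn_integral_cmult nn_integral_mehler nn_integral_lik p.emeasure_space_1)
  then show "emeasure (coupling a c) (space (coupling a c)) = 1" by simp
qed

lemma coupling_fst:
  assumes [measurable]: "f \<in> borel_measurable (p \<Otimes>\<^sub>M cscg)"
  shows "integrable (rho a) f \<Longrightarrow> integrable (coupling a c) (\<lambda>(\<omega>, y, z). f (\<omega>, y) :: real)"
    and "(\<integral>x. (case x of (\<omega>, y, z) \<Rightarrow> f (\<omega>, y)) \<partial>coupling a c) = integral\<^sup>L (rho a) f"
proof -
  have m: "(\<lambda>(\<omega>, y, z). (\<omega>, y)) \<in> coupling a c \<rightarrow>\<^sub>M p \<Otimes>\<^sub>M cscg" by measurable
  show "integrable (rho a) f \<Longrightarrow> integrable (coupling a c) (\<lambda>(\<omega>, y, z). f (\<omega>, y) :: real)"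
    unfolding distr_coupling_fst[symmetric] by (drule integrable_distr[OF m]) (simp add: case_prod_beta')
  show "(\<integral>x. (case x of (\<omega>, y, z) \<Rightarrow> f (\<omega>, y)) \<partial>coupling a c) = integral\<^sup>L (rho a) f"
    unfolding distr_coupling_fst[symmetric] by (simp add: integral_distr[OF m] case_prod_beta)
qed

lemma coupling_snd:
  assumes [measurable]: "f \<in> borel_measurable (p \<Otimes>\<^sub>M cscg)"
  shows "integrable (rho (a * c)) f \<Longrightarrow> integrable (coupling a c) (\<lambda>(\<omega>, y, z). f (\<omega>, z) :: real)"
    and "(\<integral>x. (case x of (\<omega>, y, z) \<Rightarrow> f (\<omega>, z)) \<partial>coupling a c) = integral\<^sup>L (rho (a * c)) f"
proof -
  have m: "(\<lambda>(\<omega>, y, z). (\<omega>, z)) \<in> coupling a c \<rightarrow>\<^sub>M p \<Otimes>\<^sub>M cscg" by measurable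
  show "integrable (rho (a * c)) f \<Longrightarrow> integrable (coupling a c) (\<lambda>(\<omega>, y, z). f (\<omega>, z) :: real)"
    unfolding distr_coupling_snd[symmetric] by (drule integrable_distr[OF m]) (simp add: case_prod_beta')
  show "(\<integral>x. (case x of (\<omega>, y, z) \<Rightarrow> f (\<omega>, z)) \<partial>coupling a c) = integral\<^sup>L (rho (a * c)) f"
    unfolding distr_coupling_snd[symmetric] by (simp add: integral_distr[OF m] case_prod_beta)
qed

lemma AE_coupling_pos:
  assumes La: "cond_lik a La" and Lb: "cond_lik (a * c) Lb"
  shows "AE (\<omega>, y, z) in coupling a c. 0 < La (fst \<omega>, y) \<and> 0 < Lb (fst \<omega>, z)"
proof -
  note [measurable] = cond_lik_measurable[OF La] cond_lik_measurable[OF Lb]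
  have "AE x in coupling a c. (case x of (\<omega>, y, z) \<Rightarrow> 0 < La (fst \<omega>, y))"
    using AE_distrD[OF _ AE_cond_lik_pos[OF La, folded distr_coupling_fst]] by (simp add: case_prod_beta)
  moreover have "AE x in coupling a c. (case x of (\<omega>, y, z) \<Rightarrow> 0 < Lb (fst \<omega>, z))"
    using AE_distrD[OF _ AE_cond_lik_pos[OF Lb, folded distr_coupling_snd]] by (simp add: case_prod_beta)
  ultimately show ?thesis by eventually_elim auto
qed

end

end

section \<open>Ratios of likelihoods with mean at most one along the degradation\<close>

context channel_input
begin

context
  fixes a c :: real and La Lb :: "'u \<times> complex \<Rightarrow> real"
  assumes c: "\<bar>c\<bar> < 1" and La: "cond_lik a La" and Lb: "cond_lik (a * c) Lb"
begin

lemma L_measurable [measurable]: "La \<in> borel_measurable (U \<Otimes>\<^sub>M borel)" "Lb \<in> borel_measurable (U \<Otimes>\<^sub>M borel)"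
  using La Lb by (auto intro: cond_lik_measurable)

lemma L_nn [simp]: "0 \<le> La us" "0 \<le> Lb us"
  using La Lb by (auto intro: cond_lik_nonneg)

lemma mehler_nn' [simp]: "0 \<le> mehler (of_real c) y z" by (rule mehler_nn[OF c])

lemma avg_lik_nn [simp]: "0 \<le> avg_lik b s" "avg_lik b s \<noteq> 0" using avg_lik_pos[of b s] by auto
lemma mixlik_nn [simp]: "0 \<le> mixlik P b s" "mixlik P b s \<noteq> 0" using mixlik_pos[of P b s] P_pos by auto

text \<open>Behind I(x;z|u) <= I(x;y|u). The weight of the coupling cancels \<open>lik a\<close>;
  conditioning on u replaces \<open>lik (a * c)\<close> by \<open>Lb\<close>, which cancels as well;
  what remains is the total mass of \<open>La\<close>.\<close>

lemma mixed_ratio_le_1: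
  "(\<integral>\<^sup>+x. ennreal (case x of (\<omega>, y, z) \<Rightarrow> La (fst \<omega>, y) * lik (a * c) (snd \<omega>) z / (Lb (fst \<omega>, z) * lik a (snd \<omega>) y)) \<partial>coupling a c) \<le> 1"
  (is "?I \<le> 1")
proof -
  \<comment> \<open>Collects all factors that involve x only through u, as
    \<open>cond_lik_eq\<close> requires of its test function.\<close>
  define \<psi> where "\<psi> us = (\<integral>\<^sup>+y. ennreal (mehler (of_real c) y (snd us) * (La (fst us, y) / Lb us)) \<partial>cscg)" for us
  have [measurable]: "\<psi> \<in> borel_measurable (U \<Otimes>\<^sub>M borel)" unfolding \<psi>_def by measurable
  have "?I = (\<integral>\<^sup>+\<omega>. \<integral>\<^sup>+z. \<integral>\<^sup>+y. ennreal (lik (a * c) (snd \<omega>) z) * ennreal (mehler (of_real c) y z * (La (fst \<omega>, y) / Lb (fst \<omega>, z))) \<partial>cscg \<partial>cscg \<partial>p)"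
    by (subst nn_integral_coupling', measurable) (intro nn_integral_cong, simp add: ennreal_mult'[symmetric])
  also have "\<dots> = (\<integral>\<^sup>+\<omega>. \<integral>\<^sup>+z. ennreal (lik (a * c) (snd \<omega>) z) * \<psi> (fst \<omega>, z) \<partial>cscg \<partial>p)"
    unfolding \<psi>_def by (intro nn_integral_cong, subst nn_integral_cmult) auto
  also have "\<dots> = (\<integral>\<^sup>+us. ennreal (Lb us) * \<psi> us \<partial>(pu \<Otimes>\<^sub>M cscg))"
    by (rule cond_lik_eq[OF Lb]) measurable
  also have "\<dots> \<le> (\<integral>\<^sup>+us. \<integral>\<^sup>+y. ennreal (mehler (of_real c) y (snd us)) * ennreal (La (fst us, y)) \<partial>cscg \<partial>(pu \<Otimes>\<^sub>M cscg))"
  proof (rule nn_integral_mono)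
    fix us assume [measurable]: "us \<in> space (pu \<Otimes>\<^sub>M cscg)"
    then have [measurable]: "fst us \<in> space U" by (auto simp: space_pair_measure)
    have "ennreal (Lb us) * \<psi> us = (\<integral>\<^sup>+y. ennreal (Lb us) * ennreal (mehler (of_real c) y (snd us) * (La (fst us, y) / Lb us)) \<partial>cscg)"
      unfolding \<psi>_def by (rule nn_integral_cmult[symmetric]) measurable
    also have "\<dots> \<le> (\<integral>\<^sup>+y. ennreal (mehler (of_real c) y (snd us)) * ennreal (La (fst us, y)) \<partial>cscg)"
      \<comment> \<open>\<open>Lb * (La / Lb)\<close> is \<open>La\<close>, or 0 where
        \<open>Lb\<close> vanishes because division by zero gives 0; either way it is at most
        \<open>La\<close>.\<close>
      by (intro nn_integral_mono) (simp add: ennreal_mult'[symmetric])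
    finally show "ennreal (Lb us) * \<psi> us \<le> (\<integral>\<^sup>+y. ennreal (mehler (of_real c) y (snd us)) * ennreal (La (fst us, y)) \<partial>cscg)" .
  qed
  also have "\<dots> = (\<integral>\<^sup>+u. \<integral>\<^sup>+z. \<integral>\<^sup>+y. ennreal (mehler (of_real c) y z) * ennreal (La (u, y)) \<partial>cscg \<partial>cscg \<partial>pu)"
    by (subst cscg.nn_integral_fst[symmetric]) auto
  also have "\<dots> = (\<integral>\<^sup>+u. \<integral>\<^sup>+y. \<integral>\<^sup>+z. ennreal (mehler (of_real c) y z) * ennreal (La (u, y)) \<partial>cscg \<partial>cscg \<partial>pu)"
    by (intro nn_integral_cong ss.Fubini') measurable
  also have "\<dots> = (\<integral>\<^sup>+u. \<integral>\<^sup>+y. ennreal (La (u, y)) \<partial>cscg \<partial>pu)"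
    using c by (simp add: nn_integral_multc nn_integral_mehler)
  also have "\<dots> = (\<integral>\<^sup>+us. ennreal (La us) \<partial>(pu \<Otimes>\<^sub>M cscg))"
    by (subst cscg.nn_integral_fst[symmetric]) auto
  finally show ?thesis by (simp add: cond_lik_nn_integral[OF La])
qed

text \<open>Behind the decrease, from y to z, of the relative entropy of the output to the Gaussian
  output. Averaging \<open>lik a\<close> over the input gives \<open>avg_lik a\<close>, which
  cancels; the kernel then carries \<open>mixlik P a\<close> to \<open>mixlik P (a * c)\<close>,
  leaving the mass of \<open>avg_lik (a * c)\<close>.\<close>

lemma gauss_ratio_le_1:
  "(\<integral>\<^sup>+x. ennreal (case x of (\<omega>, y, z) \<Rightarrow> avg_lik (a * c) z * mixlik P a y / (avg_lik a y * mixlik P (a * c) z)) \<partial>coupling a c) \<le> 1"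
  (is "?I \<le> 1")
proof -
  define W where "W y = (\<integral>\<^sup>+z. ennreal (mehler (of_real c) y z * (avg_lik (a * c) z * mixlik P a y / (avg_lik a y * mixlik P (a * c) z))) \<partial>cscg)" for y
  have [measurable]: "W \<in> borel_measurable borel" unfolding W_def by measurable
  have "?I = (\<integral>\<^sup>+\<omega>. \<integral>\<^sup>+y. \<integral>\<^sup>+z. ennreal (lik a (snd \<omega>) y) * ennreal (mehler (of_real c) y z * (avg_lik (a * c) z * mixlik P a y / (avg_lik a y * mixlik P (a * c) z))) \<partial>cscg \<partial>cscg \<partial>p)"
    by (subst nn_integral_coupling, measurable) (intro nn_integral_cong, simp add: ennreal_mult'[symmetric] mult.assoc)
  also have "\<dots> = (\<integral>\<^sup>+\<omega>. \<integral>\<^sup>+y. ennreal (lik a (snd \<omega>) y) * W y \<partial>cscg \<partial>p)"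
    unfolding W_def by (intro nn_integral_cong, subst nn_integral_cmult) auto
  also have "\<dots> = (\<integral>\<^sup>+y. \<integral>\<^sup>+\<omega>. ennreal (lik a (snd \<omega>) y) * W y \<partial>p \<partial>cscg)"
    by (rule pxs.Fubini'[symmetric]) measurable
  also have "\<dots> = (\<integral>\<^sup>+y. ennreal (avg_lik a y) * W y \<partial>cscg)"
    by (simp add: nn_integral_multc avg_lik_eq)
  also have "\<dots> = (\<integral>\<^sup>+y. \<integral>\<^sup>+z. ennreal (mehler (of_real c) y z) * ennreal (mixlik P a y) * ennreal (avg_lik (a * c) z / mixlik P (a * c) z) \<partial>cscg \<partial>cscg)"
    unfolding W_def
    by (intro nn_integral_cong, subst nn_integral_cmult[symmetric], measurable, intro nn_integral_cong)
       (simp add: ennreal_mult'[symmetric] field_simps)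
  also have "\<dots> = (\<integral>\<^sup>+z. \<integral>\<^sup>+y. ennreal (mehler (of_real c) y z) * ennreal (mixlik P a y) * ennreal (avg_lik (a * c) z / mixlik P (a * c) z) \<partial>cscg \<partial>cscg)"
    by (rule ss.Fubini'[symmetric]) measurable
  also have "\<dots> = (\<integral>\<^sup>+z. ennreal (mixlik P (a * c) z) * ennreal (avg_lik (a * c) z / mixlik P (a * c) z) \<partial>cscg)"
    using P_pos by (simp add: nn_integral_multc nn_integral_mehler_mixlik[OF c])
  also have "\<dots> = (\<integral>\<^sup>+z. ennreal (avg_lik (a * c) z) \<partial>cscg)"
    by (simp add: ennreal_mult'[symmetric])
  finally show ?thesis by (simp add: nn_integral_avg_lik)
qed

text \<open>Behind the data processing inequality I(u;z) <= I(u;y). Conditioning turns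
  \<open>lik a\<close> into \<open>La\<close>, which cancels; the kernel carries
  \<open>avg_lik a\<close> to \<open>avg_lik (a * c)\<close>, which cancels too, and the mass of
  \<open>Lb\<close> remains.\<close>

lemma dpi_ratio_le_1:
  "(\<integral>\<^sup>+x. ennreal (case x of (\<omega>, y, z) \<Rightarrow> Lb (fst \<omega>, z) * avg_lik a y / (avg_lik (a * c) z * La (fst \<omega>, y))) \<partial>coupling a c) \<le> 1"
  (is "?I \<le> 1")
proof -
  define \<psi> where "\<psi> us = (\<integral>\<^sup>+z. ennreal (mehler (of_real c) (snd us) z * (Lb (fst us, z) * avg_lik a (snd us) / (avg_lik (a * c) z * La us))) \<partial>cscg)" for us
  have [measurable]: "\<psi> \<in> borel_measurable (U \<Otimes>\<^sub>M borel)" unfolding \<psi>_def by measurable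
  have "?I = (\<integral>\<^sup>+\<omega>. \<integral>\<^sup>+y. \<integral>\<^sup>+z. ennreal (lik a (snd \<omega>) y) * ennreal (mehler (of_real c) y z * (Lb (fst \<omega>, z) * avg_lik a y / (avg_lik (a * c) z * La (fst \<omega>, y)))) \<partial>cscg \<partial>cscg \<partial>p)"
    by (subst nn_integral_coupling, measurable) (intro nn_integral_cong, simp add: ennreal_mult'[symmetric] mult.assoc)
  also have "\<dots> = (\<integral>\<^sup>+\<omega>. \<integral>\<^sup>+y. ennreal (lik a (snd \<omega>) y) * \<psi> (fst \<omega>, y) \<partial>cscg \<partial>p)"
    unfolding \<psi>_def by (intro nn_integral_cong, subst nn_integral_cmult) auto
  also have "\<dots> = (\<integral>\<^sup>+us. ennreal (La us) * \<psi> us \<partial>(pu \<Otimes>\<^sub>M cscg))"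
    by (rule cond_lik_eq[OF La]) measurable
  also have "\<dots> \<le> (\<integral>\<^sup>+us. \<integral>\<^sup>+z. ennreal (mehler (of_real c) (snd us) z) * ennreal (avg_lik a (snd us)) * ennreal (Lb (fst us, z) / avg_lik (a * c) z) \<partial>cscg \<partial>(pu \<Otimes>\<^sub>M cscg))"
  proof (rule nn_integral_mono)
    fix us assume [measurable]: "us \<in> space (pu \<Otimes>\<^sub>M cscg)"
    then have [measurable]: "fst us \<in> space U" by (auto simp: space_pair_measure)
    have "ennreal (La us) * \<psi> us = (\<integral>\<^sup>+z. ennreal (La us) * ennreal (mehler (of_real c) (snd us) z * (Lb (fst us, z) * avg_lik a (snd us) / (avg_lik (a * c) z * La us))) \<partial>cscg)"
      unfolding \<psi>_def by (rule nn_integral_cmult[symmetric]) measurable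
    also have "\<dots> \<le> (\<integral>\<^sup>+z. ennreal (mehler (of_real c) (snd us) z) * ennreal (avg_lik a (snd us)) * ennreal (Lb (fst us, z) / avg_lik (a * c) z) \<partial>cscg)"
      \<comment> \<open>Where \<open>La\<close> vanishes the left side is 0; elsewhere it cancels
        and both integrands agree.\<close>
      by (intro nn_integral_mono) (cases "La us = 0"; simp add: ennreal_mult'[symmetric] field_simps)
    finally show "ennreal (La us) * \<psi> us \<le> (\<integral>\<^sup>+z. ennreal (mehler (of_real c) (snd us) z) * ennreal (avg_lik a (snd us)) * ennreal (Lb (fst us, z) / avg_lik (a * c) z) \<partial>cscg)" .
  qed
  also have "\<dots> = (\<integral>\<^sup>+u. \<integral>\<^sup>+y. \<integral>\<^sup>+z. ennreal (mehler (of_real c) y z) * ennreal (avg_lik a y) * ennreal (Lb (u, z) / avg_lik (a * c) z) \<partial>cscg \<partial>cscg \<partial>pu)"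
    by (subst cscg.nn_integral_fst[symmetric]) auto
  also have "\<dots> = (\<integral>\<^sup>+u. \<integral>\<^sup>+z. \<integral>\<^sup>+y. ennreal (mehler (of_real c) y z) * ennreal (avg_lik a y) * ennreal (Lb (u, z) / avg_lik (a * c) z) \<partial>cscg \<partial>cscg \<partial>pu)"
    by (intro nn_integral_cong ss.Fubini'[symmetric]) measurable
  also have "\<dots> = (\<integral>\<^sup>+u. \<integral>\<^sup>+z. ennreal (avg_lik (a * c) z) * ennreal (Lb (u, z) / avg_lik (a * c) z) \<partial>cscg \<partial>pu)"
    by (simp add: nn_integral_multc nn_integral_mehler_avg_lik[OF c])
  also have "\<dots> = (\<integral>\<^sup>+u. \<integral>\<^sup>+z. ennreal (Lb (u, z)) \<partial>cscg \<partial>pu)"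
    by (simp add: ennreal_mult'[symmetric])
  also have "\<dots> = (\<integral>\<^sup>+us. ennreal (Lb us) \<partial>(pu \<Otimes>\<^sub>M cscg))"
    by (subst cscg.nn_integral_fst[symmetric]) auto
  finally show ?thesis by (simp add: cond_lik_nn_integral[OF Lb])
qed

section \<open>Comparison of the information at two gains\<close>

lemma info_lr_coupling:
  "integrable (coupling a c) (\<lambda>(\<omega>, y, z). info_lr La a (\<omega>, y))"
  "integrable (coupling a c) (\<lambda>(\<omega>, y, z). info_lr Lb (a * c) (\<omega>, z))"
  "(\<integral>x. (case x of (\<omega>, y, z) \<Rightarrow> info_lr La a (\<omega>, y)) \<partial>coupling a c) = integral\<^sup>L (rho a) (info_lr La a)"
  "(\<integral>x. (case x of (\<omega>, y, z) \<Rightarrow> info_lr Lb (a * c) (\<omega>, z)) \<partial>coupling a c) = integral\<^sup>L (rho (a * c)) (info_lr Lb (a * c))"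
  using coupling_fst[OF c borel_measurable_info_lr[OF La]] coupling_snd[OF c borel_measurable_info_lr[OF Lb]]
    integrable_info_lr[OF La] integrable_info_lr[OF Lb]
  by auto

text \<open>In the coupling, the information density at z minus that at y is the logarithm of
  \<open>?R\<close>, so ln t <= t - 1 bounds the difference of the means by the mean of
  \<open>?R\<close> minus one.\<close>

lemma info_degraded_le:
  "integral\<^sup>L (rho (a * c)) (info_lr Lb (a * c)) \<le> integral\<^sup>L (rho a) (info_lr La a)"
proof -
  interpret G: prob_space "coupling a c" by (rule prob_space_coupling[OF c])
  let ?R = "\<lambda>(\<omega>, y, z). Lb (fst \<omega>, z) * avg_lik a y / (avg_lik (a * c) z * La (fst \<omega>, y))"
  let ?fa = "\<lambda>(\<omega>, y, z). info_lr La a (\<omega>, y)" and ?fb = "\<lambda>(\<omega>, y, z). info_lr Lb (a * c) (\<omega>, z)"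
  have R: "integrable (coupling a c) ?R" "integral\<^sup>L (coupling a c) ?R \<le> 1"
    by (rule nonneg_nn_integral_le_imp_integral[where c=1]; use dpi_ratio_le_1 in auto)+
  have "integral\<^sup>L (coupling a c) ?fb \<le> (\<integral>x. ?R x - 1 + ?fa x \<partial>coupling a c)"
  proof (rule integral_mono_AE)
    show "AE x in coupling a c. ?fb x \<le> ?R x - 1 + ?fa x"
      using AE_coupling_pos[OF c La Lb]
    proof eventually_elim
      case (elim x)
      obtain \<omega> y z where x: "x = (\<omega>, y, z)" by (cases x) auto
      have "0 < La (fst \<omega>, y)" "0 < Lb (fst \<omega>, z)" using elim x by auto
      moreover have "0 < avg_lik a y" "0 < avg_lik (a * c) z" by (rule avg_lik_pos)+
      ultimately show ?case
        using ln_le_minus_one[of "?R x"] by (simp add: x info_lr_def ln_div ln_mult)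
    qed
  qed (auto intro!: Bochner_Integration.integrable_add Bochner_Integration.integrable_diff R(1) info_lr_coupling(1,2))
  also have "\<dots> = integral\<^sup>L (coupling a c) ?R - 1 + integral\<^sup>L (coupling a c) ?fa"
    by (subst Bochner_Integration.integral_add Bochner_Integration.integral_diff;
        (intro Bochner_Integration.integrable_diff R(1) info_lr_coupling(1))?; simp add: G.prob_space[simplified])+
  finally show ?thesis using R(2) by (simp add: info_lr_coupling(3,4))
qed

text \<open>Pointwise in the coupling, ?fa - ?fb = ln ?R1 + ln ?R2 + (?ga - ?gb). The two logarithms
  have mean at most zero, so the difference is bounded by that of the Gaussian information
  densities, whose means are explicit.\<close>

lemma info_diff_le:
  "integral\<^sup>L (rho a) (info_lr La a) - integral\<^sup>L (rho (a * c)) (info_lr Lb (a * c))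
     \<le> ln (1 + P * a\<^sup>2) - ln (1 + P * (a * c)\<^sup>2)"
proof -
  interpret G: prob_space "coupling a c" by (rule prob_space_coupling[OF c])
  let ?R1 = "\<lambda>(\<omega>, y, z). La (fst \<omega>, y) * lik (a * c) (snd \<omega>) z / (Lb (fst \<omega>, z) * lik a (snd \<omega>) y)"
  let ?R2 = "\<lambda>(\<omega>, y, z). avg_lik (a * c) z * mixlik P a y / (avg_lik a y * mixlik P (a * c) z)"
  let ?fa = "\<lambda>(\<omega>, y, z). info_lr La a (\<omega>, y)" and ?fb = "\<lambda>(\<omega>, y, z). info_lr Lb (a * c) (\<omega>, z)"
  let ?ga = "\<lambda>(\<omega>, y, z). gauss_lr a (\<omega>, y)" and ?gb = "\<lambda>(\<omega>, y, z). gauss_lr (a * c) (\<omega>, z)"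
  have R1: "integrable (coupling a c) ?R1" "integral\<^sup>L (coupling a c) ?R1 \<le> 1"
    by (rule nonneg_nn_integral_le_imp_integral[where c=1]; use mixed_ratio_le_1 in auto)+
  have R2: "integrable (coupling a c) ?R2" "integral\<^sup>L (coupling a c) ?R2 \<le> 1"
    by (rule nonneg_nn_integral_le_imp_integral[where c=1]; use gauss_ratio_le_1 in auto)+
  have gm: "gauss_lr b \<in> borel_measurable (p \<Otimes>\<^sub>M cscg)" for b
    using gauss_lr(1)[of b, THEN borel_measurable_integrable] by simp
  note ga = coupling_fst[OF c gm] and gb = coupling_snd[OF c gm]
  have gI: "integrable (coupling a c) ?ga" "integrable (coupling a c) ?gb"
    using ga(1)[OF gauss_lr(1)] gb(1)[OF gauss_lr(1)] by auto
  have "integral\<^sup>L (coupling a c) ?fa \<le> (\<integral>x. ((?R1 x - 1) + (?R2 x - 1)) + ((?ga x - ?gb x) + ?fb x) \<partial>coupling a c)"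
  proof (rule integral_mono_AE)
    show "AE x in coupling a c. ?fa x \<le> ((?R1 x - 1) + (?R2 x - 1)) + ((?ga x - ?gb x) + ?fb x)"
      using AE_coupling_pos[OF c La Lb]
    proof eventually_elim
      case (elim x)
      obtain \<omega> y z where x: "x = (\<omega>, y, z)" by (cases x) auto
      have "0 < La (fst \<omega>, y)" "0 < Lb (fst \<omega>, z)" using elim x by auto
      moreover have "0 < avg_lik a y" "0 < avg_lik (a * c) z" by (rule avg_lik_pos)+
      moreover have "0 < mixlik P a y" "0 < mixlik P (a * c) z" using mixlik_pos P_pos by auto
      ultimately show ?case
        using ln_le_minus_one[of "?R1 x"] ln_le_minus_one[of "?R2 x"] 
        by (simp add: x info_lr_def gauss_lr_def ln_div ln_mult)
    qed
  qed (intro Bochner_Integration.integrable_add Bochner_Integration.integrable_diff R1(1) R2(1) gI info_lr_coupling(1,2) G.integrable_const)+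
  also have "\<dots> = ((integral\<^sup>L (coupling a c) ?R1 - 1) + (integral\<^sup>L (coupling a c) ?R2 - 1)) + 
     ((integral\<^sup>L (coupling a c) ?ga - integral\<^sup>L (coupling a c) ?gb) + integral\<^sup>L (coupling a c) ?fb)"
  proof -
    have "(\<integral>x. ((f1 x - 1) + (f2 x - 1)) + ((f3 x - f4 x) + f5 x) \<partial>coupling a c) =
       ((integral\<^sup>L (coupling a c) f1 - 1) + (integral\<^sup>L (coupling a c) f2 - 1)) + 
     ((integral\<^sup>L (coupling a c) f3 - integral\<^sup>L (coupling a c) f4) + integral\<^sup>L (coupling a c) f5)"
      if "integrable (coupling a c) f1" "integrable (coupling a c) f2" "integrable (coupling a c) f3"
        "integrable (coupling a c) f4" "integrable (coupling a c) f5" for f1 f2 f3 f4 f5 :: "_ \<Rightarrow> real"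
      using that by (simp add: G.prob_space[simplified])
    then show ?thesis using R1(1) R2(1) gI info_lr_coupling(2) by blast
  qed
  finally have "integral\<^sup>L (rho a) (info_lr La a) - integral\<^sup>L (rho (a * c)) (info_lr Lb (a * c)) \<le> 
     integral\<^sup>L (coupling a c) ?ga - integral\<^sup>L (coupling a c) ?gb"
    using R1(2) R2(2) by (simp add: info_lr_coupling(3,4))
  also have "integral\<^sup>L (coupling a c) ?ga - integral\<^sup>L (coupling a c) ?gb =
     ((1 + a\<^sup>2 * mean_power) / (1 + P * a\<^sup>2) - (1 + (a * c)\<^sup>2 * mean_power) / (1 + P * (a * c)\<^sup>2)) + (ln (1 + P * a\<^sup>2) - ln (1 + P * (a * c)\<^sup>2))"
    by (simp add: ga(2) gb(2) gauss_lr(2))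
  also have "\<dots> \<le> ln (1 + P * a\<^sup>2) - ln (1 + P * (a * c)\<^sup>2)"
  proof -
    have pos: "0 < 1 + P * a\<^sup>2" "0 < 1 + P * (a * c)\<^sup>2"
      using P_pos by (simp_all add: add_pos_nonneg)
    have "c\<^sup>2 \<le> 1" using c by (simp add: abs_square_le_1)
    then have "(a * c)\<^sup>2 \<le> a\<^sup>2" by (simp add: power_mult_distrib mult_left_le)
    \<comment> \<open>The power constraint enters here: for mean power m <= P the quotient (1 + a^2
      m) / (1 + P a^2) does not increase with the gain, and it is constant exactly when m =
      P.\<close>
    then have "0 \<le> (a\<^sup>2 - (a * c)\<^sup>2) * (P - mean_power)" using mean_power_le by simp
    then have "(1 + a\<^sup>2 * mean_power) * (1 + P * (a * c)\<^sup>2) \<le> (1 + (a * c)\<^sup>2 * mean_power) * (1 + P * a\<^sup>2)"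
      by (simp add: algebra_simps)
    then have "(1 + a\<^sup>2 * mean_power) / (1 + P * a\<^sup>2) \<le> (1 + (a * c)\<^sup>2 * mean_power) / (1 + P * (a * c)\<^sup>2)"
      using pos by (simp add: divide_le_eq pos_le_divide_eq mult.commute)
    then show ?thesis by simp
  qed
  finally show ?thesis .
qed

end

end

section \<open>Gaussian vectors and their projections\<close>

lemma lborel_complex_eq: "lborel = distr (lborel \<Otimes>\<^sub>M lborel) borel (\<lambda>(a, b). Complex a b)"
proof (rule lborel_eqI)
  have [measurable]: "(\<lambda>(a, b). Complex a b) \<in> lborel \<Otimes>\<^sub>M lborel \<rightarrow>\<^sub>M borel"
    unfolding Complex_eq by measurable
  fix l u :: complex assume le: "\<And>b. b \<in> Basis \<Longrightarrow> l \<bullet> b \<le> u \<bullet> b"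
  have "(\<lambda>(a, b). Complex a b) -` box l u = {Re l<..<Re u} \<times> {Im l<..<Im u}"
    by (auto simp: in_box_complex_iff)
  moreover have "Re l \<le> Re u" "Im l \<le> Im u"
    using le[of 1] le[of \<i>] by (auto simp: Basis_complex_def)
  ultimately show "emeasure (distr (lborel \<Otimes>\<^sub>M lborel) borel (\<lambda>(a, b). Complex a b)) (box l u) = (\<Prod>b\<in>Basis. (u - l) \<bullet> b)"
    by (subst emeasure_distr)
       (auto simp: space_pair_measure lborel.emeasure_pair_measure_Times Basis_complex_def ennreal_mult'[symmetric])
qed simp

lemma nn_integral_lborel_complex:
  assumes [measurable]: "F \<in> borel_measurable borel"
  shows "(\<integral>\<^sup>+z. F z \<partial>lborel) = (\<integral>\<^sup>+a. \<integral>\<^sup>+b. F (Complex a b) \<partial>lborel \<partial>lborel)"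
    "(\<integral>\<^sup>+z. F z \<partial>lborel) = (\<integral>\<^sup>+b. \<integral>\<^sup>+a. F (Complex a b) \<partial>lborel \<partial>lborel)"
proof -
  have [measurable]: "(\<lambda>(a, b). Complex a b) \<in> lborel \<Otimes>\<^sub>M lborel \<rightarrow>\<^sub>M borel"
    "(\<lambda>(a, b). Complex a b) \<in> borel \<Otimes>\<^sub>M borel \<rightarrow>\<^sub>M borel"
    unfolding Complex_eq by measurable
  show *: "(\<integral>\<^sup>+z. F z \<partial>lborel) = (\<integral>\<^sup>+a. \<integral>\<^sup>+b. F (Complex a b) \<partial>lborel \<partial>lborel)"
    by (subst lborel_complex_eq, subst nn_integral_distr, measurable, subst lborel.nn_integral_fst[symmetric]) auto
  show "(\<integral>\<^sup>+z. F z \<partial>lborel) = (\<integral>\<^sup>+b. \<integral>\<^sup>+a. F (Complex a b) \<partial>lborel \<partial>lborel)"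
    unfolding * by (rule lborel_pair.Fubini') measurable
qed

text \<open>With the other coordinate fixed, a shear is a translation of a line, so it preserves the
  inner integral once the order of integration is chosen accordingly.\<close>

lemma nn_integral_lborel_shear:
  assumes [measurable]: "F \<in> borel_measurable borel"
  shows "(\<integral>\<^sup>+z. F (Complex (Re z + t * Im z) (Im z)) \<partial>lborel) = (\<integral>\<^sup>+z. F z \<partial>lborel)"
    and "(\<integral>\<^sup>+z. F (Complex (Re z) (Im z + t * Re z)) \<partial>lborel) = (\<integral>\<^sup>+z. F z \<partial>lborel)"
proof -
  have [measurable]: "(\<lambda>z. Complex (Re z + t * Im z) (Im z)) \<in> borel \<rightarrow>\<^sub>M borel"
     "(\<lambda>z. Complex (Re z) (Im z + t * Re z)) \<in> borel \<rightarrow>\<^sub>M borel"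
     "(\<lambda>a. Complex a b) \<in> borel \<rightarrow>\<^sub>M borel" "(\<lambda>a. Complex b a) \<in> borel \<rightarrow>\<^sub>M borel" for b
    unfolding Complex_eq by measurable
  show "(\<integral>\<^sup>+z. F (Complex (Re z + t * Im z) (Im z)) \<partial>lborel) = (\<integral>\<^sup>+z. F z \<partial>lborel)"
    using nn_integral_lborel_translate[of "\<lambda>a. F (Complex a b)" "t * b" for b]
    by (simp add: nn_integral_lborel_complex(2) add.commute)
  show "(\<integral>\<^sup>+z. F (Complex (Re z) (Im z + t * Re z)) \<partial>lborel) = (\<integral>\<^sup>+z. F z \<partial>lborel)"
    using nn_integral_lborel_translate[of "\<lambda>b. F (Complex a b)" "t * a" for a]
    by (simp add: nn_integral_lborel_complex(1) add.commute)
qed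

text \<open>A plane rotation other than \<open>- 1\<close> is a product of three shears.\<close>

lemma nn_integral_lborel_rotate:
  assumes F[measurable]: "F \<in> borel_measurable borel" and e: "norm e = 1"
  shows "(\<integral>\<^sup>+z. F (e * z) \<partial>lborel) = (\<integral>\<^sup>+z. F (z :: complex) \<partial>lborel)"
proof (cases "e = - 1")
  case True
  then show ?thesis using nn_integral_lborel_scale[of F "- 1"] by simp
next
  case False
  define q where "q = Im e"
  \<comment> \<open>For a rotation by the angle theta, \<open>q\<close> is sin theta and
    \<open>t\<close> is - tan (theta / 2). The tangent is undefined exactly for the excluded
    half-turn.\<close>
  define t where "t = - q / (1 + Re e)"
  have sq: "(Re e)\<^sup>2 + q\<^sup>2 = 1" using e by (simp add: q_def cmod_def)
  have "Re e \<noteq> - 1"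
  proof
    assume "Re e = - 1"
    with sq have "q = 0" by simp
    with \<open>Re e = - 1\<close> False show False by (simp add: complex_eq_iff q_def)
  qed
  then have ne: "1 + Re e \<noteq> 0" by linarith
  have tq: "1 + t * q = Re e"
  proof -
    have "(1 + t * q) * (1 + Re e) = 1 + Re e - q\<^sup>2"
      using ne by (simp add: t_def field_simps power2_eq_square)
    also have "\<dots> = Re e * (1 + Re e)" using sq by (simp add: power2_eq_square algebra_simps)
    finally show ?thesis using ne by simp
  qed
  have t2: "t * (1 + Re e) = - q" using ne by (simp add: t_def)
  let ?S1 = "\<lambda>z. Complex (Re z + t * Im z) (Im z)" and ?S2 = "\<lambda>z. Complex (Re z) (Im z + q * Re z)"
  have [measurable]: "?S1 \<in> borel \<rightarrow>\<^sub>M borel" "?S2 \<in> borel \<rightarrow>\<^sub>M borel"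
    unfolding Complex_eq by measurable
  have e_eq: "e * z = ?S1 (?S2 (?S1 z))" for z
  proof -
    have "Re z + t * Im z + t * (Im z + q * (Re z + t * Im z)) = (1 + t * q) * Re z + (t * (1 + (1 + t * q))) * Im z"
      by (simp add: algebra_simps)
    also have "\<dots> = Re e * Re z - q * Im z" unfolding tq t2 by simp
    finally have 1: "Re (e * z) = Re (?S1 (?S2 (?S1 z)))" by (simp add: q_def)
    have "Im z + q * (Re z + t * Im z) = q * Re z + (1 + t * q) * Im z" by (simp add: algebra_simps)
    then have 2: "Im (e * z) = Im (?S1 (?S2 (?S1 z)))" unfolding tq by (simp add: q_def)
    show ?thesis using 1 2 by (rule complex_eqI)
  qed
  have "(\<integral>\<^sup>+z. F (e * z) \<partial>lborel) = (\<integral>\<^sup>+z. F (?S1 (?S2 z)) \<partial>lborel)"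
    unfolding e_eq by (rule nn_integral_lborel_shear(1)[of "\<lambda>z. F (?S1 (?S2 z))"]) measurable
  also have "\<dots> = (\<integral>\<^sup>+z. F (?S1 z) \<partial>lborel)"
    by (rule nn_integral_lborel_shear(2)[of "\<lambda>z. F (?S1 z)"]) measurable
  also have "\<dots> = (\<integral>\<^sup>+z. F z \<partial>lborel)"
    by (rule nn_integral_lborel_shear(1)) measurable
  finally show ?thesis .
qed

lemma nn_integral_cscg_rotate:
  assumes [measurable]: "F \<in> borel_measurable borel" and e: "norm e = 1"
  shows "(\<integral>\<^sup>+w. F (e * w) \<partial>cscg) = (\<integral>\<^sup>+w. F w \<partial>cscg)"
proof -
  have "(\<integral>\<^sup>+w. F w \<partial>cscg) = (\<integral>\<^sup>+w. ennreal (cscg_density 1 (e * w)) * F (e * w) \<partial>lborel)"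
    using nn_integral_lborel_rotate[of "\<lambda>w. ennreal (cscg_density 1 w) * F w" e] e
    by (simp add: nn_integral_cscg)
  also have "\<dots> = (\<integral>\<^sup>+w. F (e * w) \<partial>cscg)"
    using e by (subst nn_integral_cscg) (auto simp: cscg_density_def norm_mult)
  finally show ?thesis by simp
qed

lemma nn_integral_cscg_mult:
  assumes [measurable]: "F \<in> borel_measurable borel"
  shows "(\<integral>\<^sup>+w. F (a * w) \<partial>cscg) = (\<integral>\<^sup>+w. F (norm a *\<^sub>R w) \<partial>cscg)"
proof (cases "a = 0")
  case False
  then have "a * w = norm a *\<^sub>R (sgn a * w)" for w
    by (simp add: sgn_div_norm)
  then show ?thesis
    using nn_integral_cscg_rotate[of "\<lambda>w. F (norm a *\<^sub>R w)" "sgn a"] False by (simp add: norm_sgn)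
qed simp

text \<open>After scaling by the length r of the pair (a, b) and absorbing the phase of b into w,
  the sum is one Ornstein-Uhlenbeck step from y with complex correlation a / r. Integrating the
  Mehler kernel over its starting point gives one, so the standard Gaussian is stationary. For b = 0
  the correlation has modulus at least one or is undefined, hence the separate case.\<close>

lemma nn_integral_cscg_add:
  assumes [measurable]: "F \<in> borel_measurable borel"
  shows "(\<integral>\<^sup>+y. \<integral>\<^sup>+w. F (a * y + b * w) \<partial>cscg \<partial>cscg) = (\<integral>\<^sup>+w. F (sqrt ((norm a)\<^sup>2 + (norm b)\<^sup>2) *\<^sub>R w) \<partial>cscg)"
proof (cases "b = 0")
  case True
  then show ?thesis using cscg.emeasure_space_1 by (simp add: nn_integral_cscg_mult)
next
  case False
  interpret ss: pair_sigma_finite cscg cscg ..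
  define r where "r = sqrt ((norm a)\<^sup>2 + (norm b)\<^sup>2)"
  have r2: "r\<^sup>2 = (norm a)\<^sup>2 + (norm b)\<^sup>2" by (simp add: r_def)
  have r: "r > 0" using False by (simp add: r_def add_nonneg_pos)
  define c where "c = a / of_real r"
  have nc: "(norm c)\<^sup>2 = 1 - (norm b / r)\<^sup>2"
  proof -
    have "(norm a)\<^sup>2 / r\<^sup>2 + (norm b)\<^sup>2 / r\<^sup>2 = 1"
      unfolding add_divide_distrib[symmetric] r2[symmetric] using r by simp
    moreover have "(norm c)\<^sup>2 = (norm a)\<^sup>2 / r\<^sup>2" by (simp add: c_def norm_divide power_divide)
    moreover have "(norm b / r)\<^sup>2 = (norm b)\<^sup>2 / r\<^sup>2" by (rule power_divide)
    ultimately show ?thesis by linarith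
  qed
  have b0: "norm b / r > 0" using r False by simp
  have "(norm c)\<^sup>2 < 1" using nc zero_less_power[OF b0, of 2] by linarith
  then have c: "norm c < 1" using abs_square_less_1[of "norm c"] by simp
  have sc: "sqrt (1 - (norm c)\<^sup>2) = norm b / r" using b0 r by (simp add: nc)
  have "(\<integral>\<^sup>+y. \<integral>\<^sup>+w. F (a * y + b * w) \<partial>cscg \<partial>cscg) = (\<integral>\<^sup>+y. \<integral>\<^sup>+w. F (a * y + norm b *\<^sub>R w) \<partial>cscg \<partial>cscg)"
    by (intro nn_integral_cong nn_integral_cscg_mult[of "\<lambda>v. F (a * y + v)" for y]) measurable
  also have "\<dots> = (\<integral>\<^sup>+y. \<integral>\<^sup>+w. F (r *\<^sub>R (c * y + sqrt (1 - (norm c)\<^sup>2) *\<^sub>R w)) \<partial>cscg \<partial>cscg)"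
  proof -
    have "a * y + norm b *\<^sub>R w = r *\<^sub>R (c * y + (norm b / r) *\<^sub>R w)" for y w
      using r by (simp add: c_def scaleR_conv_of_real distrib_left)
    then show ?thesis unfolding sc by simp
  qed
  also have "\<dots> = (\<integral>\<^sup>+y. \<integral>\<^sup>+z. ennreal (mehler c y z) * F (r *\<^sub>R z) \<partial>cscg \<partial>cscg)"
    using c by (intro nn_integral_cong nn_integral_mehler_eq[of "\<lambda>z. F (r *\<^sub>R z)"]) auto
  also have "\<dots> = (\<integral>\<^sup>+z. \<integral>\<^sup>+y. ennreal (mehler c y z) * F (r *\<^sub>R z) \<partial>cscg \<partial>cscg)"
    by (rule ss.Fubini') measurable
  also have "\<dots> = (\<integral>\<^sup>+z. F (r *\<^sub>R z) \<partial>cscg)"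
    using c by (simp add: nn_integral_multc nn_integral_mehler')
  finally show ?thesis unfolding r_def .
qed

interpretation cscg_product: product_sigma_finite "\<lambda>_. cscg" ..

lemma nn_integral_PiM_cscg_sum:
  assumes "finite I" and [measurable]: "F \<in> borel_measurable borel"
  shows "(\<integral>\<^sup>+\<omega>. F (\<Sum>i\<in>I. a i * \<omega> i) \<partial>Pi\<^sub>M I (\<lambda>_. cscg)) =
     (\<integral>\<^sup>+w. F (sqrt (\<Sum>i\<in>I. (norm (a i))\<^sup>2) *\<^sub>R w) \<partial>cscg)"
  using assms
proof (induction I arbitrary: F)
  case empty
  then show ?case using cscg.emeasure_space_1 by (simp add: PiM_empty)
next
  case (insert i I)
  note [measurable] = insert.prems
  note [simp] = insert.hyps
  let ?s = "sqrt (\<Sum>i\<in>I. (norm (a i))\<^sup>2)"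
  have "(\<integral>\<^sup>+\<omega>. F (\<Sum>j\<in>insert i I. a j * \<omega> j) \<partial>Pi\<^sub>M (insert i I) (\<lambda>_. cscg)) =
    (\<integral>\<^sup>+y. (\<integral>\<^sup>+\<omega>. F (\<Sum>j\<in>insert i I. a j * fun_upd \<omega> i y j) \<partial>Pi\<^sub>M I (\<lambda>_. cscg)) \<partial>cscg)"
    by (rule cscg_product.product_nn_integral_insert_rev) auto
  also have "\<dots> = (\<integral>\<^sup>+y. (\<integral>\<^sup>+\<omega>. F (a i * y + (\<Sum>j\<in>I. a j * \<omega> j)) \<partial>Pi\<^sub>M I (\<lambda>_. cscg)) \<partial>cscg)"
  proof -
    have "(\<Sum>j\<in>I. a j * fun_upd \<omega> i y j) = (\<Sum>j\<in>I. a j * \<omega> j)" for \<omega> y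
      by (rule sum.cong) auto
    then show ?thesis by simp
  qed
  also have "\<dots> = (\<integral>\<^sup>+y. (\<integral>\<^sup>+w. F (a i * y + of_real ?s * w) \<partial>cscg) \<partial>cscg)"
    by (intro nn_integral_cong, subst insert.IH) (auto simp: scaleR_conv_of_real)
  also have "\<dots> = (\<integral>\<^sup>+w. F (sqrt (\<Sum>i\<in>insert i I. (norm (a i))\<^sup>2) *\<^sub>R w) \<partial>cscg)"
    by (subst nn_integral_cscg_add) (auto simp: sum_nonneg)
  finally show ?case .
qed

section \<open>Noise vectors in coordinates\<close>

lemma vec_measurable [measurable]: "(\<lambda>\<omega>. \<chi> i. (\<omega> i :: complex)) \<in> Pi\<^sub>M UNIV (\<lambda>_. borel) \<rightarrow>\<^sub>M borel"
  by (subst borel_measurable_euclidean_space) (auto simp: Basis_vec_def inner_axis)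

lemma lborel_vec_eq: 
  "(lborel :: (complex ^ 'n) measure) = distr (Pi\<^sub>M UNIV (\<lambda>_. lborel)) borel (\<lambda>\<omega>. \<chi> i. \<omega> i)"
proof (rule lborel_eqI)
  interpret product_sigma_finite "\<lambda>_. lborel" ..
  fix l u :: "complex ^ 'n" assume le: "\<And>b. b \<in> Basis \<Longrightarrow> l \<bullet> b \<le> u \<bullet> b"
  have le': "l $ i \<bullet> b \<le> u $ i \<bullet> b" if "b \<in> Basis" for i b
    using le[of "axis i b"] that by (auto simp: Basis_vec_def inner_axis)
  have m: "(\<lambda>\<omega>. \<chi> i. \<omega> i) \<in> Pi\<^sub>M (UNIV :: 'n set) (\<lambda>_. lborel) \<rightarrow>\<^sub>M (borel :: (complex ^ 'n) measure)"
    using vec_measurable by (simp cong: measurable_cong_sets PiM_cong)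
  have "emeasure (distr (Pi\<^sub>M UNIV (\<lambda>_. lborel)) borel (\<lambda>\<omega>. \<chi> i. \<omega> i)) (box l u) =
    emeasure (Pi\<^sub>M UNIV (\<lambda>_. lborel)) (Pi\<^sub>E UNIV (\<lambda>i. box (l $ i) (u $ i)))"
  proof -
    have "(\<chi> i. \<omega> i) \<in> box l u \<longleftrightarrow> (\<forall>i. \<omega> i \<in> box (l $ i) (u $ i))" for \<omega>
      unfolding mem_box by (auto simp: Basis_vec_def inner_axis)
    then have "(\<lambda>\<omega>. \<chi> i. \<omega> i) -` box l u \<inter> space (Pi\<^sub>M UNIV (\<lambda>_. lborel)) = Pi\<^sub>E UNIV (\<lambda>i. box (l $ i) (u $ i))"
      by (auto simp: space_PiM PiE_iff)
    then show ?thesis by (subst emeasure_distr[OF m]) auto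
  qed
  also have "\<dots> = (\<Prod>i\<in>UNIV. emeasure lborel (box (l $ i) (u $ i)))"
    by (rule emeasure_PiM) auto
  also have "\<dots> = (\<Prod>i\<in>UNIV. ennreal (\<Prod>b\<in>Basis. (u $ i - l $ i) \<bullet> b))"
    using le' by (intro prod.cong refl emeasure_lborel_box) auto
  also have "\<dots> = ennreal (\<Prod>i\<in>UNIV. \<Prod>b\<in>Basis. (u $ i - l $ i) \<bullet> b)"
    using le' by (intro prod_ennreal prod_nonneg) (auto simp: inner_diff_left)
  also have "(\<Prod>i\<in>UNIV. \<Prod>b\<in>Basis. (u $ i - l $ i) \<bullet> b) = (\<Prod>b\<in>Basis. (u - l) \<bullet> b)"
  proof -
    \<comment> \<open>The real basis of the vector space is indexed by pairs of a coordinate and a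
      real basis element of \<open>complex\<close>, so the volume of a box is a double
      product.\<close>
    have "(\<Prod>b\<in>Basis. (u - l) \<bullet> b) = (\<Prod>x\<in>UNIV \<times> Basis. (u - l) \<bullet> axis (fst x) (snd x))"
    proof (rule prod.reindex_bij_betw[symmetric])
      have "inj_on (\<lambda>x. axis (fst x) (snd x)) (UNIV \<times> Basis :: ('n \<times> complex) set)"
        by (auto simp: inj_on_def axis_eq_axis)
      moreover have "(\<lambda>x. axis (fst x) (snd x)) ` (UNIV \<times> Basis) = (Basis :: (complex ^ 'n) set)"
        by (force simp: Basis_vec_def)
      ultimately show "bij_betw (\<lambda>x. axis (fst x) (snd x)) (UNIV \<times> Basis) (Basis :: (complex ^ 'n) set)"
        by (simp add: bij_betw_def)
    qed
    then show ?thesis by (simp add: prod.cartesian_product inner_axis case_prod_beta')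
  qed
  finally show "emeasure (distr (Pi\<^sub>M UNIV (\<lambda>_. lborel)) borel (\<lambda>\<omega>. \<chi> i. \<omega> i)) (box l u) = (\<Prod>b\<in>Basis. (u - l) \<bullet> b)" .
qed simp

lemma sets_cscg_noise [simp, measurable_cong]: "sets (cscg_noise :: (complex ^ 'n) measure) = sets borel"
  and space_cscg_noise [simp]: "space (cscg_noise :: (complex ^ 'n) measure) = UNIV"
  by (simp_all add: cscg_noise_def)

lemma borel_measurable_noise_density [measurable]:
  "(\<lambda>w :: complex ^ 'n. ennreal (\<Prod>i\<in>UNIV. cscg_density 1 (w $ i))) \<in> borel_measurable borel"
proof -
  have [measurable]: "(\<lambda>w. w $ i) \<in> borel_measurable borel" for i :: 'n
    by (intro borel_measurable_continuous_onI continuous_intros)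
  show ?thesis by measurable
qed

lemma PiM_cscg_eq: 
  "Pi\<^sub>M (UNIV :: 'n :: finite set) (\<lambda>_. cscg) = density (Pi\<^sub>M UNIV (\<lambda>_. lborel)) (\<lambda>\<omega>. \<Prod>i\<in>UNIV. ennreal (cscg_density 1 (\<omega> i)))"
proof -
  interpret L: product_sigma_finite "\<lambda>_. lborel" ..
  have sP: "sets (Pi\<^sub>M (UNIV :: 'n set) (\<lambda>_. lborel)) = sets (Pi\<^sub>M (UNIV :: 'n set) (\<lambda>_. cscg))"
    by (intro sets_PiM_cong) auto
  have "density (Pi\<^sub>M (UNIV :: 'n set) (\<lambda>_. lborel)) (\<lambda>\<omega>. \<Prod>i\<in>UNIV. ennreal (cscg_density 1 (\<omega> i))) = Pi\<^sub>M UNIV (\<lambda>_. cscg)"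
  proof (rule cscg_product.PiM_eqI)
    fix A :: "'n \<Rightarrow> complex set" assume "\<And>i. i \<in> UNIV \<Longrightarrow> A i \<in> sets cscg"
    then have [measurable]: "A i \<in> sets borel" for i by simp
    have "emeasure (density (Pi\<^sub>M (UNIV :: 'n set) (\<lambda>_. lborel)) (\<lambda>\<omega>. \<Prod>i\<in>UNIV. ennreal (cscg_density 1 (\<omega> i)))) (Pi\<^sub>E UNIV A) =
      (\<integral>\<^sup>+\<omega>. (\<Prod>i\<in>UNIV. ennreal (cscg_density 1 (\<omega> i))) * indicator (Pi\<^sub>E UNIV A) \<omega> \<partial>Pi\<^sub>M UNIV (\<lambda>_. lborel))"
      by (rule emeasure_density) (auto intro!: sets_PiM_I_finite)
    also have "\<dots> = (\<integral>\<^sup>+\<omega>. (\<Prod>i\<in>UNIV. ennreal (cscg_density 1 (\<omega> i)) * indicator (A i) (\<omega> i)) \<partial>Pi\<^sub>M UNIV (\<lambda>_. lborel))"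
    proof (rule nn_integral_cong)
      fix \<omega> :: "'n \<Rightarrow> complex"
      have "(\<Prod>i\<in>UNIV. indicator (A i) (\<omega> i) :: ennreal) = indicator (Pi\<^sub>E UNIV A) \<omega>"
      proof (cases "\<forall>i. \<omega> i \<in> A i")
        case True
        then show ?thesis by (simp add: PiE_iff)
      next
        case False
        then obtain i where "indicator (A i) (\<omega> i) = (0 :: ennreal)" by (auto simp: indicator_def)
        then have "(\<Prod>i\<in>UNIV. indicator (A i) (\<omega> i) :: ennreal) = 0" by (intro prod_zero) auto
        with False show ?thesis by (simp add: PiE_iff)
      qed
      then show "(\<Prod>i\<in>UNIV. ennreal (cscg_density 1 (\<omega> i))) * indicator (Pi\<^sub>E UNIV A) \<omega> =
        (\<Prod>i\<in>UNIV. ennreal (cscg_density 1 (\<omega> i)) * indicator (A i) (\<omega> i))"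
        by (simp add: prod.distrib)
    qed
    also have "\<dots> = (\<Prod>i\<in>UNIV. \<integral>\<^sup>+z. ennreal (cscg_density 1 z) * indicator (A i) z \<partial>lborel)"
      by (rule L.product_nn_integral_prod) auto
    also have "\<dots> = (\<Prod>i\<in>UNIV. emeasure cscg (A i))"
      by (simp add: cscg_def emeasure_density)
    finally show "emeasure (density (Pi\<^sub>M (UNIV :: 'n set) (\<lambda>_. lborel)) (\<lambda>\<omega>. \<Prod>i\<in>UNIV. ennreal (cscg_density 1 (\<omega> i)))) (Pi\<^sub>E UNIV A) =
      (\<Prod>i\<in>UNIV. emeasure cscg (A i))" .
  qed (auto simp: sP)
  then show ?thesis ..
qed

lemma nn_integral_cscg_noise_lborel:
  fixes F :: "complex ^ 'n \<Rightarrow> ennreal"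
  assumes [measurable]: "F \<in> borel_measurable borel"
  shows "(\<integral>\<^sup>+w. F w \<partial>cscg_noise) = (\<integral>\<^sup>+w. ennreal (\<Prod>i\<in>UNIV. cscg_density 1 (w $ i)) * F w \<partial>lborel)"
  unfolding cscg_noise_def by (subst nn_integral_density) auto

lemma nn_integral_cscg_noise:
  fixes F :: "complex ^ 'n \<Rightarrow> ennreal"
  assumes [measurable]: "F \<in> borel_measurable borel"
  shows "(\<integral>\<^sup>+w. F w \<partial>cscg_noise) = (\<integral>\<^sup>+\<omega>. F (\<chi> i. \<omega> i) \<partial>Pi\<^sub>M UNIV (\<lambda>_. cscg))"
proof -
  have m[measurable]: "(\<lambda>\<omega>. \<chi> i. \<omega> i) \<in> Pi\<^sub>M (UNIV :: 'n set) (\<lambda>_. lborel) \<rightarrow>\<^sub>M (borel :: (complex ^ 'n) measure)"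
    using vec_measurable by (simp cong: measurable_cong_sets PiM_cong)
  have "(\<integral>\<^sup>+w. F w \<partial>cscg_noise) = (\<integral>\<^sup>+w. ennreal (\<Prod>i\<in>UNIV. cscg_density 1 (w $ i)) * F w \<partial>lborel)"
    by (rule nn_integral_cscg_noise_lborel) measurable
  also have "\<dots> = (\<integral>\<^sup>+\<omega>. ennreal (\<Prod>i\<in>UNIV. cscg_density 1 ((\<chi> i. \<omega> i) $ i)) * F (\<chi> i. \<omega> i) \<partial>Pi\<^sub>M UNIV (\<lambda>_. lborel))"
    by (subst lborel_vec_eq, subst nn_integral_distr) auto
  also have "\<dots> = (\<integral>\<^sup>+\<omega>. (\<Prod>i\<in>UNIV. ennreal (cscg_density 1 (\<omega> i))) * F (\<chi> i. \<omega> i) \<partial>Pi\<^sub>M UNIV (\<lambda>_. lborel))"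
    by (simp add: prod_ennreal cscg_density_nonneg)
  also have "\<dots> = (\<integral>\<^sup>+\<omega>. F (\<chi> i. \<omega> i) \<partial>Pi\<^sub>M UNIV (\<lambda>_. cscg))"
    unfolding PiM_cscg_eq by (subst nn_integral_density) auto
  finally show ?thesis .
qed

text \<open>The matched filter: the Hermitian inner product, conjugated in \<open>e\<close>. For
  unit \<open>e\<close> it sends the received vector \<open>x *s (a *\<^sub>R e) + w\<close> to
  \<open>a *\<^sub>R x + proj e w\<close>.\<close>

definition proj :: "complex ^ 'n \<Rightarrow> complex ^ 'n \<Rightarrow> complex" where
  "proj e y = (\<Sum>i\<in>UNIV. cnj (e $ i) * y $ i)"

lemma proj_measurable [measurable]: "proj e \<in> borel_measurable borel"
  unfolding proj_def by (intro borel_measurable_continuous_onI continuous_intros)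

lemma norm_vec_squared: "(norm (e :: complex ^ 'n))\<^sup>2 = (\<Sum>i\<in>UNIV. (norm (e $ i))\<^sup>2)"
  by (simp add: norm_vec_def L2_set_def sum_nonneg)

lemma nn_integral_cscg_noise_proj:
  fixes e :: "complex ^ 'n"
  assumes [measurable]: "F \<in> borel_measurable borel" and e: "norm e = 1"
  shows "(\<integral>\<^sup>+w. F (proj e w) \<partial>cscg_noise) = (\<integral>\<^sup>+w. F w \<partial>cscg)"
proof -
  have "(\<integral>\<^sup>+w. F (proj e w) \<partial>cscg_noise) = (\<integral>\<^sup>+\<omega>. F (\<Sum>i\<in>UNIV. cnj (e $ i) * \<omega> i) \<partial>Pi\<^sub>M UNIV (\<lambda>_. cscg))"
    using nn_integral_cscg_noise[of "\<lambda>w. F (proj e w)"] by (simp add: proj_def[of e "\<chi> i. f i" for f])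
  also have "\<dots> = (\<integral>\<^sup>+w. F (sqrt (\<Sum>i\<in>UNIV. (norm (cnj (e $ i)))\<^sup>2) *\<^sub>R w) \<partial>cscg)"
    by (rule nn_integral_PiM_cscg_sum) auto
  also have "(\<Sum>i\<in>UNIV. (norm (cnj (e $ i)))\<^sup>2) = 1" using norm_vec_squared[of e] e by simp
  finally show ?thesis by simp
qed

lemma prob_space_cscg_noise: "prob_space (cscg_noise :: (complex ^ 'n) measure)"
proof
  interpret PP: prob_space "Pi\<^sub>M (UNIV :: 'n set) (\<lambda>_. cscg)"
    by (intro prob_space_PiM prob_space_cscg)
  have "(\<integral>\<^sup>+w. 1 \<partial>(cscg_noise :: (complex ^ 'n) measure)) = 1"
    by (subst nn_integral_cscg_noise) (auto simp: PP.emeasure_space_1)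
  then show "emeasure (cscg_noise :: (complex ^ 'n) measure) (space cscg_noise) = 1" by simp
qed

text \<open>The coordinatewise likelihood ratios multiply to a function of \<open>proj e y\<close>
  alone, since their exponents are linear in y and the squared moduli of the coordinates of
  \<open>e\<close> sum to one. This is the factorisation that makes the projection
  sufficient.\<close>

lemma nn_integral_cscg_noise_shift:
  fixes e :: "complex ^ 'n"
  assumes [measurable]: "F \<in> borel_measurable borel" and e: "norm e = 1"
  shows "(\<integral>\<^sup>+w. F (x *s (a *\<^sub>R e) + w) \<partial>cscg_noise) = (\<integral>\<^sup>+y. ennreal (lik a x (proj e y)) * F y \<partial>cscg_noise)"
proof -
  let ?m = "x *s (a *\<^sub>R e)"
  let ?d = "\<lambda>w :: complex ^ 'n. \<Prod>i\<in>UNIV. cscg_density 1 (w $ i)"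
  have d: "?d (y - ?m) = ?d y * lik a x (proj e y)" for y
  proof -
    \<comment> \<open>Coordinate \<open>i\<close> is a scalar channel of gain \<open>a\<close> with
      input \<open>x * e $ i\<close>.\<close>
    have "?d (y - ?m) = (\<Prod>i\<in>UNIV. cscg_density 1 (y $ i) * lik a (x * e $ i) (y $ i))"
      by (simp add: cscg_density_lik[symmetric])
    also have "\<dots> = ?d y * (\<Prod>i\<in>UNIV. lik a (x * e $ i) (y $ i))" by (simp add: prod.distrib)
    also have "(\<Prod>i\<in>UNIV. lik a (x * e $ i) (y $ i)) = 
      exp (\<Sum>i\<in>UNIV. 2 * a * Re (cnj x * (cnj (e $ i) * y $ i)) - a\<^sup>2 * (norm x)\<^sup>2 * (norm (e $ i))\<^sup>2)"
      by (simp add: lik_def exp_sum norm_mult power_mult_distrib mult.assoc)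
    also have "(\<Sum>i\<in>UNIV. 2 * a * Re (cnj x * (cnj (e $ i) * y $ i)) - a\<^sup>2 * (norm x)\<^sup>2 * (norm (e $ i))\<^sup>2)
      = 2 * a * Re (cnj x * proj e y) - a\<^sup>2 * (norm x)\<^sup>2 * (\<Sum>i\<in>UNIV. (norm (e $ i))\<^sup>2)"
      by (simp only: sum_subtractf proj_def sum_distrib_left Re_sum)
    also have "(\<Sum>i\<in>UNIV. (norm (e $ i))\<^sup>2) = 1" using norm_vec_squared[of e] e by simp
    finally show ?thesis by (simp add: lik_def)
  qed
  have nn: "0 \<le> ?d y" for y by (intro prod_nonneg) (auto simp: cscg_density_nonneg)
  have [measurable]: "(\<lambda>w. ennreal (?d (w - ?m))) \<in> borel_measurable borel"
    by (rule measurable_compose[OF _ borel_measurable_noise_density]) measurable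
  have "(\<integral>\<^sup>+w. F (?m + w) \<partial>cscg_noise) = (\<integral>\<^sup>+w. ennreal (?d ((?m + w) - ?m)) * F (?m + w) \<partial>lborel)"
    by (subst nn_integral_cscg_noise_lborel) auto
  also have "\<dots> = (\<integral>\<^sup>+w. ennreal (?d (w - ?m)) * F w \<partial>lborel)"
    by (rule nn_integral_lborel_translate) measurable
  also have "\<dots> = (\<integral>\<^sup>+y. ennreal (lik a x (proj e y)) * F y \<partial>cscg_noise)"
    unfolding d by (subst nn_integral_cscg_noise_lborel) (auto simp: ennreal_mult nn ac_simps)
  finally show ?thesis .
qed

section \<open>The secrecy rate as a difference of scalar informations\<close>

lemma distributedI_nn_integral:
  assumes [measurable]: "X \<in> M \<rightarrow>\<^sub>M N" "f \<in> borel_measurable N"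
    and eq: "\<And>A. A \<in> sets N \<Longrightarrow> (\<integral>\<^sup>+x. indicator A (X x) \<partial>M) = (\<integral>\<^sup>+y. f y * indicator A y \<partial>N)"
  shows "distributed M N X f"
  unfolding distributed_def
proof (intro conjI measure_eqI)
  fix A assume "A \<in> sets (distr M N X)"
  then have A[measurable]: "A \<in> sets N" by simp
  have "emeasure (distr M N X) A = (\<integral>\<^sup>+y. indicator A y \<partial>distr M N X)"
    using A by simp
  also have "\<dots> = (\<integral>\<^sup>+x. indicator A (X x) \<partial>M)"
    by (subst nn_integral_distr) auto
  also have "\<dots> = emeasure (density N f) A"
    unfolding eq[OF A] using A by (simp add: emeasure_density)
  finally show "emeasure (distr M N X) A = emeasure (density N f) A" .
qed (use assms in auto)

lemma distr_proj_cscg_noise: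
  fixes e :: "complex ^ 'n"
  assumes e: "norm e = 1"
  shows "distr cscg_noise borel (proj e) = cscg"
proof (rule measure_eqI)
  fix A assume "A \<in> sets (distr cscg_noise borel (proj e))"
  then have A[measurable]: "A \<in> sets borel" by simp
  have "emeasure (distr cscg_noise borel (proj e)) A = (\<integral>\<^sup>+y. indicator A y \<partial>distr cscg_noise borel (proj e))"
    using A by simp
  also have "\<dots> = (\<integral>\<^sup>+w. indicator A (proj e w) \<partial>cscg_noise)"
    by (subst nn_integral_distr) auto
  also have "\<dots> = emeasure cscg A"
    using A by (subst nn_integral_cscg_noise_proj[OF _ e]) auto
  finally show "emeasure (distr cscg_noise borel (proj e)) A = emeasure cscg A" .
qed simp

context channel_input
begin

text \<open>\<open>cond_lik\<close> speaks of nonnegative integrals only; as an equality of measures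
  it also applies to the signed integral that defines mutual information.\<close>

lemma distr_rho_eq_density:
  assumes L: "cond_lik a L"
  shows "distr (rho a) (U \<Otimes>\<^sub>M borel) (\<lambda>(\<omega>, s). (fst \<omega>, s)) = density (pu \<Otimes>\<^sub>M cscg) (\<lambda>us. ennreal (L us))"
proof -
  note [measurable] = cond_lik_measurable[OF L]
  have s: "sets (pu \<Otimes>\<^sub>M cscg) = sets (U \<Otimes>\<^sub>M borel)" by (intro sets_pair_measure_cong) auto
  have "distributed (rho a) (pu \<Otimes>\<^sub>M cscg) (\<lambda>(\<omega>, s). (fst \<omega>, s)) (\<lambda>us. ennreal (L us))"
  proof (rule distributedI_nn_integral)
    fix A assume "A \<in> sets (pu \<Otimes>\<^sub>M cscg)"
    then have [measurable]: "A \<in> sets (U \<Otimes>\<^sub>M borel)" by (simp add: s)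
    show "(\<integral>\<^sup>+x. indicator A (case x of (\<omega>, s) \<Rightarrow> (fst \<omega>, s)) \<partial>rho a) = (\<integral>\<^sup>+us. ennreal (L us) * indicator A us \<partial>(pu \<Otimes>\<^sub>M cscg))"
      by (subst cond_lik_eq[OF L, symmetric], measurable, subst nn_integral_rho) auto
  qed measurable
  then have "distr (rho a) (pu \<Otimes>\<^sub>M cscg) (\<lambda>(\<omega>, s). (fst \<omega>, s)) = density (pu \<Otimes>\<^sub>M cscg) (\<lambda>us. ennreal (L us))"
    by (simp add: distributed_def)
  then show ?thesis using s by (simp cong: distr_cong)
qed

text \<open>For each \<open>B\<close>, the two sides agree as functions of the scalar \<open>s\<close> outside a null set, which
  pulls back to a null set under \<open>proj e\<close>: the projection is a sufficient statistic.\<close>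

lemma noise_cond_lik:
  fixes e :: "complex ^ 'n"
  assumes L: "cond_lik a L" and e: "norm e = 1" and F[measurable]: "F \<in> borel_measurable (U \<Otimes>\<^sub>M borel)"
  shows "(\<integral>\<^sup>+\<omega>. \<integral>\<^sup>+y. ennreal (lik a (snd \<omega>) (proj e y)) * F (fst \<omega>, y) \<partial>cscg_noise \<partial>p) =
    (\<integral>\<^sup>+us. ennreal (L (fst us, proj e (snd us))) * F us \<partial>(pu \<Otimes>\<^sub>M cscg_noise))"
proof -
  note [measurable] = cond_lik_measurable[OF L]
  interpret N: prob_space "cscg_noise :: (complex ^ 'n) measure" by (rule prob_space_cscg_noise)
  interpret pN: pair_prob_space p "cscg_noise :: (complex ^ 'n) measure" ..
  interpret puN: pair_prob_space pu "cscg_noise :: (complex ^ 'n) measure" ..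
  let ?noise = "cscg_noise :: (complex ^ 'n) measure"
  have s: "sets (pu \<Otimes>\<^sub>M ?noise) = sets (U \<Otimes>\<^sub>M borel)" by (intro sets_pair_measure_cong) auto
  let ?\<pi> = "\<lambda>(\<omega> :: 'u \<times> complex, y :: complex ^ 'n). (fst \<omega>, y)"
  let ?M0 = "density (p \<Otimes>\<^sub>M ?noise) (\<lambda>(\<omega>, y). ennreal (lik a (snd \<omega>) (proj e y)))"
  let ?M1 = "distr ?M0 (U \<Otimes>\<^sub>M borel) ?\<pi>"
  let ?M2 = "density (pu \<Otimes>\<^sub>M ?noise) (\<lambda>us. ennreal (L (fst us, proj e (snd us))))"
  have M1: "(\<integral>\<^sup>+x. G x \<partial>?M1) = (\<integral>\<^sup>+\<omega>. \<integral>\<^sup>+y. ennreal (lik a (snd \<omega>) (proj e y)) * G (fst \<omega>, y) \<partial>?noise \<partial>p)"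
    if [measurable]: "G \<in> borel_measurable (U \<Otimes>\<^sub>M borel)" for G
  proof -
    have "(\<integral>\<^sup>+x. G x \<partial>?M1) = (\<integral>\<^sup>+x. ennreal (lik a (snd (fst x)) (proj e (snd x))) * G (fst (fst x), snd x) \<partial>(p \<Otimes>\<^sub>M ?noise))"
      by (subst nn_integral_distr, measurable, subst nn_integral_density) (auto simp: case_prod_beta)
    then show ?thesis by (subst (asm) N.nn_integral_fst[symmetric]) auto
  qed
  have M2: "(\<integral>\<^sup>+x. G x \<partial>?M2) = (\<integral>\<^sup>+us. ennreal (L (fst us, proj e (snd us))) * G us \<partial>(pu \<Otimes>\<^sub>M ?noise))"
    if [measurable]: "G \<in> borel_measurable (U \<Otimes>\<^sub>M borel)" for G
    by (subst nn_integral_density) auto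
  have rect: "(\<integral>\<^sup>+x. indicator (B \<times> D) x \<partial>?M1) = (\<integral>\<^sup>+x. indicator (B \<times> D) x \<partial>?M2)"
    if B[measurable]: "B \<in> sets U" and D[measurable]: "D \<in> sets borel" for B D
  proof -
    define k where "k s = (\<integral>\<^sup>+\<omega>. ennreal (lik a (snd \<omega>) s) * indicator B (fst \<omega>) \<partial>p)" for s
    define l where "l s = (\<integral>\<^sup>+u. ennreal (L (u, s)) * indicator B u \<partial>pu)" for s
    have [measurable]: "k \<in> borel_measurable borel" "l \<in> borel_measurable borel"
      unfolding k_def l_def by measurable
    have "AE s in cscg. k s = l s"
    \<comment> \<open>Testing \<open>cond_lik\<close> on the rectangle of \<open>B\<close> and
      \<open>A\<close> shows that \<open>k\<close> and \<open>l\<close> have the same integral over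
      every Borel set \<open>A\<close>.\<close>
    proof (rule cscg.density_unique_finite_measure)
      fix A assume "A \<in> sets cscg"
      then have [measurable]: "A \<in> sets borel" by simp
      have "(\<integral>\<^sup>+s. k s * indicator A s \<partial>cscg) = (\<integral>\<^sup>+s. \<integral>\<^sup>+\<omega>. ennreal (lik a (snd \<omega>) s) * indicator (B \<times> A) (fst \<omega>, s) \<partial>p \<partial>cscg)"
        unfolding k_def by (subst nn_integral_multc[symmetric]) (auto simp: indicator_times mult.assoc)
      also have "\<dots> = (\<integral>\<^sup>+\<omega>. \<integral>\<^sup>+s. ennreal (lik a (snd \<omega>) s) * indicator (B \<times> A) (fst \<omega>, s) \<partial>cscg \<partial>p)"
        by (rule pxs.Fubini') measurable
      also have "\<dots> = (\<integral>\<^sup>+us. ennreal (L us) * indicator (B \<times> A) us \<partial>(pu \<Otimes>\<^sub>M cscg))"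
        by (rule cond_lik_eq[OF L]) measurable
      also have "\<dots> = (\<integral>\<^sup>+s. \<integral>\<^sup>+u. ennreal (L (u, s)) * indicator (B \<times> A) (u, s) \<partial>pu \<partial>cscg)"
        by (subst pus.nn_integral_snd[symmetric]) auto
      also have "\<dots> = (\<integral>\<^sup>+s. l s * indicator A s \<partial>cscg)"
        unfolding l_def by (subst nn_integral_multc[symmetric]) (auto simp: indicator_times mult.assoc)
      finally show "(\<integral>\<^sup>+s. k s * indicator A s \<partial>cscg) = (\<integral>\<^sup>+s. l s * indicator A s \<partial>cscg)" .
    qed auto
    then have kl: "AE y in ?noise. k (proj e y) = l (proj e y)"
      unfolding distr_proj_cscg_noise[OF e, symmetric] by (rule AE_distrD[rotated]) measurable
    have "(\<integral>\<^sup>+x. indicator (B \<times> D) x \<partial>?M1) = (\<integral>\<^sup>+\<omega>. \<integral>\<^sup>+y. ennreal (lik a (snd \<omega>) (proj e y)) * indicator (B \<times> D) (fst \<omega>, y) \<partial>?noise \<partial>p)"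
      by (rule M1) measurable
    also have "\<dots> = (\<integral>\<^sup>+y. \<integral>\<^sup>+\<omega>. ennreal (lik a (snd \<omega>) (proj e y)) * indicator (B \<times> D) (fst \<omega>, y) \<partial>p \<partial>?noise)"
      by (rule pN.Fubini'[symmetric]) measurable
    also have "\<dots> = (\<integral>\<^sup>+y. k (proj e y) * indicator D y \<partial>?noise)"
      unfolding k_def by (subst nn_integral_multc[symmetric]) (auto simp: indicator_times mult.assoc)
    also have "\<dots> = (\<integral>\<^sup>+y. l (proj e y) * indicator D y \<partial>?noise)"
      using kl by (intro nn_integral_cong_AE) auto
    also have "\<dots> = (\<integral>\<^sup>+y. \<integral>\<^sup>+u. ennreal (L (u, proj e y)) * indicator (B \<times> D) (u, y) \<partial>pu \<partial>?noise)"
      unfolding l_def by (subst nn_integral_multc[symmetric]) (auto simp: indicator_times mult.assoc)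
    also have "\<dots> = (\<integral>\<^sup>+us. ennreal (L (fst us, proj e (snd us))) * indicator (B \<times> D) us \<partial>(pu \<Otimes>\<^sub>M ?noise))"
      by (subst puN.nn_integral_snd[symmetric]) auto
    also have "\<dots> = (\<integral>\<^sup>+x. indicator (B \<times> D) x \<partial>?M2)"
      by (rule M2[symmetric]) measurable
    finally show ?thesis .
  qed
  \<comment> \<open>The rectangles form a generator stable under intersection. Total mass one allows
    the whole space itself, as a constant sequence, to serve as the exhaustion.\<close>
  have "?M1 = ?M2"
  proof (rule measure_eqI_generator_eq[OF Int_stable_pair_measure_generator[of U "borel :: (complex ^ 'n) measure"]])
    show "{B \<times> D |B D. B \<in> sets U \<and> D \<in> sets (borel :: (complex ^ 'n) measure)} \<subseteq> Pow (space U \<times> UNIV)"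
      using sets.sets_into_space by fastforce
    show "sets ?M1 = sigma_sets (space U \<times> UNIV) {B \<times> D |B D. B \<in> sets U \<and> D \<in> sets (borel :: (complex ^ 'n) measure)}"
      by (simp add: sets_pair_measure)
    show "sets ?M2 = sigma_sets (space U \<times> UNIV) {B \<times> D |B D. B \<in> sets U \<and> D \<in> sets (borel :: (complex ^ 'n) measure)}"
      by (simp add: s) (simp add: sets_pair_measure)
    fix X assume "X \<in> {B \<times> D |B D. B \<in> sets U \<and> D \<in> sets (borel :: (complex ^ 'n) measure)}"
    then obtain B D where X: "X = B \<times> D" and BD: "B \<in> sets U" "D \<in> sets (borel :: (complex ^ 'n) measure)" by auto
    show "emeasure ?M1 X = emeasure ?M2 X"
      using rect[OF BD] BD s unfolding X by simp
  next
    let ?A = "\<lambda>i::nat. space U \<times> (UNIV :: (complex ^ 'n) set)"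
    show "range ?A \<subseteq> {B \<times> D |B D. B \<in> sets U \<and> D \<in> sets (borel :: (complex ^ 'n) measure)}"
      by (intro image_subsetI CollectI exI conjI) (rule refl, auto)
    show "(\<Union>i. ?A i) = space U \<times> UNIV" by simp
    fix i
    have "?A i \<in> sets ?M1" by (auto intro!: pair_measureI)
    then have "emeasure ?M1 (?A i) = (\<integral>\<^sup>+x. indicator (?A i) x \<partial>?M1)"
      by (rule nn_integral_indicator[symmetric])
    also have "\<dots> \<le> (\<integral>\<^sup>+x. 1 \<partial>?M1)" by (intro nn_integral_mono) (auto simp: indicator_def)
    also have "\<dots> = (\<integral>\<^sup>+\<omega>. \<integral>\<^sup>+y. ennreal (lik a (snd \<omega>) (proj e y)) \<partial>?noise \<partial>p)"
      by (subst M1) auto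
    also have "\<dots> = 1"
      by (simp add: nn_integral_cscg_noise_proj[OF _ e, of "\<lambda>s. ennreal (lik a x s)" for x] nn_integral_lik p.emeasure_space_1)
    finally show "emeasure ?M1 (?A i) \<noteq> \<infinity>" by (auto simp: top_unique)
  qed
  then show ?thesis using M1[OF F] M2[OF F] by simp
qed

text \<open>The pair \<open>X\<close>, \<open>W\<close> stands for the input and the noise of either
  receiver on the common space; \<open>law\<close> says that they have the product law. Relative to
  \<open>pu\<close> and the noise law, the density of u is 1 and those of the output and of the pair
  depend on the output only through \<open>proj e\<close>, which reduces everything to the scalar
  channel.\<close>

lemma mutual_information_channel:
  fixes e :: "complex ^ 'n" and T :: "'t measure"
  assumes T: "prob_space T" and X[measurable]: "X \<in> T \<rightarrow>\<^sub>M p" and W[measurable]: "W \<in> T \<rightarrow>\<^sub>M borel"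
    and law: "\<And>F. F \<in> borel_measurable (p \<Otimes>\<^sub>M borel) \<Longrightarrow>
       (\<integral>\<^sup>+t. F (X t, W t) \<partial>T) = (\<integral>\<^sup>+\<omega>. \<integral>\<^sup>+w. F (\<omega>, w) \<partial>cscg_noise \<partial>p)"
    and e: "norm e = 1" and L: "cond_lik a L"
  shows "prob_space.mutual_information T 2 U borel (\<lambda>t. fst (X t)) (\<lambda>t. snd (X t) *s (a *\<^sub>R e) + W t) =
    integral\<^sup>L (rho a) (info_lr L a) / ln 2"
proof -
  note Lm[measurable] = cond_lik_measurable[OF L]
  let ?noise = "cscg_noise :: (complex ^ 'n) measure"
  interpret T: information_space T 2 using T by (simp add: information_space_def information_space_axioms_def)
  interpret N: prob_space ?noise by (rule prob_space_cscg_noise)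
  interpret pN: pair_prob_space p ?noise ..
  interpret puN: pair_prob_space pu ?noise ..
  let ?u = "\<lambda>t. fst (X t)" and ?y = "\<lambda>t. snd (X t) *s (a *\<^sub>R e) + W t"
  have s: "sets (pu \<Otimes>\<^sub>M ?noise) = sets (U \<Otimes>\<^sub>M borel)" by (intro sets_pair_measure_cong) auto
  have vm[measurable]: "(\<lambda>xw. fst xw *s (a *\<^sub>R e) + snd xw) \<in> borel \<Otimes>\<^sub>M borel \<rightarrow>\<^sub>M borel"
    unfolding borel_prod
    by (intro borel_measurable_continuous_onI) (auto intro!: continuous_intros simp: vector_scalar_mult_def)
  have ym[measurable]: "?y \<in> T \<rightarrow>\<^sub>M borel"
    using measurable_compose[OF _ vm, of "\<lambda>t. (snd (X t), W t)" T] by simp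
  have law_uy: "(\<integral>\<^sup>+t. F (?u t, ?y t) \<partial>T) = (\<integral>\<^sup>+\<omega>. \<integral>\<^sup>+y. ennreal (lik a (snd \<omega>) (proj e y)) * F (fst \<omega>, y) \<partial>?noise \<partial>p)"
    if [measurable]: "F \<in> borel_measurable (U \<Otimes>\<^sub>M borel)" for F
  proof -
    have m: "(\<lambda>(\<omega>, w). F (fst \<omega>, snd \<omega> *s (a *\<^sub>R e) + w)) \<in> borel_measurable (p \<Otimes>\<^sub>M borel)"
    proof -
      have "(\<lambda>x. (fst (fst x), fst (snd (fst x), snd x) *s (a *\<^sub>R e) + snd (snd (fst x), snd x))) \<in> p \<Otimes>\<^sub>M borel \<rightarrow>\<^sub>M U \<Otimes>\<^sub>M borel"
        by (intro measurable_Pair measurable_compose[OF _ vm]) measurable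
      then have "(\<lambda>x. F (fst (fst x), fst (snd (fst x), snd x) *s (a *\<^sub>R e) + snd (snd (fst x), snd x))) \<in> borel_measurable (p \<Otimes>\<^sub>M borel)"
        by (rule measurable_compose) measurable
      then show ?thesis by (simp add: case_prod_beta')
    qed
    have "(\<integral>\<^sup>+t. F (?u t, ?y t) \<partial>T) = (\<integral>\<^sup>+\<omega>. \<integral>\<^sup>+w. F (fst \<omega>, snd \<omega> *s (a *\<^sub>R e) + w) \<partial>?noise \<partial>p)"
      using law[OF m] by simp
    also have "\<dots> = (\<integral>\<^sup>+\<omega>. \<integral>\<^sup>+y. ennreal (lik a (snd \<omega>) (proj e y)) * F (fst \<omega>, y) \<partial>?noise \<partial>p)"
    proof (rule nn_integral_cong)
      fix \<omega> assume [measurable]: "\<omega> \<in> space p"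
      then have [measurable]: "fst \<omega> \<in> space U" by (rule measurable_space[OF measurable_fst_p])
      show "(\<integral>\<^sup>+w. F (fst \<omega>, snd \<omega> *s (a *\<^sub>R e) + w) \<partial>?noise) = (\<integral>\<^sup>+y. ennreal (lik a (snd \<omega>) (proj e y)) * F (fst \<omega>, y) \<partial>?noise)"
        by (rule nn_integral_cscg_noise_shift[OF _ e]) measurable
    qed
    finally show ?thesis .
  qed
  have um[measurable]: "?u \<in> T \<rightarrow>\<^sub>M U" by measurable
  have Pxy: "distributed T (pu \<Otimes>\<^sub>M ?noise) (\<lambda>t. (?u t, ?y t)) (\<lambda>us. ennreal (L (fst us, proj e (snd us))))"
  proof (rule distributedI_nn_integral)
    show "(\<lambda>t. (?u t, ?y t)) \<in> T \<rightarrow>\<^sub>M pu \<Otimes>\<^sub>M ?noise"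
      using um ym by (simp add: measurable_cong_sets[OF refl s])
    fix A assume "A \<in> sets (pu \<Otimes>\<^sub>M ?noise)"
    then have [measurable]: "A \<in> sets (U \<Otimes>\<^sub>M borel)" by (simp add: s)
    show "(\<integral>\<^sup>+t. indicator A (?u t, ?y t) \<partial>T) = (\<integral>\<^sup>+us. ennreal (L (fst us, proj e (snd us))) * indicator A us \<partial>(pu \<Otimes>\<^sub>M ?noise))"
      by (subst law_uy, measurable, rule noise_cond_lik[OF L e]) measurable
  qed measurable
  have Px: "distributed T pu ?u (\<lambda>_. ennreal 1)"
  proof (rule distributedI_nn_integral)
    fix A assume "A \<in> sets pu" then have A[measurable]: "A \<in> sets U" by simp
    have "(\<integral>\<^sup>+t. indicator A (?u t) \<partial>T) = (\<integral>\<^sup>+\<omega>. \<integral>\<^sup>+w. indicator A (fst \<omega>) \<partial>?noise \<partial>p)"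
    proof -
      have "(\<lambda>(\<omega>, w). indicator A (fst \<omega>)) \<in> borel_measurable (p \<Otimes>\<^sub>M borel)" by measurable
      from law[OF this] show ?thesis by simp
    qed
    also have "\<dots> = (\<integral>\<^sup>+\<omega>. indicator A (fst \<omega>) \<partial>p)"
      by (simp add: N.emeasure_space_1[simplified])
    also have "\<dots> = (\<integral>\<^sup>+u. indicator A u \<partial>pu)"
      unfolding pu_def by (subst nn_integral_distr) auto
    finally show "(\<integral>\<^sup>+t. indicator A (?u t) \<partial>T) = (\<integral>\<^sup>+u. ennreal 1 * indicator A u \<partial>pu)" by simp
  qed (use um in \<open>simp_all add: measurable_cong_sets[OF refl sets_pu]\<close>)
  have Py: "distributed T ?noise ?y (\<lambda>y. ennreal (avg_lik a (proj e y)))"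
  proof (rule distributedI_nn_integral)
    fix A assume "A \<in> sets ?noise" then have A[measurable]: "A \<in> sets borel" by simp
    have "(\<integral>\<^sup>+t. indicator A (?y t) \<partial>T) = (\<integral>\<^sup>+\<omega>. \<integral>\<^sup>+y. ennreal (lik a (snd \<omega>) (proj e y)) * indicator A y \<partial>?noise \<partial>p)"
    proof -
      have "(\<lambda>(u, y). indicator A y) \<in> borel_measurable (U \<Otimes>\<^sub>M borel)" by measurable
      from law_uy[OF this] show ?thesis by simp
    qed
    also have "\<dots> = (\<integral>\<^sup>+y. \<integral>\<^sup>+\<omega>. ennreal (lik a (snd \<omega>) (proj e y)) * indicator A y \<partial>p \<partial>?noise)"
      by (rule pN.Fubini'[symmetric]) measurable
    also have "\<dots> = (\<integral>\<^sup>+y. ennreal (avg_lik a (proj e y)) * indicator A y \<partial>?noise)"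
      by (simp add: nn_integral_multc avg_lik_eq)
    finally show "(\<integral>\<^sup>+t. indicator A (?y t) \<partial>T) = (\<integral>\<^sup>+y. ennreal (avg_lik a (proj e y)) * indicator A y \<partial>?noise)" .
  qed (use ym in simp_all)
  \<comment> \<open>Mutual information uses its measure arguments only as measurable spaces, so they
    may be exchanged for the reference measures of the densities.\<close>
  have cong: "T.mutual_information 2 U borel ?u ?y = T.mutual_information 2 pu ?noise ?u ?y"
  proof -
    have "distr T U ?u = distr T pu ?u" by (rule distr_cong) auto
    moreover have "distr T borel ?y = distr T ?noise ?y" by (rule distr_cong) auto
    moreover have "distr T (U \<Otimes>\<^sub>M borel) (\<lambda>x. (?u x, ?y x)) = distr T (pu \<Otimes>\<^sub>M ?noise) (\<lambda>x. (?u x, ?y x))"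
      by (rule distr_cong) (auto simp: s)
    ultimately show ?thesis unfolding T.mutual_information_def by simp
  qed
  let ?g = "\<lambda>us. ln (L us / avg_lik a (snd us)) / ln 2"
  have gm[measurable]: "?g \<in> borel_measurable (U \<Otimes>\<^sub>M borel)" by measurable
  have "T.mutual_information 2 U borel ?u ?y = (\<integral>us. L (fst us, proj e (snd us)) * log 2 (L (fst us, proj e (snd us)) / (1 * avg_lik a (proj e (snd us)))) \<partial>(pu \<Otimes>\<^sub>M ?noise))"
    unfolding cong
    by (rule T.mutual_information_distr[OF pu.sigma_finite_measure_axioms N.sigma_finite_measure_axioms Px _ Py _ Pxy])
      (auto simp: cond_lik_nonneg[OF L] less_imp_le[OF avg_lik_pos])
  also have "\<dots> = (\<integral>us. L (fst us, proj e (snd us)) * ?g (fst us, proj e (snd us)) \<partial>(pu \<Otimes>\<^sub>M ?noise))"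
    by (simp add: log_def)
  also have "\<dots> = (\<integral>us. L us * ?g us \<partial>distr (pu \<Otimes>\<^sub>M ?noise) (U \<Otimes>\<^sub>M borel) (\<lambda>(u, y). (u, proj e y)))"
    by (subst integral_distr) (auto simp: case_prod_beta')
  \<comment> \<open>The projected noise is standard Gaussian, so the vector integral becomes one
    over the scalar output.\<close>
  also have "distr (pu \<Otimes>\<^sub>M ?noise) (U \<Otimes>\<^sub>M borel) (\<lambda>(u, y). (u, proj e y)) = pu \<Otimes>\<^sub>M cscg"
  proof -
    have d: "distr pu U (\<lambda>u. u) = pu" by (rule distr_id2) simp
    have "distr pu U (\<lambda>u. u) \<Otimes>\<^sub>M distr ?noise borel (proj e) = distr (pu \<Otimes>\<^sub>M ?noise) (U \<Otimes>\<^sub>M borel) (\<lambda>(u, y). (u, proj e y))"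
      by (rule pair_measure_distr) (auto simp: distr_proj_cscg_noise[OF e] intro!: cscg.sigma_finite_measure_axioms)
    then show ?thesis by (simp add: d distr_proj_cscg_noise[OF e])
  qed
  also have "(\<integral>us. L us * ?g us \<partial>(pu \<Otimes>\<^sub>M cscg)) = (\<integral>us. ?g us \<partial>density (pu \<Otimes>\<^sub>M cscg) (\<lambda>us. ennreal (L us)))"
    by (subst integral_density) (auto simp: cond_lik_nonneg[OF L])
  also have "\<dots> = (\<integral>x. ?g (case x of (\<omega>, s) \<Rightarrow> (fst \<omega>, s)) \<partial>rho a)"
    unfolding distr_rho_eq_density[OF L, symmetric] by (rule integral_distr) measurable
  also have "\<dots> = integral\<^sup>L (rho a) (info_lr L a) / ln 2"
    by (subst integral_divide_zero[symmetric]) (auto simp: info_lr_def case_prod_beta intro!: Bochner_Integration.integral_cong)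
  finally show ?thesis .
qed

end

lemma unit_direction: "\<exists>e. norm e = 1 \<and> h = norm h *\<^sub>R e" for h :: "complex ^ 'n"
proof (cases "h = 0")
  case True
  have "axis undefined 1 \<in> (Basis :: (complex ^ 'n) set)" by (auto simp: Basis_vec_def)
  then show ?thesis using True by (intro exI[of _ "axis undefined 1"]) (simp add: norm_Basis)
next
  case False
  then show ?thesis by (intro exI[of _ "sgn h"]) (simp add: norm_sgn sgn_div_norm)
qed

section \<open>Secrecy rate as a function of the two channel norms\<close>

context channel_input
begin

text \<open>Each information is an instance of \<open>mutual_information_channel\<close> with the
  noise of the other receiver integrated out; the direction of the channel vector enters only
  through the unit vector of the projection.\<close>

lemma secrecy_rate_eq:
  fixes h :: "complex ^ 'b" and g :: "complex ^ 'e"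
  assumes L: "\<And>a. cond_lik a (L a)"
  defines "J \<equiv> \<lambda>a. integral\<^sup>L (rho a) (info_lr (L a) a) / ln 2"
  shows "secrecy_rate U p h g = J (norm h) - J (norm g)"
proof -
  let ?nB = "cscg_noise :: (complex ^ 'b) measure" and ?nE = "cscg_noise :: (complex ^ 'e) measure"
  let ?T = "p \<Otimes>\<^sub>M (?nB \<Otimes>\<^sub>M ?nE)"
  interpret B: prob_space ?nB by (rule prob_space_cscg_noise)
  interpret E: prob_space ?nE by (rule prob_space_cscg_noise)
  interpret BE: pair_prob_space ?nB ?nE ..
  interpret T: pair_prob_space p "?nB \<Otimes>\<^sub>M ?nE" ..
  obtain eh where eh: "norm eh = 1" "h = norm h *\<^sub>R eh" using unit_direction by blast
  obtain eg where eg: "norm eg = 1" "g = norm g *\<^sub>R eg" using unit_direction by blast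
  have 1: "prob_space.mutual_information ?T 2 U borel (\<lambda>t. fst (fst t)) (\<lambda>t. snd (fst t) *s (norm h *\<^sub>R eh) + fst (snd t)) = J (norm h)"
    unfolding J_def
  proof (rule mutual_information_channel[OF _ _ _ _ eh(1) L])
    show "prob_space ?T" by unfold_locales
    fix F :: "('u \<times> complex) \<times> (complex ^ 'b) \<Rightarrow> ennreal" assume [measurable]: "F \<in> borel_measurable (p \<Otimes>\<^sub>M borel)"
    have "(\<integral>\<^sup>+t. F (fst t, fst (snd t)) \<partial>?T) = (\<integral>\<^sup>+\<omega>. \<integral>\<^sup>+w. F (\<omega>, fst w) \<partial>(?nB \<Otimes>\<^sub>M ?nE) \<partial>p)"
      by (subst BE.P.nn_integral_fst[symmetric]) auto
    also have "\<dots> = (\<integral>\<^sup>+\<omega>. \<integral>\<^sup>+w. F (\<omega>, w) \<partial>?nB \<partial>p)"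
      by (intro nn_integral_cong, subst E.nn_integral_fst[symmetric]) (auto simp: E.emeasure_space_1[simplified])
    finally show "(\<integral>\<^sup>+t. F (fst t, fst (snd t)) \<partial>?T) = (\<integral>\<^sup>+\<omega>. \<integral>\<^sup>+w. F (\<omega>, w) \<partial>?nB \<partial>p)" .
  qed measurable
  have 2: "prob_space.mutual_information ?T 2 U borel (\<lambda>t. fst (fst t)) (\<lambda>t. snd (fst t) *s (norm g *\<^sub>R eg) + snd (snd t)) = J (norm g)"
    unfolding J_def
  proof (rule mutual_information_channel[OF _ _ _ _ eg(1) L])
    show "prob_space ?T" by unfold_locales
    fix F :: "('u \<times> complex) \<times> (complex ^ 'e) \<Rightarrow> ennreal" assume [measurable]: "F \<in> borel_measurable (p \<Otimes>\<^sub>M borel)"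
    have "(\<integral>\<^sup>+t. F (fst t, snd (snd t)) \<partial>?T) = (\<integral>\<^sup>+\<omega>. \<integral>\<^sup>+w. F (\<omega>, snd w) \<partial>(?nB \<Otimes>\<^sub>M ?nE) \<partial>p)"
      by (subst BE.P.nn_integral_fst[symmetric]) auto
    also have "\<dots> = (\<integral>\<^sup>+\<omega>. \<integral>\<^sup>+w. F (\<omega>, w) \<partial>?nE \<partial>p)"
      by (intro nn_integral_cong, subst E.nn_integral_fst[symmetric]) (auto simp: B.emeasure_space_1[simplified])
    finally show "(\<integral>\<^sup>+t. F (fst t, snd (snd t)) \<partial>?T) = (\<integral>\<^sup>+\<omega>. \<integral>\<^sup>+w. F (\<omega>, w) \<partial>?nE \<partial>p)" .
  qed measurable
  show ?thesis
    using 1 2 unfolding eh(2)[symmetric] eg(2)[symmetric]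
    by (simp add: secrecy_rate_def transmission_def Let_def case_prod_beta')
qed

text \<open>All that the converse needs to know about an input. A version of the conditional
  likelihood is chosen once for each gain; for b < a the degradation parameter is b / a.\<close>

lemma secrecy_rate_information_function:
  "\<exists>J. (\<forall>(h :: complex ^ 'b) (g :: complex ^ 'e). secrecy_rate U p h g = J (norm h) - J (norm g)) \<and>
     (\<forall>b a. 0 \<le> b \<longrightarrow> b \<le> a \<longrightarrow> J b \<le> J a \<and> J a - J b \<le> log 2 (1 + P * a\<^sup>2) - log 2 (1 + P * b\<^sup>2))"
proof -
  have "\<exists>L. \<forall>a. cond_lik a (L a)" using cond_lik_exists by (intro choice) blast
  then obtain L where L: "\<And>a. cond_lik a (L a)" by blast
  define J where "J a = integral\<^sup>L (rho a) (info_lr (L a) a) / ln 2" for a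
  have "J b \<le> J a \<and> J a - J b \<le> log 2 (1 + P * a\<^sup>2) - log 2 (1 + P * b\<^sup>2)" if "0 \<le> b" "b \<le> a" for a b
  proof (cases "b = a")
    case False
    then have c: "\<bar>b / a\<bar> < 1" and ab: "a * (b / a) = b" using that by auto
    note 1 = info_degraded_le[OF c L L[of "a * (b / a)"], unfolded ab]
    note 2 = info_diff_le[OF c L L[of "a * (b / a)"], unfolded ab]
    have "J a - J b \<le> (ln (1 + P * a\<^sup>2) - ln (1 + P * b\<^sup>2)) / ln 2"
      unfolding J_def diff_divide_distrib[symmetric] using 2 by (intro divide_right_mono) auto
    moreover have "J b \<le> J a"
      unfolding J_def using 1 by (intro divide_right_mono) auto
    ultimately show ?thesis by (simp add: log_def diff_divide_distrib)
  qed simp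
  moreover have "secrecy_rate U p h g = J (norm h) - J (norm g)" for h :: "complex ^ 'b" and g :: "complex ^ 'e"
    unfolding J_def by (rule secrecy_rate_eq[OF L])
  ultimately show ?thesis by blast
qed

end

text \<open>With u = x Gaussian of power P, the conditional likelihood is \<open>lik\<close> and the
  averaged one is \<open>mixlik\<close>, so \<open>info_lr\<close> coincides with
  \<open>gauss_lr\<close> almost surely.\<close>

lemma gaussian_input_secrecy_rate:
  assumes P: "P > 0"
  shows "\<exists>p. admissible_input (borel :: complex measure) P p \<and>
    (\<forall>(h :: complex ^ 'b) (g :: complex ^ 'e). secrecy_rate borel p h g = log 2 (1 + P * (norm h)\<^sup>2) - log 2 (1 + P * (norm g)\<^sup>2))"
proof -
  define p :: "(complex \<times> complex) measure" where
    "p = distr cscg (borel \<Otimes>\<^sub>M borel) (\<lambda>w. (sqrt P *\<^sub>R w, sqrt P *\<^sub>R w))"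
  have nn_p: "(\<integral>\<^sup>+\<omega>. F \<omega> \<partial>p) = (\<integral>\<^sup>+w. F (sqrt P *\<^sub>R w, sqrt P *\<^sub>R w) \<partial>cscg)"
    if [measurable]: "F \<in> borel_measurable (borel \<Otimes>\<^sub>M borel)" for F
    unfolding p_def by (rule nn_integral_distr) auto
  have pw: "(\<integral>\<^sup>+\<omega>. ennreal ((norm (snd \<omega>))\<^sup>2) \<partial>p) = ennreal P"
    using P by (subst nn_p) (auto simp: power_mult_distrib ennreal_mult nn_integral_cmult nn_integral_cscg_norm_squared)
  have adm: "admissible_input (borel :: complex measure) P p"
    unfolding admissible_input_def pw by (auto simp: p_def intro!: cscg.prob_space_distr)
  interpret channel_input borel p P by unfold_locales (use adm P in auto)
  have mean: "mean_power = P"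
    using pw unfolding nn_integral_mean_power using P mean_power_nonneg by simp
  have avg: "avg_lik a s = mixlik P a s" for a s
  proof -
    have "ennreal (avg_lik a s) = (\<integral>\<^sup>+w. ennreal (lik a (sqrt P *\<^sub>R w) s) \<partial>cscg)"
      unfolding avg_lik_eq[symmetric] by (subst nn_p) auto
    then show ?thesis using P mixlik_pos[of P a s] avg_lik_pos[of a s] by (simp add: mixlik_eq)
  qed
  let ?L = "\<lambda>a (u, s). lik a u s"
  have L: "cond_lik a (?L a)" for a
    unfolding cond_lik_def
  proof (intro conjI ballI allI)
    show "?L a \<in> borel_measurable (pu \<Otimes>\<^sub>M cscg)" by measurable
    fix \<psi> :: "complex \<times> complex \<Rightarrow> ennreal" assume [measurable]: "\<psi> \<in> borel_measurable (borel \<Otimes>\<^sub>M borel)"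
    have "(\<integral>\<^sup>+\<omega>. \<integral>\<^sup>+s. ennreal (lik a (snd \<omega>) s) * \<psi> (fst \<omega>, s) \<partial>cscg \<partial>p) =
      (\<integral>\<^sup>+w. \<integral>\<^sup>+s. ennreal (lik a (sqrt P *\<^sub>R w) s) * \<psi> (sqrt P *\<^sub>R w, s) \<partial>cscg \<partial>cscg)"
      by (subst nn_p) auto
    also have "\<dots> = (\<integral>\<^sup>+\<omega>. \<integral>\<^sup>+s. ennreal (lik a (fst \<omega>) s) * \<psi> (fst \<omega>, s) \<partial>cscg \<partial>p)"
      by (subst nn_p) auto
    also have "\<dots> = (\<integral>\<^sup>+u. \<integral>\<^sup>+s. ennreal (lik a u s) * \<psi> (u, s) \<partial>cscg \<partial>pu)"
      unfolding pu_def by (subst nn_integral_distr) auto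
    also have "\<dots> = (\<integral>\<^sup>+us. ennreal (?L a us) * \<psi> us \<partial>(pu \<Otimes>\<^sub>M cscg))"
      by (subst cscg.nn_integral_fst[symmetric]) (auto simp: case_prod_beta')
    finally show "(\<integral>\<^sup>+\<omega>. \<integral>\<^sup>+s. ennreal (lik a (snd \<omega>) s) * \<psi> (fst \<omega>, s) \<partial>cscg \<partial>p) = (\<integral>\<^sup>+us. ennreal (?L a us) * \<psi> us \<partial>(pu \<Otimes>\<^sub>M cscg))" .
  qed auto
  have J: "integral\<^sup>L (rho a) (info_lr (?L a) a) / ln 2 = log 2 (1 + P * a\<^sup>2)" for a
  proof -
    have "AE \<omega> in p. fst \<omega> = snd \<omega>"
      unfolding p_def by (subst AE_distr_iff) auto
    then have "AE \<omega> in distr (p \<Otimes>\<^sub>M cscg) p fst. fst \<omega> = snd \<omega>"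
      by (subst cscg.distr_pair_fst)
    then have "AE x in p \<Otimes>\<^sub>M cscg. fst (fst x) = snd (fst x)"
      by (rule AE_distrD[rotated]) measurable
    then have "AE x in rho a. fst (fst x) = snd (fst x)"
      unfolding rho_def by (subst AE_density) auto
    then have "AE x in rho a. info_lr (?L a) a x = gauss_lr a x"
      by eventually_elim (auto simp: info_lr_def gauss_lr_def avg)
    moreover have "gauss_lr a \<in> borel_measurable (rho a)"
      using gauss_lr(1) by (rule borel_measurable_integrable)
    moreover have "info_lr (?L a) a \<in> borel_measurable (rho a)"
      using borel_measurable_info_lr[OF L] by simp
    ultimately have "integral\<^sup>L (rho a) (info_lr (?L a) a) = integral\<^sup>L (rho a) (gauss_lr a)"
      by (intro integral_cong_AE)
    \<comment> \<open>At full power the quotient in \<open>gauss_lr\<close> is one and cancels the -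
      1.\<close>
    also have "\<dots> = ln (1 + P * a\<^sup>2)"
      using P by (simp add: gauss_lr(2) mean mult.commute add_nonneg_eq_0_iff)
    finally show ?thesis by (simp add: log_def)
  qed
  show ?thesis using adm secrecy_rate_eq[of ?L, OF L] unfolding J by blast
qed

section \<open>Outage and ergodic rate for a Gaussian eavesdropper channel\<close>

lemma lower_inc_gamma_eq_erlang_CDF:
  assumes t: "0 \<le> t"
  shows "lower_inc_gamma (real (Suc k)) t = fact k * erlang_CDF k 1 t"
proof -
  have "(\<integral>\<^sup>+x. ennreal (erlang_density k 1 x * indicator {..t} x) \<partial>lborel) = ennreal (erlang_CDF k 1 t)"
    using nn_integral_erlang_density[of 1 k t] by (simp add: ennreal_mult'' ennreal_indicator)
  then have "((\<lambda>x. erlang_density k 1 x * indicator {..t} x) has_integral erlang_CDF k 1 t) UNIV"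
    by (rule nn_integral_has_integral[rotated 2]) auto
  also have "(\<lambda>x. erlang_density k 1 x * indicator {..t} x) = (\<lambda>x. if x \<in> {0..t} then x ^ k * exp (- x) / fact k else 0)"
    by (auto simp: erlang_density_def fun_eq_iff)
  finally have "((\<lambda>x. x ^ k * exp (- x) / fact k) has_integral erlang_CDF k 1 t) {0..t}"
    by (simp only: has_integral_restrict_UNIV)
  from has_integral_mult_right[OF this, of "fact k"]
  have "((\<lambda>x. x ^ k * exp (- x)) has_integral fact k * erlang_CDF k 1 t) {0..t}" by simp
  then have "((\<lambda>x. x powr (real (Suc k) - 1) * exp (- x)) has_integral fact k * erlang_CDF k 1 t) {0..t}"
    \<comment> \<open>The two integrands may differ at 0: for \<open>k\<close> = 0 the power
      \<open>0 ^ 0\<close> is 1 while \<open>0 powr 0\<close> is 0.\<close>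
    by (rule has_integral_spike[of "{0}", rotated 2]) (auto simp: powr_realpow)
  then show ?thesis unfolding lower_inc_gamma_def by (rule integral_unique)
qed

lemma erlang_CDF_measurable [measurable]: "erlang_CDF k l \<in> borel_measurable borel"
  unfolding erlang_CDF_def by measurable

text \<open>The squared moduli of the components are independent exponential variables of mean v.
  The shape index is one less than their number because \<open>erlang_density k\<close> is the law
  of a sum of k + 1 exponentials.\<close>

lemma (in prob_space) norm_squared_gaussian_vector:
  fixes g :: "'a \<Rightarrow> complex ^ 'e"
  assumes v: "v > 0"
    and ind: "indep_vars (\<lambda>_. borel) (\<lambda>i \<omega>. g \<omega> $ i) UNIV"
    and dist: "\<And>i. distributed M lborel (\<lambda>\<omega>. g \<omega> $ i) (\<lambda>z. ennreal (cscg_density v z))"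
  shows "distributed M lborel (\<lambda>\<omega>. (norm (g \<omega>))\<^sup>2) (erlang_density (CARD('e) - 1) (1 / v))"
proof -
  have [measurable]: "(\<lambda>\<omega>. g \<omega> $ i) \<in> borel_measurable M" for i
    using distributed_measurable[OF dist] by simp
  have ex: "distributed M lborel (\<lambda>\<omega>. (norm (g \<omega> $ i))\<^sup>2) (exponential_density (1 / v))" for i
  proof (rule distributedI_nn_integral)
    fix A :: "real set" assume "A \<in> sets lborel"
    then have [measurable]: "A \<in> sets borel" by simp
    have "(\<integral>\<^sup>+\<omega>. indicator A ((norm (g \<omega> $ i))\<^sup>2) \<partial>M) = (\<integral>\<^sup>+z. ennreal (cscg_density v z) * indicator A ((norm z)\<^sup>2) \<partial>lborel)"
      by (rule distributed_nn_integral[OF dist, symmetric]) measurable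
    also have "\<dots> = (\<integral>\<^sup>+t. ennreal (exponential_density (1 / v) t) * indicator A t \<partial>lborel)"
      using v by (intro nn_integral_cscg_density_norm_squared) auto
    finally show "(\<integral>\<^sup>+\<omega>. indicator A ((norm (g \<omega> $ i))\<^sup>2) \<partial>M) = (\<integral>\<^sup>+t. ennreal (exponential_density (1 / v) t) * indicator A t \<partial>lborel)" .
  qed measurable
  have "indep_vars (\<lambda>_. borel) (\<lambda>i \<omega>. (norm (g \<omega> $ i))\<^sup>2) UNIV"
    by (rule indep_vars_compose2[OF ind]) measurable
  then have "distributed M lborel (\<lambda>\<omega>. \<Sum>i\<in>UNIV. (norm (g \<omega> $ i))\<^sup>2) (erlang_density (CARD('e) - 1) (1 / v))"
    using v ex by (intro exponential_distributed_sum) auto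
  then show ?thesis by (simp add: norm_vec_squared)
qed

locale gaussian_eavesdropper = prob_space M for M :: "'s measure" +
  fixes g :: "'s \<Rightarrow> complex ^ 'e" and P v H :: real
  assumes P: "P > 0" and v: "v > 0" and H: "H \<ge> 0"
    and ind: "indep_vars (\<lambda>_. borel) (\<lambda>i \<omega>. g \<omega> $ i) UNIV"
    and dist: "\<And>i. distributed M lborel (\<lambda>\<omega>. g \<omega> $ i) (\<lambda>z. ennreal (cscg_density v z))"
begin

definition C :: real where "C = log 2 (1 + P * H\<^sup>2)"

text \<open>The secrecy rate of the Gaussian input. In \<open>converse\<close> its positive part
  dominates the secrecy rate of every admissible input.\<close>

definition rate :: "'s \<Rightarrow> real" where "rate \<omega> = C - log 2 (1 + P * (norm (g \<omega>))\<^sup>2)"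

lemmas sq_dist = norm_squared_gaussian_vector[OF v ind dist]

lemma sq_measurable [measurable]: "(\<lambda>\<omega>. (norm (g \<omega>))\<^sup>2) \<in> borel_measurable M"
  using distributed_measurable[OF sq_dist] by simp

lemma norm_measurable [measurable]: "(\<lambda>\<omega>. norm (g \<omega>)) \<in> borel_measurable M"
proof -
  have "(\<lambda>\<omega>. sqrt ((norm (g \<omega>))\<^sup>2)) \<in> borel_measurable M" by measurable
  then show ?thesis by simp
qed

lemma rate_measurable [measurable]: "rate \<in> borel_measurable M"
  unfolding rate_def log_def by measurable

lemma P_sq_pos: "0 < 1 + P * x\<^sup>2"
  using P by (simp add: add_pos_nonneg)

lemma C_nonneg: "0 \<le> C"
  using P unfolding C_def by (subst zero_le_log_cancel_iff) (auto intro: P_sq_pos)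

lemma rate_le: "rate \<omega> \<le> C"
  using P P_sq_pos[of "norm (g \<omega>)"] unfolding rate_def by (simp add: zero_le_log_cancel_iff)

text \<open>The upper limit in the incomplete gamma function, which is the largest value of |g|^2 /
  v for which the Gaussian input still supports the rate r; see \<open>le_rate_iff\<close>. It is
  negative precisely for r > C.\<close>

definition thr :: "real \<Rightarrow> real" where
  "thr r = 1 / (2 powr r * P * v) + H\<^sup>2 / (2 powr r * v) - 1 / (P * v)"

lemma thr_eq: "thr r = ((1 + P * H\<^sup>2) / 2 powr r - 1) / (P * v)"
  using P v by (simp add: thr_def field_simps)

lemma thr_nonneg_iff: "0 \<le> thr r \<longleftrightarrow> r \<le> C"
proof -
  have "0 \<le> thr r \<longleftrightarrow> 2 powr r \<le> 1 + P * H\<^sup>2"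
    using P v by (simp add: thr_eq pos_le_divide_eq[of "P * v" 0])
  also have "\<dots> \<longleftrightarrow> r \<le> C"
    unfolding C_def using le_log_iff[of 2 "1 + P * H\<^sup>2" r] P_sq_pos[of H] by simp
  finally show ?thesis .
qed

lemma le_rate_iff: "r \<le> rate \<omega> \<longleftrightarrow> (norm (g \<omega>))\<^sup>2 \<le> v * thr r"
proof -
  let ?s = "(norm (g \<omega>))\<^sup>2"
  have pos: "0 < 1 + P * ?s" "0 < 1 + P * H\<^sup>2" by (rule P_sq_pos)+
  have "r \<le> rate \<omega> \<longleftrightarrow> r \<le> log 2 ((1 + P * H\<^sup>2) / (1 + P * ?s))"
    unfolding rate_def C_def using pos by (simp add: log_divide)
  also have "\<dots> \<longleftrightarrow> 2 powr r \<le> (1 + P * H\<^sup>2) / (1 + P * ?s)"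
    using pos by (intro le_log_iff) auto
  also have "\<dots> \<longleftrightarrow> 1 + P * ?s \<le> (1 + P * H\<^sup>2) / 2 powr r"
    using pos by (simp add: pos_le_divide_eq mult.commute)
  also have "\<dots> \<longleftrightarrow> ?s \<le> ((1 + P * H\<^sup>2) / 2 powr r - 1) / P"
    using P by (subst pos_le_divide_eq) (auto simp: algebra_simps)
  also have "((1 + P * H\<^sup>2) / 2 powr r - 1) / P = v * thr r"
    using P v by (simp add: thr_eq)
  finally show ?thesis .
qed

lemma erlang_CDF_thr: "r \<le> C \<Longrightarrow> erlang_CDF (CARD('e) - 1) 1 (thr r) = gamma_term CARD('e) P v H r"
  using lower_inc_gamma_eq_erlang_CDF[of "thr r" "CARD('e) - 1"]
  unfolding gamma_term_def thr_def[symmetric] by (simp add: thr_nonneg_iff)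

lemma prob_le_rate: "prob {\<omega> \<in> space M. r \<le> rate \<omega>} = (if r \<le> C then gamma_term CARD('e) P v H r else 0)"
proof (cases "r \<le> C")
  case True
  have "prob {\<omega> \<in> space M. r \<le> rate \<omega>} = erlang_CDF (CARD('e) - 1) (1 / v) (v * thr r)"
    unfolding le_rate_iff using v True by (intro erlang_distributed_le[OF sq_dist]) (auto simp: thr_nonneg_iff)
  also have "\<dots> = erlang_CDF (CARD('e) - 1) 1 (thr r)"
    using v by (subst erlang_CDF_transform) auto
  finally show ?thesis using True by (simp add: erlang_CDF_thr[simplified])
next
  case False
  \<comment> \<open>Even a vanishing eavesdropper channel leaves a rate of at most \<open>C\<close>,
    the information of the legitimate link.\<close>
  then have "{\<omega> \<in> space M. r \<le> rate \<omega>} = {}" using rate_le by (auto intro: order_trans)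
  then show ?thesis using False by (simp only: if_False measure_empty)
qed

lemma prob_rate_less: "prob {\<omega> \<in> space M. rate \<omega> < r} = (if r \<le> C then 1 - gamma_term CARD('e) P v H r else 1)"
proof -
  have "{\<omega> \<in> space M. rate \<omega> < r} = space M - {\<omega> \<in> space M. r \<le> rate \<omega>}" by auto
  then have "prob {\<omega> \<in> space M. rate \<omega> < r} = 1 - prob {\<omega> \<in> space M. r \<le> rate \<omega>}"
    by (simp add: prob_compl)
  then show ?thesis by (simp add: prob_le_rate)
qed

lemma integrable_pos_rate: "integrable M (\<lambda>\<omega>. max 0 (rate \<omega>))"
  by (rule integrable_const_bound[of _ C]) (auto simp: C_nonneg rate_le)

text \<open>Layer cake formula: the positive part of \<open>rate\<close> is the length of the set of
  r in {0..C} with r <= rate. Exchanging the integrals leaves the integral of the tail probability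
  over r.\<close>

lemma expectation_pos_rate: "expectation (\<lambda>\<omega>. max 0 (rate \<omega>)) = integral {0..C} (gamma_term CARD('e) P v H)"
proof -
  interpret pair_sigma_finite M "lborel :: real measure" ..
  let ?E = "expectation (\<lambda>\<omega>. max 0 (rate \<omega>))"
  \<comment> \<open>Written through \<open>erlang_CDF\<close>, for which measurability is at hand;
    on {0..C} it equals \<open>gamma_term\<close>.\<close>
  define f where "f r = indicator {0..C} r * erlang_CDF (CARD('e) - 1) 1 (thr r)" for r
  have [measurable]: "f \<in> borel_measurable borel" unfolding f_def thr_def by measurable
  have f_nn: "0 \<le> f r" for r unfolding f_def by simp
  have f_eq: "f r = (if r \<in> {0..C} then gamma_term CARD('e) P v H r else 0)" for r
    by (auto simp: f_def erlang_CDF_thr[simplified])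
  have "ennreal ?E = (\<integral>\<^sup>+\<omega>. ennreal (max 0 (rate \<omega>)) \<partial>M)"
    by (rule nn_integral_eq_integral[symmetric, OF integrable_pos_rate]) auto
  also have "\<dots> = (\<integral>\<^sup>+\<omega>. \<integral>\<^sup>+r. indicator {0..C} r * indicator {r. r \<le> rate \<omega>} r \<partial>lborel \<partial>M)"
  proof (rule nn_integral_cong)
    fix \<omega>
    have "(\<integral>\<^sup>+r. indicator {0..C} r * indicator {r. r \<le> rate \<omega>} r \<partial>lborel) = (\<integral>\<^sup>+r. indicator {0..rate \<omega>} r \<partial>lborel)"
      using rate_le[of \<omega>] by (intro nn_integral_cong) (auto simp: indicator_def)
    also have "\<dots> = ennreal (max 0 (rate \<omega>))"
      by (simp add: emeasure_lborel_Icc_eq max_def)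
    finally show "ennreal (max 0 (rate \<omega>)) = (\<integral>\<^sup>+r. indicator {0..C} r * indicator {r. r \<le> rate \<omega>} r \<partial>lborel)" ..
  qed
  also have "\<dots> = (\<integral>\<^sup>+r. \<integral>\<^sup>+\<omega>. indicator {0..C} r * indicator {r. r \<le> rate \<omega>} r \<partial>M \<partial>lborel)"
    by (rule Fubini'[symmetric]) measurable
  also have "\<dots> = (\<integral>\<^sup>+r. ennreal (f r) \<partial>lborel)"
  proof (rule nn_integral_cong)
    fix r
    have "(\<integral>\<^sup>+\<omega>. indicator {0..C} r * indicator {r. r \<le> rate \<omega>} r \<partial>M) = 
      indicator {0..C} r * (\<integral>\<^sup>+\<omega>. indicator {\<omega> \<in> space M. r \<le> rate \<omega>} \<omega> \<partial>M)"
      by (subst nn_integral_cmult[symmetric], measurable) (intro nn_integral_cong, auto simp: indicator_def)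
    also have "\<dots> = indicator {0..C} r * ennreal (prob {\<omega> \<in> space M. r \<le> rate \<omega>})"
      by (simp add: emeasure_eq_measure)
    also have "\<dots> = ennreal (f r)"
      by (auto simp: f_eq prob_le_rate indicator_def)
    finally show "(\<integral>\<^sup>+\<omega>. indicator {0..C} r * indicator {r. r \<le> rate \<omega>} r \<partial>M) = ennreal (f r)" .
  qed
  finally have "(\<integral>\<^sup>+r. ennreal (f r) \<partial>lborel) = ennreal ?E" ..
  then have "(f has_integral ?E) UNIV"
    by (rule nn_integral_has_integral[rotated 2]) (auto simp: f_nn)
  then have "(gamma_term CARD('e) P v H has_integral ?E) {0..C}"
    unfolding f_eq[abs_def] by (simp only: has_integral_restrict_UNIV)
  then show ?thesis by (simp add: integral_unique)
qed

lemma achievability: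
  fixes h :: "complex ^ 'b"
  assumes h: "norm h = H"
  shows "\<exists>(U :: complex measure) p. admissible_input U P p \<and>
     (\<forall>r. SOP U p M (\<lambda>_. h) g r = prob {\<omega> \<in> space M. rate \<omega> < r}) \<and>
     EPSR U p M (\<lambda>_. h) g = expectation (\<lambda>\<omega>. max 0 (rate \<omega>))"
proof -
  obtain p where p: "admissible_input (borel :: complex measure) P p" 
    and sr: "\<And>(h :: complex ^ 'b) (g :: complex ^ 'e). secrecy_rate borel p h g = log 2 (1 + P * (norm h)\<^sup>2) - log 2 (1 + P * (norm g)\<^sup>2)"
    using gaussian_input_secrecy_rate[OF P] by blast
  have "secrecy_rate borel p h (g \<omega>) = rate \<omega>" for \<omega>
    unfolding sr rate_def C_def h ..
  then show ?thesis using p by (intro exI[of _ borel] exI[of _ p]) (simp add: SOP_def EPSR_def)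
qed

text \<open>Pointwise comparison: for |g| <= |h| the gap bound gives at most \<open>rate\<close>,
  and for |g| > |h| monotonicity of \<open>J\<close> gives at most 0.\<close>

lemma converse:
  fixes h :: "complex ^ 'b"
  assumes h: "norm h = H" and p: "admissible_input U P p"
  shows "0 < r \<Longrightarrow> prob {\<omega> \<in> space M. rate \<omega> < r} \<le> SOP U p M (\<lambda>_. h) g r"
    and "EPSR U p M (\<lambda>_. h) g \<le> expectation (\<lambda>\<omega>. max 0 (rate \<omega>))"
proof -
  interpret channel_input U p P by unfold_locales (use p P in auto)
  obtain J where sr: "\<And>(h :: complex ^ 'b) (g :: complex ^ 'e). secrecy_rate U p h g = J (norm h) - J (norm g)"
    and mono_J: "\<And>a b. 0 \<le> b \<Longrightarrow> b \<le> a \<Longrightarrow> J b \<le> J a"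
    and diff_J: "\<And>a b. 0 \<le> b \<Longrightarrow> b \<le> a \<Longrightarrow> J a - J b \<le> log 2 (1 + P * a\<^sup>2) - log 2 (1 + P * b\<^sup>2)"
    using secrecy_rate_information_function by metis
  let ?s = "\<lambda>\<omega>. secrecy_rate U p h (g \<omega>)"
  have le: "?s \<omega> \<le> max 0 (rate \<omega>)" for \<omega>
    using mono_J[of H "norm (g \<omega>)"] diff_J[of "norm (g \<omega>)" H] H
    unfolding sr h rate_def C_def by (cases "norm (g \<omega>) \<le> H") auto
  \<comment> \<open>Measurability of the secrecy rate in the channel state comes from monotonicity
    of \<open>J\<close>, extended by a constant to negative gains.\<close>
  have "mono (\<lambda>x. J (max 0 x))" by (intro monoI mono_J) auto
  then have "(\<lambda>x. J (max 0 x)) \<in> borel_measurable borel" by (rule borel_measurable_mono)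
  from measurable_compose[OF norm_measurable this]
  have [measurable]: "?s \<in> borel_measurable M" unfolding sr by simp
  show "prob {\<omega> \<in> space M. rate \<omega> < r} \<le> SOP U p M (\<lambda>_. h) g r" if "0 < r"
    unfolding SOP_def
  proof (rule finite_measure_mono)
    show "{\<omega> \<in> space M. rate \<omega> < r} \<subseteq> {\<omega> \<in> space M. ?s \<omega> < r}"
    proof safe
      fix \<omega> assume "rate \<omega> < r"
      \<comment> \<open>Here r > 0 is essential: \<open>rate\<close> below r then forces its
        positive part below r.\<close>
      with le[of \<omega>] that show "?s \<omega> < r" by linarith
    qed
  qed measurable
  show "EPSR U p M (\<lambda>_. h) g \<le> expectation (\<lambda>\<omega>. max 0 (rate \<omega>))"
    unfolding EPSR_def
  proof (rule integral_mono)
    show "integrable M (\<lambda>\<omega>. max 0 (?s \<omega>))"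
      using le by (intro Bochner_Integration.integrable_bound[OF integrable_pos_rate]) (auto simp: abs_of_nonneg)
    show "max 0 (?s \<omega>) \<le> max 0 (rate \<omega>)" for \<omega> using le[of \<omega>] by simp
  qed (rule integrable_pos_rate)
qed

end

text \<open>The Gaussian input with u = x attains the outage minima for all r > 0 and the ergodic
  maximum simultaneously, because the comparison with other inputs is made for each channel state
  separately.\<close>

theorem mainTheorem7:
  fixes P \<sigma> :: real
    and h :: "complex ^ 'b"
    and M :: "'s measure"
    and g :: "'s \<Rightarrow> complex ^ 'e"
  assumes "P > 0" and "\<sigma> > 0"
    and "prob_space M"
    and "prob_space.indep_vars M (\<lambda>_. borel) (\<lambda>i \<omega>. g \<omega> $ i) UNIV"
    and "\<And>i. distributed M lborel (\<lambda>\<omega>. g \<omega> $ i) (\<lambda>z. ennreal (cscg_density (\<sigma>\<^sup>2) z))"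
  defines "C \<equiv> log 2 (1 + P * (norm h)\<^sup>2)"
  defines "SOPstar \<equiv> (\<lambda>r. if r \<le> C then 1 - gamma_term CARD('e) P (\<sigma>\<^sup>2) (norm h) r else 1)"
  defines "EPSRstar \<equiv> integral {0..C} (gamma_term CARD('e) P (\<sigma>\<^sup>2) (norm h))"
  shows "(\<forall>r>0.
            (\<forall>(U :: 'u measure) p. admissible_input U P p \<longrightarrow> SOPstar r \<le> SOP U p M (\<lambda>_. h) g r) \<and>
            (\<exists>(U :: complex measure) p. admissible_input U P p \<and> SOP U p M (\<lambda>_. h) g r = SOPstar r)) \<and>
         (\<forall>(U :: 'u measure) p. admissible_input U P p \<longrightarrow> EPSR U p M (\<lambda>_. h) g \<le> EPSRstar) \<and>
         (\<exists>(U :: complex measure) p. admissible_input U P p \<and> EPSR U p M (\<lambda>_. h) g = EPSRstar)"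
proof -
  interpret prob_space M by fact
  interpret E: gaussian_eavesdropper M g P "\<sigma>\<^sup>2" "norm h"
    by unfold_locales (use assms in auto)
  have C: "E.C = C" unfolding C_def E.C_def ..
  have SOPstar: "SOPstar r = prob {\<omega> \<in> space M. E.rate \<omega> < r}" for r
    unfolding SOPstar_def E.prob_rate_less C ..
  have EPSRstar: "EPSRstar = expectation (\<lambda>\<omega>. max 0 (E.rate \<omega>))"
    unfolding EPSRstar_def E.expectation_pos_rate C ..
  show ?thesis
    unfolding SOPstar EPSRstar
    using E.achievability[OF refl] E.converse[OF refl] by blast
qed

end
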